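(* Let $0<\lambda<1$. Under each of the three regimes (High Memory, High Message, Constrained) of the RCPB policy, let $\pi^n$ be the unique invariant distribution of $(S^n(t),M^n(t))$ and let $\pi^n_s(\cdot)=\sum_{m=0}^{c(n)}\pi^n(\cdot,m)$ be its marginal for $S^n$. Then $$\lim_{n\to\infty}\pi^n_s=\delta_{s^*}\quad\text{in distribution},$$ where $\delta_{s^*}$ is the Dirac measure at $s^*$, the point with $s_0^*=1$ and $s_i^*=\lambda(\lambda P_0^* )^{i-1}$ for $i\ge1$, with $P_0^*=\left[1-\frac{\mu(1-\lambda)}{\lambda}\right]^+$ (High Memory), $P_0^*=0$ (High Message), $P_0^*=\left[\sum_{k=0}^{c}\left(\frac{\mu(1-\lambda)}{\lambda}\right)^k\right]^{-1}$ (Constrained).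
   Context: Notation: $[x]^+=\max\{x,0\}$; $0^0=1$; $\mathcal{S}=\{s\in[0,1]^{\mathbb{Z}_+}: s_0=1,\ s_i\ge s_{i+1}\}$, $\mathcal{S}^1=\{s\in\mathcal{S}:\sum_i s_i<\infty\}$, with the topology of the norm $\|x\|_w^2=\sum_{i\ge0}|x_i|^2/2^i$; convergence in distribution is weak convergence of probability measures for this topology. Model: for each $n$ there are $n$ unit-rate servers, each with its own infinite-capacity FIFO queue (a job in service counts as in queue). Jobs arrive as a Poisson process of rate $\lambda n$, with i.i.d. exponential mean-$1$ sizes independent of arrivals. RCPB policy with parameters $c(n)\in\{1,\dots,n\}$ and $\mu(n)>0$: the dispatcher stores up to $c(n)$ server IDs (tokens); each idle server sends messages as a Poisson process of rate $\mu(n)$, and upon receipt its ID is stored unless it is already stored or memory is full; an arriving job is sent to a server chosen uniformly among stored tokens (that token is deleted), or to a uniformly random queue if there are no tokens. With $Q^n_i(t)$ the number of jobs in queue $i$ and $M^n(t)$ the number of tokens, $(Q^n,M^n)$ is a continuous-time Markov chain on $\{(q,m)\in\mathbb{Z}_+^n\times\{0,\dots,c(n)\}:\sum_i\mathbf{1}_{\{q_i=0\}}\ge m\}$ with rates: $(q,0)\to(q+e_i,0)$ at rate $\lambda$; for $m>0$, $(q,m)\to(q+e_i,m-1)$ at rate $n\lambda\mathbf{1}_{\{q_i=0\}}/\sum_j\mathbf{1}_{\{q_j=0\}}$; $(q,m)\to(q-e_i,m)$ at rate $\mathbf{1}_{\{q_i>0\}}$; $(q,m)\to(q,m+1)$ at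 rate $\mu(n)(\sum_i\mathbf{1}_{\{q_i=0\}}-m)\mathbf{1}_{\{m<c(n)\}}$. $S^n_i(t)=\frac1n\sum_{j=1}^n\mathbf{1}_{\{Q^n_j(t)\ge i\}}$, $S^n=(S^n_i)_{i\ge0}$; $(S^n,M^n)$ is itself a Markov process, positive recurrent with a unique invariant distribution $\pi^n$. Regimes: High Memory: $c(n)\to\infty$, $c(n)/n\to0$, $\mu(n)=\mu>0$ constant. High Message: $c(n)=c\ge1$ constant, $\mu(n)$ nondecreasing with $\mu(n)\to\infty$. Constrained: $c(n)=c\ge1$ and $\mu(n)=\mu>0$ constants. (When $c(n)=c$ is constant only $n\ge c$ is considered.) *)

theory Defs
  imports "HOL-Probability.Probability"
begin

section \<open>Continuous-time Markov chains\<close>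

text \<open>
  A (standard, honest) transition function \<open>P\<close> on a countable state space \<open>X\<close>
  whose transition rates are \<open>r x y\<close> for \<open>x \<noteq> y\<close>; the diagonal of \<open>r\<close> is irrelevant.
  The last clause says that the total rate out of \<open>x\<close> is the sum of the rates \<open>r x y\<close>
  (stable and conservative rates). If these total rates are bounded, as below, \<open>P\<close> is
  uniquely determined on \<open>X\<close> and on nonnegative times.
\<close>

definition transition_function ::
  "'a set \<Rightarrow> ('a \<Rightarrow> 'a \<Rightarrow> real) \<Rightarrow> (real \<Rightarrow> 'a \<Rightarrow> 'a pmf) \<Rightarrow> bool" where
  "transition_function X r P \<longleftrightarrow>
     (\<forall>x\<in>X. \<forall>t\<ge>0. set_pmf (P t x) \<subseteq> X) \<and>
     (\<forall>x\<in>X. P 0 x = return_pmf x) \<and>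
     (\<forall>x\<in>X. \<forall>s\<ge>0. \<forall>t\<ge>0. P (s + t) x = bind_pmf (P s x) (P t)) \<and>
     (\<forall>x\<in>X. \<forall>y\<in>X. x \<noteq> y \<longrightarrow> ((\<lambda>t. pmf (P t x) y / t) \<longlongrightarrow> r x y) (at_right 0)) \<and>
     (\<forall>x\<in>X. ((\<lambda>t. (1 - pmf (P t x) x) / t) \<longlongrightarrow> (\<Sum>\<^sub>\<infinity>y\<in>X - {x}. r x y)) (at_right 0))"

text \<open>
  If the process with transition function \<open>P\<close> on \<open>X\<close> is observed through \<open>f\<close>, then
  \<open>R\<close> is the transition function of the observed process on \<open>f ` X\<close>: the law of the image
  at time \<open>t\<close> depends on the initial state \<open>x\<close> only through \<open>f x\<close>, and equals \<open>R t (f x)\<close>.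
\<close>

definition image_transition_function ::
  "'a set \<Rightarrow> ('a \<Rightarrow> 'b) \<Rightarrow> (real \<Rightarrow> 'a \<Rightarrow> 'a pmf) \<Rightarrow> (real \<Rightarrow> 'b \<Rightarrow> 'b pmf) \<Rightarrow> bool" where
  "image_transition_function X f P R \<longleftrightarrow>
     (\<forall>x\<in>X. \<forall>t\<ge>0. R t (f x) = map_pmf f (P t x))"

definition invariant_distribution ::
  "'a set \<Rightarrow> (real \<Rightarrow> 'a \<Rightarrow> 'a pmf) \<Rightarrow> 'a pmf \<Rightarrow> bool" where
  "invariant_distribution X P \<pi> \<longleftrightarrow>
     set_pmf \<pi> \<subseteq> X \<and> (\<forall>t\<ge>0. bind_pmf \<pi> (P t) = \<pi>)"

section \<open>The RCPB policy\<close>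

text \<open>
  A state is a pair \<open>(q, m)\<close>: the list \<open>q\<close> of the \<open>n\<close> queue lengths (servers are numbered
  from \<open>0\<close>) and the number \<open>m\<close> of stored tokens.
\<close>

type_synonym rcpb_state = "nat list \<times> nat"

definition idle :: "nat list \<Rightarrow> nat" where
  "idle q = card {i. i < length q \<and> q ! i = 0}"

definition rcpb_states :: "nat \<Rightarrow> nat \<Rightarrow> rcpb_state set" where
  "rcpb_states n c = {(q, m). length q = n \<and> m \<le> c \<and> m \<le> idle q}"

text \<open>
  The four summands are: arrival with no token stored, arrival with a token stored,
  service completion, and storage of a new token. Different transitions out of a state lead
  to different states, so at most one of the terms is nonzero.
\<close>

definition rcpb_rate ::
  "real \<Rightarrow> nat \<Rightarrow> real \<Rightarrow> nat \<Rightarrow> rcpb_state \<Rightarrow> rcpb_state \<Rightarrow> real" where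
  "rcpb_rate lam c mu n x y = (case x of (q, m) \<Rightarrow>
     (\<Sum>i<n. if m = 0 \<and> y = (q[i := q ! i + 1], 0) then lam else 0) +
     (\<Sum>i<n. if m > 0 \<and> y = (q[i := q ! i + 1], m - 1)
             then real n * lam * (if q ! i = 0 then 1 else 0) / real (idle q) else 0) +
     (\<Sum>i<n. if q ! i > 0 \<and> y = (q[i := q ! i - 1], m) then 1 else 0) +
     (if m < c \<and> y = (q, m + 1) then mu * (real (idle q) - real m) else 0))"

definition queue_fractions :: "nat \<Rightarrow> nat list \<Rightarrow> nat \<Rightarrow> real" where
  "queue_fractions n q = (\<lambda>i. real (card {j. j < n \<and> q ! j \<ge> i}) / real n)"

definition rcpb_observe :: "nat \<Rightarrow> rcpb_state \<Rightarrow> (nat \<Rightarrow> real) \<times> nat" where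
  "rcpb_observe n = (\<lambda>(q, m). (queue_fractions n q, m))"

section \<open>The space of fraction vectors and weak convergence\<close>

definition fraction_space :: "(nat \<Rightarrow> real) set" where
  "fraction_space = {s. (\<forall>i. 0 \<le> s i \<and> s i \<le> 1) \<and> s 0 = 1 \<and> (\<forall>i. s (Suc i) \<le> s i)}"

definition norm_w :: "(nat \<Rightarrow> real) \<Rightarrow> real" where
  "norm_w x = sqrt (\<Sum>\<^sub>\<infinity>i. \<bar>x i\<bar>\<^sup>2 / 2 ^ i)"

definition dist_w :: "(nat \<Rightarrow> real) \<Rightarrow> (nat \<Rightarrow> real) \<Rightarrow> real" where
  "dist_w x y = norm_w (\<lambda>i. x i - y i)"

abbreviation fraction_topology :: "(nat \<Rightarrow> real) topology" where
  "fraction_topology \<equiv> Metric_space.mtopology fraction_space dist_w"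

lemma summable_norm_w:
  fixes x :: "nat \<Rightarrow> real"
  assumes "\<And>i. \<bar>x i\<bar> \<le> 1"
  shows "summable (\<lambda>i. \<bar>x i\<bar>\<^sup>2 / 2 ^ i)"
proof (rule summable_comparison_test')
  show "summable (\<lambda>i. (1 / 2 :: real) ^ i)"
    by (rule summable_geometric) simp
  show "norm (\<bar>x i\<bar>\<^sup>2 / 2 ^ i) \<le> (1 / 2) ^ i" if "i \<ge> 0" for i
    using power_mono[OF assms[of i], of 2] by (simp add: power_divide divide_right_mono)
qed

lemma summable_dist_w:
  assumes "x \<in> fraction_space" "y \<in> fraction_space"
  shows "summable (\<lambda>i. \<bar>x i - y i\<bar>\<^sup>2 / 2 ^ i)"
proof (rule summable_norm_w)
  fix i
  have "0 \<le> x i" "x i \<le> 1" "0 \<le> y i" "y i \<le> 1"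
    using assms by (auto simp: fraction_space_def)
  then show "\<bar>x i - y i\<bar> \<le> 1" by linarith
qed

lemma dist_w_eq_suminf:
  assumes "x \<in> fraction_space" "y \<in> fraction_space"
  shows "dist_w x y = sqrt (\<Sum>i. \<bar>x i - y i\<bar>\<^sup>2 / 2 ^ i)"
proof -
  have "(\<Sum>\<^sub>\<infinity>i. \<bar>x i - y i\<bar>\<^sup>2 / 2 ^ i) = (\<Sum>i. \<bar>x i - y i\<bar>\<^sup>2 / 2 ^ i)"
    using summable_dist_w[OF assms]
    by (intro infsumI norm_summable_imp_has_sum summable_sums) simp_all
  then show ?thesis by (simp add: dist_w_def norm_w_def)
qed

lemma Metric_space_fraction_space: "Metric_space fraction_space dist_w"
proof
  fix x y :: "nat \<Rightarrow> real"
  show "0 \<le> dist_w x y"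
    unfolding dist_w_def norm_w_def by (intro real_sqrt_ge_zero infsum_nonneg) simp
  show "dist_w x y = dist_w y x"
    by (simp add: dist_w_def norm_w_def power2_commute)
next
  fix x y assume xy: "x \<in> fraction_space" "y \<in> fraction_space"
  have "dist_w x y = 0 \<longleftrightarrow> (\<forall>i. \<bar>x i - y i\<bar>\<^sup>2 / 2 ^ i = 0)"
    using suminf_eq_zero_iff[OF summable_dist_w[OF xy]] by (simp add: dist_w_eq_suminf[OF xy])
  then show "dist_w x y = 0 \<longleftrightarrow> x = y" by (auto simp: fun_eq_iff)
next
  fix x y z
  assume x: "x \<in> fraction_space" and y: "y \<in> fraction_space" and z: "z \<in> fraction_space"
  let ?L = "\<lambda>x y n. L2_set (\<lambda>i. (x i - y i) / sqrt (2 ^ i)) {..<n}"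
  have lim: "?L x y \<longlonglongrightarrow> dist_w x y" if "x \<in> fraction_space" "y \<in> fraction_space" for x y
    using tendsto_real_sqrt[OF summable_LIMSEQ[OF summable_dist_w[OF that]]]
    by (simp add: L2_set_def dist_w_eq_suminf[OF that] power_divide)
  show "dist_w x z \<le> dist_w x y + dist_w y z"
  proof (rule LIMSEQ_le[OF lim[OF x z] tendsto_add[OF lim[OF x y] lim[OF y z]]], intro exI allI impI)
    fix n
    show "?L x z n \<le> ?L x y n + ?L y z n"
      using L2_set_triangle_ineq[of "\<lambda>i. (x i - y i) / sqrt (2 ^ i)"
          "\<lambda>i. (y i - z i) / sqrt (2 ^ i)" "{..<n}"]
      by (simp add: add_divide_distrib[symmetric])
  qed
qed

text \<open>
  Weak convergence of discrete probability measures on a topological space \<open>X\<close>. All laws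
  are meant to be carried by \<open>topspace X\<close>, so values of \<open>f\<close> outside it are irrelevant.
\<close>

definition weakly_converges :: "'a topology \<Rightarrow> (nat \<Rightarrow> 'a pmf) \<Rightarrow> 'a pmf \<Rightarrow> bool" where
  "weakly_converges X \<nu> \<nu>' \<longleftrightarrow>
     (\<forall>f. continuous_map X euclideanreal f \<and> bounded (f ` topspace X) \<longrightarrow>
        (\<lambda>n. measure_pmf.expectation (\<nu> n) f) \<longlonglongrightarrow> measure_pmf.expectation \<nu>' f)"

section \<open>Regimes and the limit point\<close>

text \<open>The arguments are the values of those parameters that do not depend on \<open>n\<close>.\<close>

datatype regime =
    High_Memory real      \<comment> \<open>constant message rate\<close>
  | High_Message nat      \<comment> \<open>constant memory size\<close>
  | Constrained nat real  \<comment> \<open>constant memory size and message rate\<close>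

fun in_regime :: "regime \<Rightarrow> (nat \<Rightarrow> nat) \<Rightarrow> (nat \<Rightarrow> real) \<Rightarrow> bool" where
  "in_regime (High_Memory mu0) c mu \<longleftrightarrow>
     (\<forall>n\<ge>1. 1 \<le> c n \<and> c n \<le> n) \<and>
     filterlim c at_top sequentially \<and> (\<lambda>n. real (c n) / real n) \<longlonglongrightarrow> 0 \<and>
     mu0 > 0 \<and> (\<forall>n. mu n = mu0)"
| "in_regime (High_Message c0) c mu \<longleftrightarrow>
     c0 \<ge> 1 \<and> (\<forall>n. c n = c0) \<and>
     (\<forall>n\<ge>c0. mu n > 0) \<and> mono_on {c0..} mu \<and> filterlim mu at_top sequentially"
| "in_regime (Constrained c0 mu0) c mu \<longleftrightarrow>
     c0 \<ge> 1 \<and> (\<forall>n. c n = c0) \<and> mu0 > 0 \<and> (\<forall>n. mu n = mu0)"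

fun P0_star :: "regime \<Rightarrow> real \<Rightarrow> real" where
  "P0_star (High_Memory mu0) lam = max (1 - mu0 * (1 - lam) / lam) 0"
| "P0_star (High_Message c0) lam = 0"
| "P0_star (Constrained c0 mu0) lam = inverse (\<Sum>k=0..c0. (mu0 * (1 - lam) / lam) ^ k)"

definition s_star :: "regime \<Rightarrow> real \<Rightarrow> nat \<Rightarrow> real" where
  "s_star reg lam = (\<lambda>i. if i = 0 then 1 else lam * (lam * P0_star reg lam) ^ (i - 1))"

end

theory Submission
  imports Defs
begin

text \<open>
  At equilibrium the generator of the chain, applied to a bounded observable, has expectation zero
  (\<open>invariant_generator_expectation_zero\<close>). The theorem follows from this identity for a few
  families of observables of the fractions \<open>S\<close> and of the token count \<open>M\<close>; trajectories and their
  fluid limits do not appear. Write \<open>G\<close> for the indicator of \<open>M = 0\<close>.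

  The observables \<open>S k\<close> give \<open>E (S 1) = lam\<close> and, after summation over coordinates,
  \<open>E (S (k + 1)) = lam * E (G * S k)\<close>. Hence \<open>E (S k) \<le> lam ^ k\<close> for every number \<open>n\<close> of servers, which
  bounds all tails.

  The observables \<open>g S * h M\<close> with a Lipschitz function \<open>g\<close> expose the fast motion of the tokens: an
  arrival or a departure changes \<open>g S\<close> by \<open>O(1/n)\<close>, while \<open>M\<close> jumps by one at a rate of order \<open>n\<close>.
  After division by \<open>n\<close> only the token jumps remain (\<open>E_token_balance\<close>), and they say that
  given \<open>S\<close> the token count has asymptotically the equilibrium law of a birth and death chain on \<open>{0..c}\<close>
  with ratio \<open>rho = mu * (1 - S 1) / lam\<close>. So inside expectations \<open>G\<close> can be replaced by a nondecreasing function
  \<open>p\<close> of \<open>S 1\<close>: the inverse of \<open>1 + rho + ... + rho ^ c\<close> when \<open>c\<close> is constant, the positive part of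
  \<open>1 - rho\<close> when \<open>c\<close> tends to infinity, and \<open>0\<close> when \<open>mu\<close> tends to infinity. In the last case the
  replacement may fail where \<open>S 1\<close> is close to \<open>1\<close>, so the upper half of the comparison is asked only
  for test functions bounded by a multiple of \<open>1 - S 1\<close>; this is what the locale
  \<open>averaged_rcpb_sequence\<close> records, and the rest of the argument is common to the three regimes.

  With \<open>G\<close> replaced by \<open>p (S 1)\<close>, the drift of \<open>S\<close> is cooperative: each coordinate is pushed up when
  the others grow. Therefore the sum of the positive parts of \<open>S k - s* k\<close> decreases at least at the speed
  given by the positive part of \<open>S 1 - lam\<close>. In equilibrium nothing can decrease on average, so that
  positive part vanishes in the limit (\<open>E_S1_excess_le\<close>, with a smoothed positive part and finitely many
  coordinates). Since \<open>E (S 1) = lam\<close> exactly, \<open>S 1\<close> converges to \<open>lam\<close> in mean.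

  Concentration then climbs from one coordinate to the next. The observable \<open>(S k - s* k) * g S\<close>
  shows that \<open>g S\<close> is asymptotically orthogonal to the drift of \<open>S k\<close> once \<open>S k\<close> is concentrated.
  If \<open>S (k - 1)\<close> is concentrated as well, that drift is, up to vanishing terms,
  \<open>S (k + 1) - s* (k + 1)\<close>, and taking this for \<open>g S\<close> gives convergence in mean square
  (\<open>vanishing_fraction_step\<close>). Convergence of every coordinate to a constant implies weak
  convergence to the Dirac measure, because the weights in the metric make the tails uniformly small.
\<close>

section \<open>The generator at equilibrium\<close>

lemma integrable_pmf_bounded:
  fixes f :: "'a \<Rightarrow> real"
  assumes "\<And>x. x \<in> set_pmf p \<Longrightarrow> \<bar>f x\<bar> \<le> B"
  shows "integrable (measure_pmf p) f"
  by (rule measure_pmf.integrable_const_bound[where B=B]) (use assms in \<open>auto simp: AE_measure_pmf_iff\<close>)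

lemma expectation_pmf_mono:
  fixes f g :: "'a \<Rightarrow> real"
  assumes "\<And>x. x \<in> set_pmf p \<Longrightarrow> \<bar>f x\<bar> \<le> A" "\<And>x. x \<in> set_pmf p \<Longrightarrow> \<bar>g x\<bar> \<le> B"
    and "\<And>x. x \<in> set_pmf p \<Longrightarrow> f x \<le> g x"
  shows "measure_pmf.expectation p f \<le> measure_pmf.expectation p g"
  by (rule integral_mono_AE[OF integrable_pmf_bounded[OF assms(1)] integrable_pmf_bounded[OF assms(2)]])
     (use assms in \<open>auto simp: AE_measure_pmf_iff\<close>)

lemma expectation_pmf_cong:
  fixes f g :: "'a \<Rightarrow> real"
  assumes "\<And>x. x \<in> set_pmf p \<Longrightarrow> f x = g x"
  shows "measure_pmf.expectation p f = measure_pmf.expectation p g"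
  by (rule integral_cong_AE) (use assms in \<open>auto simp: AE_measure_pmf_iff\<close>)

lemma expectation_pmf_abs_le:
  fixes f :: "'a \<Rightarrow> real"
  assumes "\<And>x. x \<in> set_pmf p \<Longrightarrow> \<bar>f x\<bar> \<le> B"
  shows "\<bar>measure_pmf.expectation p f\<bar> \<le> B"
proof -
  have *: "- B \<le> f x \<and> f x \<le> B" "\<bar>B\<bar> \<le> \<bar>B\<bar>" "\<bar>-B\<bar> \<le> \<bar>B\<bar>" if "x \<in> set_pmf p" for x
    using assms[OF that] by auto
  have "measure_pmf.expectation p f \<le> measure_pmf.expectation p (\<lambda>_. B)"
    by (rule expectation_pmf_mono[OF assms]) (use * in blast)+
  moreover have "measure_pmf.expectation p (\<lambda>_. - B) \<le> measure_pmf.expectation p f"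
    by (rule expectation_pmf_mono[OF _ assms]) (use * in blast)+
  ultimately show ?thesis by simp
qed

text \<open>
  By the Markov property, staying put over time \<open>t\<close> is at least as likely as being found at \<open>x\<close> at each
  of the times \<open>t/k, 2t/k, ..., t\<close>. So the infinitesimal bound on the exit probability, which
  is only a limit at \<open>0\<close>, holds for all \<open>t\<close>. It is the domination that allows the derivative at \<open>0\<close>
  to be taken under the expectation in \<open>invariant_generator_expectation_zero\<close>.
\<close>
lemma transition_leave_bound:
  assumes tf: "transition_function X r P" and x: "x \<in> X"
    and q: "(\<Sum>\<^sub>\<infinity>y\<in>X - {x}. r x y) \<le> q" and t: "0 \<le> t"
  shows "1 - pmf (P t x) x \<le> q * t"
proof (cases "t = 0")
  case True
  then show ?thesis using tf x by (auto simp: transition_function_def)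
next
  case False
  with t have t: "t > 0" by simp
  define Q where "Q = (\<Sum>\<^sub>\<infinity>y\<in>X - {x}. r x y)"
  let ?a = "\<lambda>k. pmf (P (t / real (Suc k)) x) x"
  have mult: "pmf (P s x) x * pmf (P u x) x \<le> pmf (P (s + u) x) x" if "s \<ge> 0" "u \<ge> 0" for s u
  proof -
    have "pmf (P s x) x * pmf (P u x) x
        = measure_pmf.expectation (P s x) (\<lambda>y. indicator {x} y * pmf (P u x) x)"
      by (simp add: measure_pmf_single)
    also have "\<dots> \<le> measure_pmf.expectation (P s x) (\<lambda>y. pmf (P u y) x)"
      by (rule expectation_pmf_mono[where A=1 and B=1])
         (auto simp: pmf_le_1 indicator_def)
    also have "\<dots> = pmf (P (s + u) x) x"
      using tf x that by (simp add: transition_function_def pmf_bind)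
    finally show ?thesis .
  qed
  have pow: "pmf (P h x) x ^ k \<le> pmf (P (real k * h) x) x" if h: "h \<ge> 0" for h k
  proof (induction k)
    case 0
    then show ?case using tf x by (simp add: transition_function_def)
  next
    case (Suc k)
    have "pmf (P h x) x ^ Suc k \<le> pmf (P h x) x * pmf (P (real k * h) x) x"
      using Suc by (simp add: mult_left_mono)
    also have "\<dots> \<le> pmf (P (h + real k * h) x) x"
      using h by (intro mult) auto
    finally show ?case by (simp add: algebra_simps)
  qed
  have lim0: "((\<lambda>t. (1 - pmf (P t x) x) / t) \<longlongrightarrow> Q) (at_right 0)"
    using tf x by (simp add: transition_function_def Q_def)
  have seq: "filterlim (\<lambda>k. t / real (Suc k)) (at_right 0) sequentially"
  proof (rule tendsto_imp_filterlim_at_right)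
    show "(\<lambda>k. t / real (Suc k)) \<longlonglongrightarrow> 0"
      using tendsto_mult[OF tendsto_const[of t] LIMSEQ_inverse_real_of_nat]
      by (simp add: divide_inverse)
  qed (use t in auto)
  have lim: "(\<lambda>k. t * ((1 - ?a k) / (t / real (Suc k)))) \<longlonglongrightarrow> t * Q"
    by (intro tendsto_mult tendsto_const filterlim_compose[OF lim0 seq])
  \<comment> \<open>Bernoulli: the probability of failing one of the \<open>k + 1\<close> tests is at most \<open>k + 1\<close> times that of failing one.\<close>
  have "1 - pmf (P t x) x \<le> t * ((1 - ?a k) / (t / real (Suc k)))" for k
  proof -
    define a where "a = 1 - ?a k"
    have "1 + real (Suc k) * (- a) \<le> (1 + (- a)) ^ Suc k"
      by (rule Bernoulli_inequality) (simp add: a_def pmf_le_1)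
    also have "\<dots> = ?a k ^ Suc k" by (simp add: a_def)
    also have "\<dots> \<le> pmf (P (real (Suc k) * (t / real (Suc k))) x) x"
      using t by (intro pow) auto
    also have "real (Suc k) * (t / real (Suc k)) = t" by simp
    finally have "1 - pmf (P t x) x \<le> real (Suc k) * a" by simp
    also have "\<dots> = t * (a / (t / real (Suc k)))" using t by simp
    finally show ?thesis by (simp add: a_def)
  qed
  then have "1 - pmf (P t x) x \<le> t * Q"
    by (intro LIMSEQ_le_const[OF lim]) auto
  also have "\<dots> \<le> t * q" using q t by (simp add: Q_def)
  finally show ?thesis by (simp add: mult.commute)
qed

definition jumps :: "'a set \<Rightarrow> ('a \<Rightarrow> 'a \<Rightarrow> real) \<Rightarrow> 'a \<Rightarrow> 'a set" where
  "jumps X r x = {y \<in> X - {x}. r x y \<noteq> 0}"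

lemma infsum_rates_eq_sum:
  assumes "finite (jumps X r x)"
  shows "(\<Sum>\<^sub>\<infinity>y\<in>X - {x}. r x y) = (\<Sum>y\<in>jumps X r x. r x y)"
proof -
  have "(\<Sum>\<^sub>\<infinity>y\<in>X - {x}. r x y) = (\<Sum>\<^sub>\<infinity>y\<in>jumps X r x. r x y)"
    by (rule infsum_cong_neutral) (auto simp: jumps_def)
  then show ?thesis using assms by simp
qed

text \<open>
  Only finitely many states can be reached by one jump. Their transition probabilities divided by \<open>t\<close>
  converge to the rates, and so does the total probability of leaving \<open>x\<close>; hence the probability of all
  other states is \<open>o(t)\<close> and a bounded function cannot see them.
\<close>
lemma transition_expectation_derivative:
  fixes F :: "'a \<Rightarrow> real"
  assumes tf: "transition_function X r P" and x: "x \<in> X"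
    and fin: "finite (jumps X r x)"
    and B: "\<And>y. y \<in> X \<Longrightarrow> \<bar>F y\<bar> \<le> B"
  shows "((\<lambda>t. (measure_pmf.expectation (P t x) F - F x) / t)
           \<longlongrightarrow> (\<Sum>y\<in>jumps X r x. r x y * (F y - F x))) (at_right 0)"
    and "t > 0 \<Longrightarrow> \<bar>(measure_pmf.expectation (P t x) F - F x) / t\<bar>
           \<le> 2 * B * (\<Sum>y\<in>jumps X r x. r x y)"
proof -
  let ?D = "\<lambda>t. measure_pmf.expectation (P t x) F - F x"
  define N where "N = jumps X r x"
  define Q where "Q = (\<Sum>y\<in>N. r x y)"
  let ?R = "\<lambda>t. measure_pmf.expectation (P t x) (\<lambda>y. (F y - F x) * indicator (- (insert x N)) y)"
  have N: "finite N" "N \<subseteq> X" "x \<notin> N" using fin by (auto simp: N_def jumps_def)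
  have Qeq: "(\<Sum>\<^sub>\<infinity>y\<in>X - {x}. r x y) = Q"
    using infsum_rates_eq_sum[OF fin] by (simp add: Q_def N_def)
  have B0: "B \<ge> 0" using B[OF x] by linarith
  have supp: "set_pmf (P t x) \<subseteq> X" if "t > 0" for t
    using tf x that by (auto simp: transition_function_def)
  have d: "\<bar>F y - F x\<bar> \<le> 2 * B" if "y \<in> X" for y
    using B[OF that] B[OF x] by linarith
  have split: "?D t =
      (\<Sum>y\<in>N. pmf (P t x) y * (F y - F x)) + ?R t"
     (is "_ = ?S + ?E")
     and rem: "\<bar>?R t\<bar>
       \<le> 2 * B * (1 - pmf (P t x) x - (\<Sum>y\<in>N. pmf (P t x) y))"
    and bnd: "\<bar>?D t\<bar> \<le> 2 * B * (1 - pmf (P t x) x)"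
    if t: "t > 0" for t
  proof -
    have iF: "integrable (P t x) F"
      using supp[OF t] B by (intro integrable_pmf_bounded[where B=B]) auto
    have "?D t
      = measure_pmf.expectation (P t x) (\<lambda>y. F y - F x)"
      using iF by simp
    also have "\<dots> = measure_pmf.expectation (P t x)
       (\<lambda>y. (F y - F x) * indicator N y + (F y - F x) * indicator (- (insert x N)) y)"
      by (rule expectation_pmf_cong) (use N in \<open>auto simp: indicator_def\<close>)
    also have "\<dots> = measure_pmf.expectation (P t x) (\<lambda>y. (F y - F x) * indicator N y) + ?E"
      by (rule Bochner_Integration.integral_add;
          rule integrable_pmf_bounded[where B="2 * B"])
         (use supp[OF t] d B0 in \<open>auto simp: indicator_def\<close>)
    also have "measure_pmf.expectation (P t x) (\<lambda>y. (F y - F x) * indicator N y)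
        = (\<Sum>y\<in>N. (F y - F x) * indicator N y * pmf (P t x) y)"
      by (rule integral_measure_pmf_real[OF N(1)]) (auto simp: indicator_def split: if_splits)
    also have "\<dots> = ?S" by (intro sum.cong) auto
    finally have SE: "?D t = ?S + ?E" .
    then show "?D t = ?S + ?E" .
    have "\<bar>?E\<bar> \<le> measure_pmf.expectation (P t x) (\<lambda>y. \<bar>(F y - F x) * indicator (- (insert x N)) y\<bar>)"
      by (rule integral_abs_bound)
    also have "\<dots> \<le> measure_pmf.expectation (P t x) (\<lambda>y. 2 * B * indicator (- (insert x N)) y)"
      by (rule expectation_pmf_mono[where A="2*B" and B="2*B"])
         (use supp[OF t] d B0 in \<open>auto simp: indicator_def\<close>)
    also have "\<dots> = 2 * B * measure (P t x) (- (insert x N))" by simp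
    also have "measure (P t x) (- (insert x N)) = 1 - measure (P t x) (insert x N)"
      using measure_pmf.prob_compl[of "insert x N" "P t x"] by (simp add: Compl_eq_Diff_UNIV)
    also have "\<dots> = 1 - pmf (P t x) x - (\<Sum>y\<in>N. pmf (P t x) y)"
      using N by (simp add: measure_measure_pmf_finite)
    finally have E: "\<bar>?E\<bar> \<le> 2 * B * (1 - pmf (P t x) x - (\<Sum>y\<in>N. pmf (P t x) y))" .
    then show "\<bar>?E\<bar> \<le> 2 * B * (1 - pmf (P t x) x - (\<Sum>y\<in>N. pmf (P t x) y))" .
    have "\<bar>?S\<bar> \<le> (\<Sum>y\<in>N. pmf (P t x) y * (2 * B))"
      by (intro order.trans[OF sum_abs] sum_mono) (use d N in \<open>auto simp: abs_mult intro!: mult_left_mono\<close>)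
    also have "\<dots> = 2 * B * (\<Sum>y\<in>N. pmf (P t x) y)"
      by (simp add: sum_distrib_left mult.commute)
    finally have "\<bar>?S + ?E\<bar> \<le> 2 * B * (\<Sum>y\<in>N. pmf (P t x) y)
        + 2 * B * (1 - pmf (P t x) x - (\<Sum>y\<in>N. pmf (P t x) y))"
      using E by linarith
    also have "\<dots> = 2 * B * (1 - pmf (P t x) x)" by (simp add: algebra_simps)
    finally show "\<bar>?D t\<bar> \<le> 2 * B * (1 - pmf (P t x) x)"
      by (simp only: SE)
  qed
  have l1: "((\<lambda>t. pmf (P t x) y / t) \<longlongrightarrow> r x y) (at_right 0)" if "y \<in> N" for y
  proof -
    have "\<forall>x\<in>X. \<forall>y\<in>X. x \<noteq> y \<longrightarrow> ((\<lambda>t. pmf (P t x) y / t) \<longlongrightarrow> r x y) (at_right 0)"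
      using tf by (simp add: transition_function_def)
    moreover have "y \<in> X" "x \<noteq> y" using that N by auto
    ultimately show ?thesis using x by simp
  qed
  have l2: "((\<lambda>t. (1 - pmf (P t x) x) / t) \<longlongrightarrow> Q) (at_right 0)"
    using tf x unfolding Qeq[symmetric] by (simp add: transition_function_def)
  have "((\<lambda>t. 2 * B * ((1 - pmf (P t x) x) / t - (\<Sum>y\<in>N. pmf (P t x) y / t)))
        \<longlongrightarrow> 2 * B * (Q - (\<Sum>y\<in>N. r x y))) (at_right 0)"
    by (intro tendsto_intros l1 l2)
  then have z: "((\<lambda>t. 2 * B * ((1 - pmf (P t x) x) / t - (\<Sum>y\<in>N. pmf (P t x) y / t))) \<longlongrightarrow> 0) (at_right 0)"
    by (simp add: Q_def)
  have rem0: "((\<lambda>t. ?R t / t) \<longlongrightarrow> 0) (at_right 0)"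
  proof (rule Lim_null_comparison[OF _ z])
    show "\<forall>\<^sub>F t in at_right 0. norm (?R t / t)
      \<le> 2 * B * ((1 - pmf (P t x) x) / t - (\<Sum>y\<in>N. pmf (P t x) y / t))"
      using eventually_at_right_less[of "0::real"]
    proof eventually_elim
      case (elim t)
      show ?case using divide_right_mono[OF rem[OF elim], of t] elim
        by (simp add: diff_divide_distrib sum_divide_distrib[symmetric] right_diff_distrib)
    qed
  qed
  have "((\<lambda>t. (\<Sum>y\<in>N. pmf (P t x) y / t * (F y - F x))
        + ?R t / t)
      \<longlongrightarrow> (\<Sum>y\<in>N. r x y * (F y - F x)) + 0) (at_right 0)"
    by (intro tendsto_intros l1 rem0)
  then have "((\<lambda>t. (\<Sum>y\<in>N. pmf (P t x) y / t * (F y - F x))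
        + ?R t / t)
      \<longlongrightarrow> (\<Sum>y\<in>jumps X r x. r x y * (F y - F x))) (at_right 0)"
    by (simp add: N_def)
  then show "((\<lambda>t. (?D t) / t)
           \<longlongrightarrow> (\<Sum>y\<in>jumps X r x. r x y * (F y - F x))) (at_right 0)"
  proof (rule Lim_transform_eventually)
    show "\<forall>\<^sub>F t in at_right 0. (\<Sum>y\<in>N. pmf (P t x) y / t * (F y - F x))
        + ?R t / t
        = (?D t) / t"
      using eventually_at_right_less[of "0::real"]
      by eventually_elim (simp add: split add_divide_distrib sum_divide_distrib)
  qed
  show "\<bar>(?D t) / t\<bar>
           \<le> 2 * B * (\<Sum>y\<in>jumps X r x. r x y)" if "t > 0"
  proof -
    have "1 - pmf (P t x) x \<le> Q * t"
      using transition_leave_bound[OF tf x, of Q t] Qeq that by simp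
    then have "2 * B * (1 - pmf (P t x) x) \<le> 2 * B * (Q * t)"
      using B0 by (intro mult_left_mono) auto
    with bnd[OF that] have "\<bar>?D t\<bar> \<le> 2 * B * Q * t" by simp
    then show ?thesis using that by (simp add: Q_def N_def abs_divide field_simps)
  qed
qed

lemma integral_bind_pmf_bounded:
  fixes f :: "'b \<Rightarrow> real"
  assumes "\<And>y. \<bar>f y\<bar> \<le> B"
  shows "measure_pmf.expectation (bind_pmf p N) f
       = measure_pmf.expectation p (\<lambda>x. measure_pmf.expectation (N x) f)"
  unfolding measure_pmf_bind
  by (rule integral_bind[where K="count_space UNIV" and B=B and B'=1])
     (use assms measurable_measure_pmf[of N] in \<open>auto simp: measure_pmf.finite_measure_axioms\<close>)

text \<open>
  The observed process lives on \<open>f ` X\<close>, but its rates are known only upstairs. The invariant law is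
  therefore lifted to \<open>X\<close> by an arbitrary section of \<open>f\<close>. The lifted law need not be invariant for \<open>P\<close>,
  but the expectation of a function of \<open>f\<close> at time \<open>t\<close> depends on the starting point only through its
  image, so the generator still has expectation zero on such functions.
\<close>
lemma invariant_generator_expectation_zero:
  fixes g :: "'b \<Rightarrow> real"
  assumes tf: "transition_function X r P" and im: "image_transition_function X f P R"
    and inv: "invariant_distribution (f ` X) R \<pi>"
    and fin: "\<And>x. x \<in> X \<Longrightarrow> finite (jumps X r x)"
    and q: "\<And>x. x \<in> X \<Longrightarrow> (\<Sum>y\<in>jumps X r x. r x y) \<le> q"
    and B: "\<And>z. z \<in> f ` X \<Longrightarrow> \<bar>g z\<bar> \<le> B"
  shows "measure_pmf.expectation (map_pmf (inv_into X f) \<pi>)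
           (\<lambda>x. \<Sum>y\<in>jumps X r x. r x y * (g (f y) - g (f x))) = 0"
proof -
  let ?E = "measure_pmf.expectation \<pi>"
  define h where "h = (\<lambda>z. if z \<in> f ` X then g z else 0)"
  define u where "u = inv_into X f"
  define A where "A = (\<lambda>x. \<Sum>y\<in>jumps X r x. r x y * (h (f y) - h (f x)))"
  have sup: "set_pmf \<pi> \<subseteq> f ` X" and st: "\<And>t. t \<ge> 0 \<Longrightarrow> bind_pmf \<pi> (R t) = \<pi>"
    using inv by (auto simp: invariant_distribution_def)
  have u: "u z \<in> X" "f (u z) = z" if "z \<in> set_pmf \<pi>" for z
    using that sup by (auto simp: u_def inv_into_into f_inv_into_f)
  have "set_pmf \<pi> \<noteq> {}" by (rule set_pmf_not_empty)
  then have "B \<ge> 0" using sup B by fastforce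
  then have h: "\<bar>h z\<bar> \<le> B" for z using B by (auto simp: h_def)
  have R: "measure_pmf.expectation (R t z) h = measure_pmf.expectation (P t (u z)) (\<lambda>x. h (f x))"
    if "z \<in> set_pmf \<pi>" "t \<ge> 0" for z t
  proof -
    have "R t (f (u z)) = map_pmf f (P t (u z))"
      using im u[OF that(1)] that(2) unfolding image_transition_function_def by blast
    then show ?thesis using u[OF that(1)] by simp
  qed
  define T where "T k = inverse (real (Suc k))" for k
  have T: "T k > 0" for k by (simp add: T_def)
  have Tl: "filterlim T (at_right 0) sequentially"
    unfolding T_def by (rule tendsto_imp_filterlim_at_right[OF LIMSEQ_inverse_real_of_nat]) auto
    let ?Q = "\<lambda>k z. measure_pmf.expectation (P (T k) (u z)) (\<lambda>x. h (f x))"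
  define D where "D k z = (?Q k z - h z) / T k" for k z
  have D0: "?E (D k) = 0" for k
  proof -
    have "?E h = measure_pmf.expectation (bind_pmf \<pi> (R (T k))) h"
      using st[of "T k"] T[of k] by simp
    also have "\<dots> = ?E (\<lambda>z. measure_pmf.expectation (R (T k) z) h)"
      by (rule integral_bind_pmf_bounded[OF h])
    also have "\<dots> = ?E (\<lambda>z. ?Q k z)"
      by (rule expectation_pmf_cong) (use R T[of k] in auto)
    finally have e: "?E h = \<dots>" .
    have "?E (D k) =
      (?E (\<lambda>z. ?Q k z)
       - ?E h) / T k"
      unfolding D_def
      by (simp, subst Bochner_Integration.integral_diff)
         (auto intro!: integrable_pmf_bounded[where B=B] expectation_pmf_abs_le h)
    then show ?thesis using e by simp
  qed
  have "(\<lambda>k. ?E (D k)) \<longlonglongrightarrow> ?E (\<lambda>z. A (u z))"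
  proof (rule integral_dominated_convergence[where w="\<lambda>_. 2 * B * q"])
    show "AE z in \<pi>. (\<lambda>k. D k z) \<longlonglongrightarrow> A (u z)"
    proof (unfold AE_measure_pmf_iff, intro ballI)
      fix z assume z: "z \<in> set_pmf \<pi>"
      have "((\<lambda>t. (measure_pmf.expectation (P t (u z)) (\<lambda>x. h (f x)) - h (f (u z))) / t) \<longlongrightarrow> A (u z)) (at_right 0)"
        unfolding A_def
        by (rule transition_expectation_derivative(1)[OF tf u(1)[OF z] fin[OF u(1)[OF z]]]) (rule h)
      from filterlim_compose[OF this Tl] show "(\<lambda>k. D k z) \<longlonglongrightarrow> A (u z)"
        by (simp add: D_def u[OF z])
    qed
    show "AE z in \<pi>. norm (D k z) \<le> 2 * B * q" for k
    proof (unfold AE_measure_pmf_iff, intro ballI)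
      fix z assume z: "z \<in> set_pmf \<pi>"
      have "\<bar>(?Q k z - h (f (u z))) / T k\<bar>
          \<le> 2 * B * (\<Sum>y\<in>jumps X r (u z). r (u z) y)"
        by (rule transition_expectation_derivative(2)[OF tf u(1)[OF z] fin[OF u(1)[OF z]]])
           (use h T in auto)
      also have "\<dots> \<le> 2 * B * q"
        using q[OF u(1)[OF z]] \<open>B \<ge> 0\<close> by (intro mult_left_mono) auto
      finally show "norm (D k z) \<le> 2 * B * q" by (simp add: D_def u[OF z])
    qed
  qed auto
  with D0 have "?E (\<lambda>z. A (u z)) = 0"
    by (simp add: LIMSEQ_const_iff)
  moreover have "?E (\<lambda>z. A (u z)) =
     ?E (\<lambda>z. \<Sum>y\<in>jumps X r (u z). r (u z) y * (g (f y) - g (f (u z))))"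
    unfolding A_def
    by (intro expectation_pmf_cong sum.cong refl) (use u sup in \<open>auto simp: h_def jumps_def\<close>)
  ultimately show ?thesis by (simp add: u_def)
qed

section \<open>The generator of the RCPB chain\<close>

definition arrival_rate :: "real \<Rightarrow> nat \<Rightarrow> nat list \<Rightarrow> nat \<Rightarrow> nat \<Rightarrow> real" where
  "arrival_rate lam n q m i =
     (if m = 0 then lam else if q ! i = 0 then real n * lam / real (idle q) else 0)"

text \<open>
  Both kinds of arrival have the target \<open>(q[i := q ! i + 1], m - 1)\<close>, because \<open>0 - 1 = 0\<close> for natural
  numbers; only the rate at which queue \<open>i\<close> is chosen distinguishes them.
\<close>
fun rcpb_generator ::
  "real \<Rightarrow> nat \<Rightarrow> real \<Rightarrow> nat \<Rightarrow> (rcpb_state \<Rightarrow> real) \<Rightarrow> rcpb_state \<Rightarrow> real" where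
  "rcpb_generator lam c mu n F (q, m) =
     (\<Sum>i<n. arrival_rate lam n q m i * (F (q[i := q ! i + 1], m - 1) - F (q, m))) +
     (\<Sum>i<n. of_bool (q ! i > 0) * (F (q[i := q ! i - 1], m) - F (q, m))) +
     of_bool (m < c) * (mu * (real (idle q) - real m)) * (F (q, m + 1) - F (q, m))"

lemma idle_arrival: "i < length q \<Longrightarrow> idle q - 1 \<le> idle (q[i := v])"
proof -
  assume i: "i < length q"
  have "card ({j. j < length q \<and> q ! j = 0} - {i}) \<le> card {j. j < length q \<and> q[i := v] ! j = 0}"
    by (rule card_mono) (auto simp: nth_list_update)
  then show ?thesis unfolding idle_def
    using diff_card_le_card_Diff[of "{i}" "{j. j < length q \<and> q ! j = 0}"] by simp
qed

lemma idle_departure: "q ! i > 0 \<Longrightarrow> idle q \<le> idle (q[i := v])"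
  unfolding idle_def by (rule card_mono) (auto, metis nth_list_update_neq less_numeral_extra(3))

lemma rcpb_rate_nonzero_cases:
  assumes x: "(q, m) \<in> rcpb_states n c" and r: "rcpb_rate lam c mu n (q, m) y \<noteq> 0"
  shows "y \<in> rcpb_states n c"
    and "y \<in> (\<lambda>i. (q[i := q ! i + 1], m - 1)) ` {..<n} \<union> (\<lambda>i. (q[i := q ! i - 1], m)) ` {..<n}
              \<union> {(q, m + 1)}"
proof -
  have x': "length q = n" "m \<le> c" "m \<le> idle q" using x by (auto simp: rcpb_states_def)
  have four: "a \<noteq> 0 \<or> b \<noteq> 0 \<or> d \<noteq> 0 \<or> t \<noteq> 0" if "a + b + d + t \<noteq> 0" for a b d t :: real
    using that by auto
  let ?a = "\<Sum>i<n. if m = 0 \<and> y = (q[i := q ! i + 1], 0) then lam else 0"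
  let ?b = "\<Sum>i<n. if m > 0 \<and> y = (q[i := q ! i + 1], m - 1)
             then real n * lam * (if q ! i = 0 then 1 else 0) / real (idle q) else 0"
  let ?d = "\<Sum>i<n. if q ! i > 0 \<and> y = (q[i := q ! i - 1], m) then 1 else 0 :: real"
  let ?t = "if m < c \<and> y = (q, m + 1) then mu * (real (idle q) - real m) else 0"
  have "?a + ?b + ?d + ?t \<noteq> 0" using r by (simp only: rcpb_rate_def prod.case not_False_eq_True)
  then consider (a) "?a \<noteq> 0" | (b) "?b \<noteq> 0" | (d) "?d \<noteq> 0" | (t) "?t \<noteq> 0"
    using four[of ?a ?b ?d ?t] by blast
  then have "y \<in> rcpb_states n c \<and> y \<in> (\<lambda>i. (q[i := q ! i + 1], m - 1)) ` {..<n}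
     \<union> (\<lambda>i. (q[i := q ! i - 1], m)) ` {..<n} \<union> {(q, m + 1)}"
  proof cases
    case a
    obtain i where "i \<in> {..<n}" "(if m = 0 \<and> y = (q[i := q ! i + 1], 0) then lam else 0) \<noteq> 0"
      by (rule sum.not_neutral_contains_not_neutral[OF a])
    then have i: "i < n" "m = 0" "y = (q[i := q ! i + 1], 0)" by (simp_all split: if_splits)
    then show ?thesis using x' by (simp add: rcpb_states_def)
  next
    case b
    obtain i where "i \<in> {..<n}" "(if m > 0 \<and> y = (q[i := q ! i + 1], m - 1)
             then real n * lam * (if q ! i = 0 then 1 else 0) / real (idle q) else 0) \<noteq> 0"
      by (rule sum.not_neutral_contains_not_neutral[OF b])
    then have i: "i < n" "m > 0" "y = (q[i := q ! i + 1], m - 1)" "q ! i = 0"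
      by (simp_all split: if_splits)
    have "m - 1 \<le> idle (q[i := q ! i + 1])"
      using idle_arrival[of i q "q ! i + 1"] i x' by simp
    then have "y \<in> rcpb_states n c" using x' i by (auto simp: rcpb_states_def)
    moreover have "y \<in> (\<lambda>i. (q[i := q ! i + 1], m - 1)) ` {..<n}" using i by blast
    ultimately show ?thesis by blast
  next
    case d
    obtain i where "i \<in> {..<n}" "(if q ! i > 0 \<and> y = (q[i := q ! i - 1], m) then 1 else 0 :: real) \<noteq> 0"
      by (rule sum.not_neutral_contains_not_neutral[OF d])
    then have i: "i < n" "q ! i > 0" "y = (q[i := q ! i - 1], m)" by (simp_all split: if_splits)
    have "m \<le> idle (q[i := q ! i - 1])"
      using idle_departure[of q i "q ! i - 1"] i x' by simp
    then show ?thesis using x' i by (auto simp: rcpb_states_def)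
  next
    case t
    then show ?thesis using x' by (auto simp: rcpb_states_def split: if_splits)
  qed
  then show "y \<in> rcpb_states n c"
    "y \<in> (\<lambda>i. (q[i := q ! i + 1], m - 1)) ` {..<n} \<union> (\<lambda>i. (q[i := q ! i - 1], m)) ` {..<n}
              \<union> {(q, m + 1)}" by blast+
qed

lemma finite_rcpb_jumps:
  assumes "x \<in> rcpb_states n c"
  shows "finite (jumps (rcpb_states n c) (rcpb_rate lam c mu n) x)"
proof -
  obtain q m where x: "x = (q, m)" by force
  show ?thesis
    by (rule finite_subset[of _ "(\<lambda>i. (q[i := q ! i + 1], m - 1)) ` {..<n}
          \<union> (\<lambda>i. (q[i := q ! i - 1], m)) ` {..<n} \<union> {(q, m + 1)}"])
       (use assms rcpb_rate_nonzero_cases(2)[of q m n c lam mu] x in \<open>auto simp: jumps_def\<close>)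
qed

lemma sum_over_targets:
  fixes D :: "'a \<Rightarrow> real"
  assumes "finite T" and "\<And>i. i \<in> I \<Longrightarrow> C i \<Longrightarrow> t i \<in> T"
  shows "(\<Sum>y\<in>T. (\<Sum>i\<in>I. if C i \<and> y = t i then a i else 0) * D y)
       = (\<Sum>i\<in>I. if C i then a i * D (t i) else 0)"
proof -
  have "(\<Sum>y\<in>T. (\<Sum>i\<in>I. if C i \<and> y = t i then a i else 0) * D y)
      = (\<Sum>i\<in>I. \<Sum>y\<in>T. if y = t i then (if C i then a i * D (t i) else 0) else 0)"
    unfolding sum_distrib_right by (subst sum.swap) (intro sum.cong refl, auto)
  also have "\<dots> = (\<Sum>i\<in>I. if C i then a i * D (t i) else 0)"
    by (intro sum.cong refl) (use assms in auto)
  finally show ?thesis .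
qed

text \<open>
  The rates are given state by state and the generator event by event. The two sums agree because
  the rate to a state is the sum over the events leading there, and events whose target is the present
  state, or is not a state at all, have rate zero or contribute a zero increment.
\<close>
lemma sum_rcpb_jumps:
  assumes x: "x \<in> rcpb_states n c"
  shows "(\<Sum>y\<in>jumps (rcpb_states n c) (rcpb_rate lam c mu n) x.
            rcpb_rate lam c mu n x y * (F y - F x)) = rcpb_generator lam c mu n F x"
proof -
  let ?r = "\<lambda>y. rcpb_rate lam c mu n x y"
  obtain q m where xq: "x = (q, m)" by force
  define T where "T = (\<lambda>i. (q[i := q ! i + 1], m - 1)) ` {..<n} \<union> (\<lambda>i. (q[i := q ! i - 1], m)) ` {..<n}
              \<union> {(q, m + 1)}"
  define D where "D y = F y - F (q, m)" for y
  have fT: "finite T" by (simp add: T_def)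
  note nz = rcpb_rate_nonzero_cases[OF x[unfolded xq], of lam mu, folded T_def]
  have "(\<Sum>y\<in>jumps (rcpb_states n c) (rcpb_rate lam c mu n) x. ?r y * (F y - F x))
      = (\<Sum>y\<in>T. ?r y * (F y - F x))"
    by (rule sum.mono_neutral_left) (use fT nz xq in \<open>auto simp: jumps_def\<close>)
  also have "\<dots> = (\<Sum>y\<in>T. (\<Sum>i<n. if m = 0 \<and> y = (q[i := q ! i + 1], 0) then lam else 0) * D y)
     + (\<Sum>y\<in>T. (\<Sum>i<n. if m > 0 \<and> y = (q[i := q ! i + 1], m - 1)
             then real n * lam * (if q ! i = 0 then 1 else 0) / real (idle q) else 0) * D y)
     + (\<Sum>y\<in>T. (\<Sum>i<n. if q ! i > 0 \<and> y = (q[i := q ! i - 1], m) then 1 else 0) * D y)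
     + (\<Sum>y\<in>T. (\<Sum>i\<in>{0::nat}. if m < c \<and> y = (q, m + 1) then mu * (real (idle q) - real m) else 0) * D y)"
    unfolding sum.distrib[symmetric]
    by (intro sum.cong refl) (simp add: rcpb_rate_def xq D_def distrib_right)
  also have "\<dots> = (\<Sum>i<n. if m = 0 then lam * D (q[i := q ! i + 1], 0) else 0)
     + (\<Sum>i<n. if m > 0 then real n * lam * (if q ! i = 0 then 1 else 0) / real (idle q) * D (q[i := q ! i + 1], m - 1) else 0)
     + (\<Sum>i<n. if q ! i > 0 then 1 * D (q[i := q ! i - 1], m) else 0)
     + (\<Sum>i\<in>{0::nat}. if m < c then mu * (real (idle q) - real m) * D (q, m + 1) else 0)"
    by (intro arg_cong2[where f=plus] sum_over_targets fT) (auto simp: T_def)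
  also have "\<dots> = rcpb_generator lam c mu n F x"
    unfolding xq rcpb_generator.simps
    unfolding sum.distrib[symmetric]
    by (intro arg_cong2[where f=plus] sum.cong refl) (auto simp: D_def arrival_rate_def)
  finally show ?thesis .
qed

lemma sum_arrival_rate:
  assumes "(q, m) \<in> rcpb_states n c"
  shows "(\<Sum>i<n. arrival_rate lam n q m i) = real n * lam"
proof (cases "m = 0")
  case True
  then show ?thesis by (simp add: arrival_rate_def)
next
  case False
  then have p: "idle q > 0" and l: "length q = n" using assms by (auto simp: rcpb_states_def)
  have "(\<Sum>i<n. arrival_rate lam n q m i) = (\<Sum>i\<in>{..<n}. if q ! i = 0 then real n * lam / real (idle q) else 0)"
    using False by (simp add: arrival_rate_def)
  also have "\<dots> = (\<Sum>i\<in>{i\<in>{..<n}. q ! i = 0}. real n * lam / real (idle q))"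
    by (rule sum.inter_filter[symmetric]) simp
  also have "{i\<in>{..<n}. q ! i = 0} = {i. i < length q \<and> q ! i = 0}" using l by auto
  also have "(\<Sum>i\<in>{i. i < length q \<and> q ! i = 0}. real n * lam / real (idle q))
      = real (idle q) * (real n * lam / real (idle q))"
    by (simp only: sum_constant idle_def)
  also have "\<dots> = real n * lam" using p by simp
  finally show ?thesis .
qed

lemma arrival_rate_nonneg: "lam \<ge> 0 \<Longrightarrow> 0 \<le> arrival_rate lam n q m i"
  by (simp add: arrival_rate_def)

lemma idle_le: "idle q \<le> length q"
  unfolding idle_def using card_mono[of "{..<length q}" "{i. i < length q \<and> q ! i = 0}"] by auto

lemma rcpb_exit_rate_le:
  assumes x: "x \<in> rcpb_states n c" and "lam \<ge> 0" "mu \<ge> 0"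
  shows "(\<Sum>y\<in>jumps (rcpb_states n c) (rcpb_rate lam c mu n) x. rcpb_rate lam c mu n x y)
           \<le> real n * (lam + 1 + mu)"
proof -
  obtain q m where xq: "x = (q, m)" by force
  then have q: "length q = n" "m \<le> idle q" using x by (auto simp: rcpb_states_def)
  \<comment> \<open>The total rate is the generator applied to the indicator of having left \<open>x\<close>.\<close>
  define F where "F y = (of_bool (y \<noteq> x) :: real)" for y
  have "(\<Sum>y\<in>jumps (rcpb_states n c) (rcpb_rate lam c mu n) x. rcpb_rate lam c mu n x y)
      = (\<Sum>y\<in>jumps (rcpb_states n c) (rcpb_rate lam c mu n) x. rcpb_rate lam c mu n x y * (F y - F x))"
    by (rule sum.cong) (auto simp: jumps_def F_def)
  also have "\<dots> = rcpb_generator lam c mu n F x" by (rule sum_rcpb_jumps[OF x])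
  also have "\<dots> \<le> (\<Sum>i<n. arrival_rate lam n q m i * 1) + (\<Sum>i<n. 1 * 1) + 1 * (mu * real n) * 1"
    unfolding xq rcpb_generator.simps
    by (intro add_mono sum_mono mult_mono)
       (use assms q idle_le[of q] arrival_rate_nonneg[of lam n q m] in \<open>auto simp: F_def xq\<close>)
  also have "\<dots> = real n * (lam + 1 + mu)"
    using sum_arrival_rate[of q m n c lam] x xq by (simp add: algebra_simps)
  finally show ?thesis .
qed

lemma rcpb_rate_nonneg:
  assumes "x \<in> rcpb_states n c" "lam \<ge> 0" "mu \<ge> 0"
  shows "0 \<le> rcpb_rate lam c mu n x y"
  using assms by (cases x) (auto simp: rcpb_rate_def rcpb_states_def intro!: add_nonneg_nonneg sum_nonneg)

lemma rcpb_generator_bounded: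
  assumes x: "x \<in> rcpb_states n c" and "lam \<ge> 0" "mu \<ge> 0"
    and B: "\<And>y. y \<in> rcpb_states n c \<Longrightarrow> \<bar>F y\<bar> \<le> B"
  shows "\<bar>rcpb_generator lam c mu n F x\<bar> \<le> real n * (lam + 1 + mu) * (2 * B)"
proof -
  let ?J = "jumps (rcpb_states n c) (rcpb_rate lam c mu n) x"
  have "\<bar>rcpb_generator lam c mu n F x\<bar> \<le> (\<Sum>y\<in>?J. \<bar>rcpb_rate lam c mu n x y * (F y - F x)\<bar>)"
    unfolding sum_rcpb_jumps[OF x, symmetric] by (rule sum_abs)
  also have "\<dots> \<le> (\<Sum>y\<in>?J. rcpb_rate lam c mu n x y * (2 * B))"
  proof (rule sum_mono)
    fix y assume "y \<in> ?J"
    then have "\<bar>F y\<bar> \<le> B" using B by (auto simp: jumps_def)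
    with B[OF x] have "\<bar>F y - F x\<bar> \<le> 2 * B" by linarith
    then show "\<bar>rcpb_rate lam c mu n x y * (F y - F x)\<bar> \<le> rcpb_rate lam c mu n x y * (2 * B)"
      using rcpb_rate_nonneg[OF x assms(2,3)] by (simp add: abs_mult mult_left_mono)
  qed
  also have "\<dots> = (\<Sum>y\<in>?J. rcpb_rate lam c mu n x y) * (2 * B)" by (simp add: sum_distrib_right)
  also have "\<dots> \<le> real n * (lam + 1 + mu) * (2 * B)"
    using rcpb_exit_rate_le[OF x assms(2,3)] B[OF x] by (intro mult_right_mono) auto
  finally show ?thesis .
qed

lemma rcpb_generator_expectation_zero:
  assumes "lam \<ge> 0" "mu \<ge> 0"
    and "transition_function (rcpb_states n c) (rcpb_rate lam c mu n) P"
    and "image_transition_function (rcpb_states n c) (rcpb_observe n) P R"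
    and "invariant_distribution (rcpb_observe n ` rcpb_states n c) R \<pi>"
    and B: "\<And>x. x \<in> rcpb_states n c \<Longrightarrow> \<bar>g (rcpb_observe n x)\<bar> \<le> B"
  shows "measure_pmf.expectation (map_pmf (inv_into (rcpb_states n c) (rcpb_observe n)) \<pi>)
           (rcpb_generator lam c mu n (\<lambda>x. g (rcpb_observe n x))) = 0"
proof -
  let ?\<nu> = "map_pmf (inv_into (rcpb_states n c) (rcpb_observe n)) \<pi>"
  have sup: "set_pmf ?\<nu> \<subseteq> rcpb_states n c"
    using assms(5) unfolding invariant_distribution_def set_map_pmf image_subset_iff
    by (meson inv_into_into subsetD)
  have "measure_pmf.expectation ?\<nu> (rcpb_generator lam c mu n (\<lambda>x. g (rcpb_observe n x)))
     = measure_pmf.expectation ?\<nu> (\<lambda>x. \<Sum>y\<in>jumps (rcpb_states n c) (rcpb_rate lam c mu n) x.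
            rcpb_rate lam c mu n x y * (g (rcpb_observe n y) - g (rcpb_observe n x)))"
    using sup by (intro expectation_pmf_cong sum_rcpb_jumps[symmetric]) blast
  also have "\<dots> = 0"
    by (rule invariant_generator_expectation_zero[OF assms(3-5), where B=B and q="real n * (lam + 1 + mu)"])
       (use finite_rcpb_jumps rcpb_exit_rate_le assms(1,2) B in auto)
  finally show ?thesis .
qed

section \<open>Fractions of long queues\<close>

lemma queue_fractions_fraction_space:
  assumes "n \<ge> 1"
  shows "queue_fractions n q \<in> fraction_space"
proof -
  have le: "card {j. j < n \<and> i \<le> q ! j} \<le> n" for i
    using card_mono[of "{..<n}" "{j. j < n \<and> i \<le> q ! j}"] by auto
  have "card {j. j < n \<and> Suc i \<le> q ! j} \<le> card {j. j < n \<and> i \<le> q ! j}" for i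
    by (rule card_mono) auto
  then show ?thesis
    using assms le by (auto simp: fraction_space_def queue_fractions_def divide_right_mono)
qed

lemma queue_fractions_eq_sum:
  "queue_fractions n q k = (\<Sum>j<n. of_bool (k \<le> q ! j)) / real n"
  by (simp add: queue_fractions_def Int_def)

lemma queue_fractions_update:
  assumes "i < n" "length q = n"
  shows "queue_fractions n (q[i := v]) k
       = queue_fractions n q k + (of_bool (k \<le> v) - of_bool (k \<le> q ! i)) / real n"
proof -
  have "(\<Sum>j<n. of_bool (k \<le> q[i := v] ! j)) =
      (\<Sum>j<n. of_bool (k \<le> q ! j) + (if j = i then of_bool (k \<le> v) - of_bool (k \<le> q ! i) else 0 :: real))"
    by (rule sum.cong) (use assms in \<open>auto simp: nth_list_update\<close>)
  then show ?thesis
    using assms by (simp add: queue_fractions_eq_sum sum.distrib add_divide_distrib)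
qed

lemma queue_fractions_arrival:
  assumes "i < n" "length q = n"
  shows "queue_fractions n (q[i := q ! i + 1]) k
       = queue_fractions n q k + of_bool (q ! i + 1 = k) / real n"
  by (subst queue_fractions_update[OF assms]) (auto simp: of_bool_def)

lemma queue_fractions_departure:
  assumes "i < n" "length q = n" "q ! i > 0"
  shows "queue_fractions n (q[i := q ! i - 1]) k
       = queue_fractions n q k - of_bool (q ! i = k) / real n"
  using assms(3) by (subst queue_fractions_update[OF assms(1,2)]) (auto simp: of_bool_def)

lemma sum_queues_of_length:
  "n \<ge> 1 \<Longrightarrow> (\<Sum>i<n. of_bool (q ! i = k)) = real n * (queue_fractions n q k - queue_fractions n q (Suc k))"
proof -
  have "(\<Sum>i<n. of_bool (q ! i = k)) = (\<Sum>i<n. of_bool (k \<le> q ! i) - of_bool (Suc k \<le> q ! i) :: real)"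
    by (rule sum.cong) (auto simp: of_bool_def)
  then show "n \<ge> 1 \<Longrightarrow> ?thesis"
    by (simp add: queue_fractions_eq_sum sum_subtractf right_diff_distrib)
qed

lemma idle_eq_queue_fractions:
  assumes "n \<ge> 1" "length q = n"
  shows "real (idle q) = real n * (1 - queue_fractions n q 1)"
proof -
  have "real (idle q) = (\<Sum>i<n. of_bool (q ! i = 0))"
    using assms by (simp add: idle_def Int_def)
  also have "\<dots> = real n * (queue_fractions n q 0 - queue_fractions n q 1)"
    using sum_queues_of_length[OF assms(1), of q 0] by simp
  also have "queue_fractions n q 0 = 1"
    using queue_fractions_fraction_space[OF assms(1), of q] by (simp add: fraction_space_def)
  finally show ?thesis .
qed

lemma queue_fractions_tendsto_0:
  "(\<lambda>k. queue_fractions n q k) \<longlonglongrightarrow> 0"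
proof (rule tendsto_eventually)
  have "queue_fractions n q k = 0" if "k > (\<Sum>j<n. q ! j)" for k
  proof -
    have "q ! j \<le> (\<Sum>j<n. q ! j)" if "j < n" for j
      using that by (intro member_le_sum) auto
    then have "{j. j < n \<and> k \<le> q ! j} = {}" using that by fastforce
    then show ?thesis by (simp add: queue_fractions_def)
  qed
  then show "\<forall>\<^sub>F k in sequentially. queue_fractions n q k = 0"
    by (rule eventually_mono[OF eventually_gt_at_top])
qed

section \<open>Lipschitz test functions\<close>

text \<open>
  One arrival or departure moves every coordinate of the fractions by at most \<open>1/n\<close>, so the supremum
  distance is the one that makes increments of order \<open>1/n\<close>. The same constant bounds the function and
  its increments.
\<close>
definition sup_lipschitz :: "real \<Rightarrow> ((nat \<Rightarrow> real) \<Rightarrow> real) \<Rightarrow> bool" where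
  "sup_lipschitz L g \<longleftrightarrow>
     (\<forall>s\<in>fraction_space. \<bar>g s\<bar> \<le> L) \<and>
     (\<forall>s\<in>fraction_space. \<forall>s'\<in>fraction_space. \<forall>d.
        (\<forall>k. \<bar>s k - s' k\<bar> \<le> d) \<longrightarrow> \<bar>g s - g s'\<bar> \<le> L * d)"

lemma one_in_fraction_space: "(\<lambda>_. 1) \<in> fraction_space"
  by (simp add: fraction_space_def)

lemma sup_lipschitzD:
  assumes "sup_lipschitz L g"
  shows "s \<in> fraction_space \<Longrightarrow> \<bar>g s\<bar> \<le> L"
    and "\<lbrakk>s \<in> fraction_space; s' \<in> fraction_space; \<And>k. \<bar>s k - s' k\<bar> \<le> d\<rbrakk> \<Longrightarrow> \<bar>g s - g s'\<bar> \<le> L * d"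
  using assms by (auto simp: sup_lipschitz_def)

lemma sup_lipschitz_nonneg: "sup_lipschitz L g \<Longrightarrow> 0 \<le> L"
  using sup_lipschitzD(1)[OF _ one_in_fraction_space] abs_ge_zero order.trans by blast

definition bounded_lipschitz :: "((nat \<Rightarrow> real) \<Rightarrow> real) \<Rightarrow> bool" where
  "bounded_lipschitz g \<longleftrightarrow> (\<exists>L. sup_lipschitz L g)"

lemma bounded_lipschitzI:
  assumes "\<And>s. s \<in> fraction_space \<Longrightarrow> \<bar>g s\<bar> \<le> A"
    and "\<And>s s' d. \<lbrakk>s \<in> fraction_space; s' \<in> fraction_space; \<And>k. \<bar>s k - s' k\<bar> \<le> d\<rbrakk> \<Longrightarrow> \<bar>g s - g s'\<bar> \<le> B * d"
  shows "bounded_lipschitz g"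
  unfolding bounded_lipschitz_def sup_lipschitz_def
proof (intro exI[of _ "max A B"] conjI ballI allI impI)
  fix s :: "nat \<Rightarrow> real" assume "s \<in> fraction_space"
  then show "\<bar>g s\<bar> \<le> max A B" using assms(1)[of s] by simp
next
  fix s s' :: "nat \<Rightarrow> real" and d :: real
  assume "s \<in> fraction_space" "s' \<in> fraction_space" and d: "\<forall>k. \<bar>s k - s' k\<bar> \<le> d"
  then have "\<bar>g s - g s'\<bar> \<le> B * d" using assms(2) by blast
  moreover have "0 \<le> d" using d abs_ge_zero order.trans by blast
  ultimately show "\<bar>g s - g s'\<bar> \<le> max A B * d"
    using mult_right_mono[of B "max A B" d] by simp
qed

lemma bounded_lipschitz_const [intro]: "bounded_lipschitz (\<lambda>_. a)"
  by (rule bounded_lipschitzI[where A="\<bar>a\<bar>" and B=0]) auto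

lemma bounded_lipschitz_coordinate [intro]: "bounded_lipschitz (\<lambda>s. s k)"
  by (rule bounded_lipschitzI[where A=1 and B=1]) (auto simp: fraction_space_def)

lemma bounded_lipschitz_add [intro]:
  assumes "bounded_lipschitz f" "bounded_lipschitz g"
  shows "bounded_lipschitz (\<lambda>s. f s + g s)"
proof -
  obtain A B where A: "sup_lipschitz A f" and B: "sup_lipschitz B g"
    using assms by (auto simp: bounded_lipschitz_def)
  show ?thesis
  proof (rule bounded_lipschitzI)
    show "\<bar>f s + g s\<bar> \<le> A + B" if "s \<in> fraction_space" for s
      using sup_lipschitzD(1)[OF A that] sup_lipschitzD(1)[OF B that] by linarith
    show "\<bar>f s + g s - (f s' + g s')\<bar> \<le> (A + B) * d"
      if "s \<in> fraction_space" "s' \<in> fraction_space" "\<And>k. \<bar>s k - s' k\<bar> \<le> d" for s s' d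
      using sup_lipschitzD(2)[OF A that] sup_lipschitzD(2)[OF B that] by (simp add: distrib_right)
  qed
qed

lemma bounded_lipschitz_mult [intro]:
  assumes "bounded_lipschitz f" "bounded_lipschitz g"
  shows "bounded_lipschitz (\<lambda>s. f s * g s)"
proof -
  obtain A B where A: "sup_lipschitz A f" and B: "sup_lipschitz B g"
    using assms by (auto simp: bounded_lipschitz_def)
  show ?thesis
  proof (rule bounded_lipschitzI)
    show "\<bar>f s * g s\<bar> \<le> A * B" if "s \<in> fraction_space" for s
      unfolding abs_mult using sup_lipschitzD(1)[OF A that] sup_lipschitzD(1)[OF B that]
      by (intro mult_mono) auto
    show "\<bar>f s * g s - f s' * g s'\<bar> \<le> (2 * A * B) * d"
      if s: "s \<in> fraction_space" "s' \<in> fraction_space" and d: "\<And>k. \<bar>s k - s' k\<bar> \<le> d" for s s' d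
    proof -
      have "f s * g s - f s' * g s' = f s * (g s - g s') + (f s - f s') * g s'" by (simp add: algebra_simps)
      also have "\<bar>\<dots>\<bar> \<le> \<bar>f s\<bar> * \<bar>g s - g s'\<bar> + \<bar>f s - f s'\<bar> * \<bar>g s'\<bar>"
        unfolding abs_mult[symmetric] by (rule abs_triangle_ineq)
      also have "\<dots> \<le> A * (B * d) + (A * d) * B"
        using sup_lipschitzD(1)[OF A s(1)] sup_lipschitzD(1)[OF B s(2)] sup_lipschitz_nonneg[OF A]
          sup_lipschitzD(2)[OF A s d] sup_lipschitzD(2)[OF B s d] order.trans[OF abs_ge_zero d[of 0]]
        by (intro add_mono mult_mono) auto
      finally show ?thesis by (simp add: algebra_simps)
    qed
  qed
qed

lemma bounded_lipschitz_minus [intro]: "bounded_lipschitz f \<Longrightarrow> bounded_lipschitz (\<lambda>s. - f s)"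
  using bounded_lipschitz_mult[OF bounded_lipschitz_const[of "-1"], of f] by simp

lemma bounded_lipschitz_diff [intro]:
  "bounded_lipschitz f \<Longrightarrow> bounded_lipschitz g \<Longrightarrow> bounded_lipschitz (\<lambda>s. f s - g s)"
  using bounded_lipschitz_add[OF _ bounded_lipschitz_minus, of f g] by simp

lemma bounded_lipschitz_divide_const [intro]: "bounded_lipschitz f \<Longrightarrow> bounded_lipschitz (\<lambda>s. f s / a)"
  using bounded_lipschitz_mult[OF _ bounded_lipschitz_const[of "1 / a"], of f] by simp

lemma bounded_lipschitz_max [intro]:
  assumes "bounded_lipschitz f" "bounded_lipschitz g"
  shows "bounded_lipschitz (\<lambda>s. max (f s) (g s))"
proof -
  obtain A B where A: "sup_lipschitz A f" and B: "sup_lipschitz B g"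
    using assms by (auto simp: bounded_lipschitz_def)
  show ?thesis
  proof (rule bounded_lipschitzI)
    show "\<bar>max (f s) (g s)\<bar> \<le> A + B" if "s \<in> fraction_space" for s
      using sup_lipschitzD(1)[OF A that] sup_lipschitzD(1)[OF B that] by linarith
    show "\<bar>max (f s) (g s) - max (f s') (g s')\<bar> \<le> (A + B) * d"
      if s: "s \<in> fraction_space" "s' \<in> fraction_space" "\<And>k. \<bar>s k - s' k\<bar> \<le> d" for s s' d
    proof -
      have "\<bar>max (f s) (g s) - max (f s') (g s')\<bar> \<le> \<bar>f s - f s'\<bar> + \<bar>g s - g s'\<bar>" by linarith
      then show ?thesis
        using sup_lipschitzD(2)[OF A s] sup_lipschitzD(2)[OF B s] by (simp add: distrib_right)
    qed
  qed
qed

lemma bounded_lipschitz_inverse [intro]: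
  assumes "bounded_lipschitz f" "\<And>s. s \<in> fraction_space \<Longrightarrow> f s \<ge> 1"
  shows "bounded_lipschitz (\<lambda>s. inverse (f s))"
proof -
  obtain A where A: "sup_lipschitz A f" using assms by (auto simp: bounded_lipschitz_def)
  show ?thesis
  proof (rule bounded_lipschitzI)
    show "\<bar>inverse (f s)\<bar> \<le> 1" if "s \<in> fraction_space" for s
      using assms(2)[OF that] by (simp add: inverse_le_1_iff)
    show "\<bar>inverse (f s) - inverse (f s')\<bar> \<le> A * d"
      if s: "s \<in> fraction_space" "s' \<in> fraction_space" "\<And>k. \<bar>s k - s' k\<bar> \<le> d" for s s' d
    proof -
      have f: "f s \<ge> 1" "f s' \<ge> 1" using assms(2) s by auto
      then have "inverse (f s) - inverse (f s') = (f s' - f s) / (f s * f s')" by (simp add: field_simps)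
      also have "\<bar>\<dots>\<bar> = \<bar>f s - f s'\<bar> / (f s * f s')" using f by (simp add: abs_divide abs_mult abs_minus_commute)
      also have "\<dots> \<le> \<bar>f s - f s'\<bar> / 1"
        using f mult_mono[of 1 "f s" 1 "f s'"] by (intro divide_left_mono) auto
      finally show ?thesis using sup_lipschitzD(2)[OF A s] by simp
    qed
  qed
qed

lemma bounded_lipschitz_sum [intro]:
  "(\<And>i. i \<in> I \<Longrightarrow> bounded_lipschitz (f i)) \<Longrightarrow> bounded_lipschitz (\<lambda>s. \<Sum>i\<in>I. f i s)"
  by (induction I rule: infinite_finite_induct) (auto intro: bounded_lipschitz_add)

lemma bounded_lipschitz_power [intro]:
  "bounded_lipschitz f \<Longrightarrow> bounded_lipschitz (\<lambda>s. f s ^ k)"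
  by (induction k) auto

text \<open>
  Every number in the unit interval is the first coordinate of some point of the fraction space, which
  turns the Lipschitz property back into one for a function of a real variable.
\<close>
lemma bounded_lipschitz_first_coordinate:
  assumes "bounded_lipschitz (\<lambda>s. u (s 1))"
  shows "\<exists>M. \<forall>y z. 0 \<le> y \<longrightarrow> y \<le> z \<longrightarrow> z \<le> 1 \<longrightarrow> u z - u y \<le> M * (z - y)"
proof -
  obtain L where L: "sup_lipschitz L (\<lambda>s. u (s 1))" using assms by (auto simp: bounded_lipschitz_def)
  have "u z - u y \<le> L * (z - y)" if "0 \<le> y" "y \<le> z" "z \<le> 1" for y z
  proof -
    define s :: "real \<Rightarrow> nat \<Rightarrow> real" where "s a k = (if k = 0 then 1 else a)" for a k
    have "s a \<in> fraction_space" if "0 \<le> a" "a \<le> 1" for a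
      using that by (simp add: s_def fraction_space_def)
    then have "s z \<in> fraction_space" "s y \<in> fraction_space" using that by auto
    from sup_lipschitzD(2)[OF L this, of "z - y"] have "\<bar>u (s z 1) - u (s y 1)\<bar> \<le> L * (z - y)"
      using that by (simp add: s_def)
    then show ?thesis by (simp add: s_def)
  qed
  then show ?thesis by blast
qed

text \<open>
  A stand-in for the positive part, within \<open>e\<close> of it, with the continuous derivative \<open>ramp e\<close>. The
  positive part itself has a kink, and jumps of size \<open>1/n\<close> across it, at a rate of order \<open>n\<close>, cost an error
  that does not vanish.
\<close>
definition smooth_pos :: "real \<Rightarrow> real \<Rightarrow> real" where
  "smooth_pos e x = ((max x 0)\<^sup>2 - (max (x - e) 0)\<^sup>2) / (2 * e)"

text \<open>
  The continuous function that is \<open>0\<close> below \<open>0\<close>, \<open>1\<close> above \<open>e\<close>, and linear in between.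
\<close>
definition ramp :: "real \<Rightarrow> real \<Rightarrow> real" where
  "ramp e x = (max x 0 - max (x - e) 0) / e"

lemma half_square_pos_taylor:
  fixes x d :: real
  shows "(max x 0)\<^sup>2 + 2 * d * max x 0 \<le> (max (x + d) 0)\<^sup>2"
    and "(max (x + d) 0)\<^sup>2 \<le> (max x 0)\<^sup>2 + 2 * d * max x 0 + d\<^sup>2"
proof -
  show "(max (x + d) 0)\<^sup>2 \<le> (max x 0)\<^sup>2 + 2 * d * max x 0 + d\<^sup>2"
  proof -
    have "(max (x + d) 0)\<^sup>2 \<le> (max x 0 + d)\<^sup>2"
      by (cases "x \<ge> 0"; cases "x + d \<ge> 0") (auto simp: max_def intro: power_mono)
    then show ?thesis by (simp add: power2_eq_square algebra_simps)
  qed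
  show "(max x 0)\<^sup>2 + 2 * d * max x 0 \<le> (max (x + d) 0)\<^sup>2"
  proof (cases "x \<ge> 0")
    case True
    then show ?thesis
    proof (cases "x + d \<ge> 0")
      case True
      then show ?thesis using \<open>x \<ge> 0\<close> by (simp add: power2_eq_square algebra_simps)
    next
      case False
      then have "x * (x + 2 * d) \<le> 0" using \<open>x \<ge> 0\<close> by (intro mult_nonneg_nonpos) auto
      then show ?thesis using False True by (simp add: power2_eq_square algebra_simps)
    qed
  qed auto
qed

lemma smooth_pos_taylor:
  assumes "e > 0"
  shows "smooth_pos e (x + d) - smooth_pos e x \<le> ramp e x * d + d\<^sup>2 / (2 * e)"
proof -
  have "(max (x + d) 0)\<^sup>2 - (max (x - e + d) 0)\<^sup>2 - ((max x 0)\<^sup>2 - (max (x - e) 0)\<^sup>2)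
      \<le> (max x 0 - max (x - e) 0) * (2 * d) + d\<^sup>2"
    using half_square_pos_taylor(2)[of x d] half_square_pos_taylor(1)[of "x - e" d]
    by (simp add: algebra_simps)
  then have "((max (x + d) 0)\<^sup>2 - (max (x + d - e) 0)\<^sup>2 - ((max x 0)\<^sup>2 - (max (x - e) 0)\<^sup>2)) / (2 * e)
      \<le> ((max x 0 - max (x - e) 0) * (2 * d) + d\<^sup>2) / (2 * e)"
    using assms by (intro divide_right_mono) (auto simp: algebra_simps)
  moreover have "((max x 0 - max (x - e) 0) * (2 * d) + d\<^sup>2) / (2 * e) = ramp e x * d + d\<^sup>2 / (2 * e)"
    by (simp add: ramp_def add_divide_distrib)
  ultimately show ?thesis unfolding smooth_pos_def by (simp only: diff_divide_distrib)
qed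

lemma ramp_bounds:
  assumes "e > 0"
  shows "0 \<le> ramp e x" "ramp e x \<le> 1" "x \<le> 0 \<Longrightarrow> ramp e x = 0" "x \<ge> e \<Longrightarrow> ramp e x = 1"
  using assms by (auto simp: ramp_def max_def field_simps)

lemma bounded_lipschitz_ramp [intro]: "bounded_lipschitz f \<Longrightarrow> bounded_lipschitz (\<lambda>s. ramp e (f s))"
  unfolding ramp_def
  by (intro bounded_lipschitz_divide_const bounded_lipschitz_diff bounded_lipschitz_max
      bounded_lipschitz_const)

section \<open>Identities for a fixed number of servers\<close>

definition fractions :: "nat \<Rightarrow> rcpb_state \<Rightarrow> nat \<Rightarrow> real" where
  "fractions n x = queue_fractions n (fst x)"

abbreviation no_token :: "rcpb_state \<Rightarrow> real" where
  "no_token x \<equiv> of_bool (snd x = 0)"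

text \<open>
  \<open>n\<close> times \<open>birth_flow lam n k\<close> is the rate at which queues of length \<open>k - 1\<close> receive a job. With tokens
  in memory only idle servers do, so the flow is \<open>lam\<close> for \<open>k = 1\<close> and zero for larger \<open>k\<close>.
\<close>
definition birth_flow :: "real \<Rightarrow> nat \<Rightarrow> nat \<Rightarrow> rcpb_state \<Rightarrow> real" where
  "birth_flow lam n k x =
     (if snd x = 0 then lam * (fractions n x (k - 1) - fractions n x k) else if k = 1 then lam else 0)"

definition net_flow :: "real \<Rightarrow> nat \<Rightarrow> nat \<Rightarrow> rcpb_state \<Rightarrow> real" where
  "net_flow lam n k x = birth_flow lam n k x - (fractions n x k - fractions n x (k + 1))"

text \<open>
  The law \<open>\<nu>\<close> stands for the lift of the observed invariant law. Such a lift makes the mean of the generator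
  vanish on functions of the fractions and of the token count, though perhaps not on all functions of the queues.
\<close>
locale rcpb_equilibrium =
  fixes n c :: nat and lam mu :: real and \<nu> :: "rcpb_state pmf"
  assumes n: "n \<ge> 1" and lam: "0 < lam" "lam < 1" and mu: "0 \<le> mu"
    and supp: "set_pmf \<nu> \<subseteq> rcpb_states n c"
    and stationary: "\<And>g B. (\<And>s m. s \<in> fraction_space \<Longrightarrow> m \<le> c \<Longrightarrow> \<bar>g s m\<bar> \<le> B) \<Longrightarrow>
      measure_pmf.expectation \<nu>
        (rcpb_generator lam c mu n (\<lambda>x. g (queue_fractions n (fst x)) (snd x))) = 0"
begin

abbreviation E :: "(rcpb_state \<Rightarrow> real) \<Rightarrow> real" where
  "E f \<equiv> measure_pmf.expectation \<nu> f"

abbreviation S :: "rcpb_state \<Rightarrow> nat \<Rightarrow> real" where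
  "S \<equiv> fractions n"

abbreviation birth :: "nat \<Rightarrow> rcpb_state \<Rightarrow> real" where
  "birth \<equiv> birth_flow lam n"

abbreviation drift :: "nat \<Rightarrow> rcpb_state \<Rightarrow> real" where
  "drift \<equiv> net_flow lam n"

lemma S_fraction_space [simp]: "S x \<in> fraction_space"
  unfolding fractions_def by (rule queue_fractions_fraction_space[OF n])

lemma S_bounds: "0 \<le> S x k" "S x k \<le> 1" "S x (Suc k) \<le> S x k" "S x 0 = 1"
  using S_fraction_space[of x] by (auto simp: fraction_space_def simp del: S_fraction_space)

lemma stateD: "x \<in> set_pmf \<nu> \<Longrightarrow> length (fst x) = n \<and> snd x \<le> c \<and> snd x \<le> idle (fst x)"
  using supp by (auto simp: rcpb_states_def)

lemma generator_bounded:
  assumes "\<And>s m. s \<in> fraction_space \<Longrightarrow> m \<le> c \<Longrightarrow> \<bar>g s m\<bar> \<le> B" and "x \<in> set_pmf \<nu>"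
  shows "\<bar>rcpb_generator lam c mu n (\<lambda>x. g (S x) (snd x)) x\<bar> \<le> real n * (lam + 1 + mu) * (2 * B)"
proof (rule rcpb_generator_bounded)
  show "x \<in> rcpb_states n c" using assms(2) supp by blast
  show "\<bar>g (S y) (snd y)\<bar> \<le> B" if "y \<in> rcpb_states n c" for y
    by (rule assms(1)[OF S_fraction_space]) (use that in \<open>auto simp: rcpb_states_def\<close>)
qed (use lam mu in auto)

lemma E_generator:
  assumes "\<And>s m. s \<in> fraction_space \<Longrightarrow> m \<le> c \<Longrightarrow> \<bar>g s m\<bar> \<le> B"
  shows "E (rcpb_generator lam c mu n (\<lambda>x. g (S x) (snd x))) = 0"
  unfolding fractions_def by (rule stationary[OF assms])

lemma sum_birth:
  assumes "x \<in> set_pmf \<nu>" "k \<ge> 1"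
  shows "(\<Sum>i<n. arrival_rate lam n (fst x) (snd x) i * of_bool (fst x ! i + 1 = k)) = real n * birth k x"
proof (cases "snd x = 0")
  case True
  have "(\<Sum>i<n. arrival_rate lam n (fst x) (snd x) i * of_bool (fst x ! i + 1 = k))
      = lam * (\<Sum>i<n. of_bool (fst x ! i = k - 1))"
    unfolding sum_distrib_left by (rule sum.cong) (use True assms in \<open>auto simp: arrival_rate_def\<close>)
  also have "\<dots> = real n * birth k x"
    using True assms(2) sum_queues_of_length[OF n, of "fst x" "k - 1"] by (simp add: birth_flow_def fractions_def)
  finally show ?thesis .
next
  case False
  have "(\<Sum>i<n. arrival_rate lam n (fst x) (snd x) i * of_bool (fst x ! i + 1 = k))
      = of_bool (k = 1) * (\<Sum>i<n. arrival_rate lam n (fst x) (snd x) i)"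
    unfolding sum_distrib_left by (rule sum.cong) (use False assms(2) in \<open>auto simp: arrival_rate_def\<close>)
  also have "\<dots> = real n * birth k x"
    using False sum_arrival_rate[of "fst x" "snd x" n c lam] assms supp by (auto simp: birth_flow_def)
  finally show ?thesis .
qed

lemma birth_bounds: "k \<ge> 1 \<Longrightarrow> 0 \<le> birth k x" "k \<ge> 1 \<Longrightarrow> birth k x \<le> 1"
proof -
  assume k: "k \<ge> 1"
  have s: "S x k \<le> S x (k - 1)" using S_bounds(3)[of x "k - 1"] k by simp
  then show "0 \<le> birth k x" using lam by (simp add: birth_flow_def)
  have "lam * (S x (k - 1) - S x k) \<le> 1 * 1"
    using lam s S_bounds(1)[of x k] S_bounds(2)[of x "k-1"] by (intro mult_mono) auto
  then show "birth k x \<le> 1" using lam by (simp add: birth_flow_def)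
qed

lemma generator_coordinate:
  assumes x: "x \<in> set_pmf \<nu>" and k: "k \<ge> 1"
  shows "rcpb_generator lam c mu n (\<lambda>x. u (S x k)) x =
      real n * birth k x * (u (S x k + 1 / real n) - u (S x k))
      + real n * (S x k - S x (k + 1)) * (u (S x k - 1 / real n) - u (S x k))"
proof -
  obtain q m where xq: "x = (q, m)" by force
  let ?v = "queue_fractions n q k"
  have len: "length q = n" using stateD[OF x] by (simp add: xq)
  have "rcpb_generator lam c mu n (\<lambda>x. u (S x k)) x =
      (\<Sum>i<n. arrival_rate lam n q m i * of_bool (q ! i + 1 = k)) * (u (S x k + 1 / real n) - u (S x k))
      + (\<Sum>i<n. of_bool (q ! i = k)) * (u (S x k - 1 / real n) - u (S x k))"
    unfolding xq rcpb_generator.simps sum_distrib_right fractions_def fst_conv diff_self mult_zero_right add_0_right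
  proof (intro arg_cong2[where f=plus] sum.cong refl)
    fix i assume "i \<in> {..<n}"
    then have i: "i < n" by simp
    show "arrival_rate lam n q m i * (u (queue_fractions n (q[i := q ! i + 1]) k) - u (?v))
      = arrival_rate lam n q m i * of_bool (q ! i + 1 = k)
          * (u (?v + 1 / real n) - u (?v))"
      unfolding queue_fractions_arrival[OF i len] by (cases "q ! i + 1 = k") simp_all
    show "of_bool (0 < q ! i) * (u (queue_fractions n (q[i := q ! i - 1]) k) - u (?v))
      = of_bool (q ! i = k) * (u (?v - 1 / real n) - u (?v))"
      using k queue_fractions_departure[OF i len, of k] by (cases "q ! i > 0"; cases "q ! i = k") simp_all
  qed
  then show ?thesis
    using sum_birth[OF x k] sum_queues_of_length[OF n, of q k] by (simp add: xq fractions_def)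
qed

lemma drift_abs: "k \<ge> 1 \<Longrightarrow> \<bar>drift k x\<bar> \<le> 2"
  using birth_bounds[of k x] S_bounds(1,2)[of x k] S_bounds(1,2)[of x "k + 1"] S_bounds(3)[of x k]
  by (auto simp: net_flow_def)

lemma E_drift_zero:
  assumes "k \<ge> 1"
  shows "E (drift k) = 0"
proof -
  have "E (rcpb_generator lam c mu n (\<lambda>x. S x k)) = 0"
    unfolding fractions_def by (rule stationary[where g="\<lambda>s m. s k" and B=1]) (auto simp: fraction_space_def)
  also have "E (rcpb_generator lam c mu n (\<lambda>x. S x k)) = E (drift k)"
  proof (rule expectation_pmf_cong)
    fix x assume "x \<in> set_pmf \<nu>"
    from generator_coordinate[OF this assms, of "\<lambda>z. z"]
    show "rcpb_generator lam c mu n (\<lambda>x. S x k) x = drift k x"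
      using n by (simp add: net_flow_def)
  qed
  finally show ?thesis .
qed

text \<open>
  The smoothed positive part of \<open>S k - a\<close> has derivative \<open>ramp e (S k - a)\<close>, and Taylor's remainder
  is \<open>O(1 / (n\<^sup>2 * e))\<close> for each jump, at total rate at most \<open>2 * n\<close>.
\<close>
lemma E_ramp_drift:
  assumes k: "k \<ge> 1" and e: "e > 0"
  shows "- 1 / (real n * e) \<le> E (\<lambda>x. ramp e (S x k - a) * drift k x)"
proof -
  let ?W = "\<lambda>x. ramp e (S x k - a) * drift k x"
  let ?G = "rcpb_generator lam c mu n (\<lambda>x. smooth_pos e (S x k - a))"
  have sb: "\<bar>smooth_pos e y\<bar> \<le> (y\<^sup>2 + (y - e)\<^sup>2) / (2 * e)" for y
  proof -
    have "(max y 0)\<^sup>2 \<le> y\<^sup>2" "(max (y - e) 0)\<^sup>2 \<le> (y - e)\<^sup>2" by (auto simp: max_def)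
    moreover have "0 \<le> (max y 0)\<^sup>2" "0 \<le> (max (y - e) 0)\<^sup>2" by auto
    ultimately have "\<bar>(max y 0)\<^sup>2 - (max (y - e) 0)\<^sup>2\<bar> \<le> y\<^sup>2 + (y - e)\<^sup>2" by linarith
    then show ?thesis using e by (simp add: smooth_pos_def abs_divide divide_right_mono)
  qed
  have sqb: "(s - b)\<^sup>2 \<le> (1 + \<bar>b\<bar>)\<^sup>2" if "0 \<le> s" "s \<le> 1" for s b :: real
    by (subst abs_le_square_iff[symmetric]) (use that in auto)
  define B where "B = ((1 + \<bar>a\<bar>)\<^sup>2 + (1 + \<bar>a + e\<bar>)\<^sup>2) / (2 * e)"
  have B: "\<bar>smooth_pos e (s k - a)\<bar> \<le> B" if "s \<in> fraction_space" for s
  proof -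
    from that have s: "0 \<le> s k" "s k \<le> 1" by (auto simp: fraction_space_def)
    have "\<bar>smooth_pos e (s k - a)\<bar> \<le> ((s k - a)\<^sup>2 + (s k - (a + e))\<^sup>2) / (2 * e)"
      using sb[of "s k - a"] by (simp add: diff_diff_eq)
    also have "\<dots> \<le> ((1 + \<bar>a\<bar>)\<^sup>2 + (1 + \<bar>a + e\<bar>)\<^sup>2) / (2 * e)"
      using e by (intro divide_right_mono add_mono sqb s) auto
    finally show ?thesis by (simp add: B_def)
  qed
  have G0: "E ?G = 0" using E_generator[where g="\<lambda>s m. smooth_pos e (s k - a)" and B=B] B by simp
  have Gb: "\<bar>?G x\<bar> \<le> real n * (lam + 1 + mu) * (2 * B)" if "x \<in> set_pmf \<nu>" for x
    using generator_bounded[where g="\<lambda>s m. smooth_pos e (s k - a)" and B=B] B that by simp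
  define N where "N = real n"
  have N: "N > 0" using n by (simp add: N_def)
  have pt: "?G x \<le> ?W x + 1 / (N * e)"
    if x: "x \<in> set_pmf \<nu>" for x
  proof -
    define y where "y = S x k - a"
    define b d where "b = birth k x" and "d = S x k - S x (k + 1)"
    have b: "0 \<le> b" "b \<le> 1" and d: "0 \<le> d" "d \<le> 1"
      using birth_bounds[OF k, of x] S_bounds(1,2)[of x k] S_bounds(1)[of x "k+1"] S_bounds(3)[of x k]
      by (auto simp: b_def d_def)
    have G: "?G x = N * b * (smooth_pos e (y + 1 / N) - smooth_pos e y)
       + N * d * (smooth_pos e (y + (- 1 / N)) - smooth_pos e y)"
      using generator_coordinate[OF x k, of "\<lambda>z. smooth_pos e (z - a)"]
      by (simp add: b_def d_def y_def N_def algebra_simps)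
    also have "\<dots> \<le> N * b * (ramp e y * (1 / N) + (1 / N)\<^sup>2 / (2 * e))
        + N * d * (ramp e y * (- 1 / N) + (- 1 / N)\<^sup>2 / (2 * e))"
      using N b d by (intro add_mono mult_left_mono smooth_pos_taylor e) auto
    also have "\<dots> = ramp e y * (b - d) + (b + d) * (1 / (2 * N * e))"
      using N e by (simp add: field_simps power2_eq_square)
    also have "\<dots> \<le> ramp e y * (b - d) + 2 * (1 / (2 * N * e))"
      using N e b d by (intro add_left_mono mult_right_mono) auto
    finally show "?G x \<le> ?W x + 1 / (N * e)"
      by (simp add: net_flow_def b_def d_def y_def)
  qed
  have wd: "\<bar>?W x\<bar> \<le> 2" for x
    using mult_mono[of "\<bar>ramp e (S x k - a)\<bar>" 1 "\<bar>drift k x\<bar>" 2] drift_abs[OF k, of x]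
      ramp_bounds(1,2)[OF e, of "S x k - a"] by (simp add: abs_mult)
  have "E ?G \<le> E (\<lambda>x. ?W x + 1 / (N * e))"
    by (rule expectation_pmf_mono[OF Gb _ pt, where B="2 + 1 / (N * e)"])
       (use wd N e in \<open>auto intro!: order.trans[OF abs_triangle_ineq] add_mono\<close>)
  also have "\<dots> = E (\<lambda>x. ?W x) + 1 / (N * e)"
    by (subst Bochner_Integration.integral_add) (auto intro!: integrable_pmf_bounded[OF wd])
  finally show ?thesis by (simp add: G0 N_def)
qed

lemma sum_drift:
  assumes "1 \<le> j" "j \<le> K"
  shows "(\<Sum>k=j..K. drift k x) =
    (if snd x = 0 then lam * (S x (j - 1) - S x K) else if j = 1 then lam else 0) - S x j + S x (Suc K)"
  using assms(2)
proof (induction rule: dec_induct)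
  case base
  then show ?case by (simp add: net_flow_def birth_flow_def)
next
  case (step K)
  then show ?case
    using assms(1)
    by (cases "snd x = 0") (simp_all add: net_flow_def[of _ _ "Suc K"] birth_flow_def[of _ _ "Suc K"] algebra_simps)
qed

lemma E_S_tendsto_0: "(\<lambda>k. E (\<lambda>x. S x k)) \<longlonglongrightarrow> 0"
proof -
  have "(\<lambda>k. E (\<lambda>x. S x k)) \<longlonglongrightarrow> E (\<lambda>x. 0)"
    by (rule integral_dominated_convergence[where w="\<lambda>_. 1"])
       (use S_bounds in \<open>auto simp: fractions_def queue_fractions_tendsto_0\<close>)
  then show ?thesis by simp
qed

text \<open>
  Flow balance across level \<open>j\<close>: the drifts of \<open>S j\<close>, ..., \<open>S K\<close> telescope, and the boundary terms at \<open>K\<close>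
  disappear as \<open>K\<close> tends to infinity. Summing before passing to the limit keeps the test functions bounded;
  the total number of jobs would be an unbounded one.
\<close>
lemma E_S_balance:
  assumes j: "j \<ge> 1"
  shows "E (\<lambda>x. S x j) = E (\<lambda>x. if snd x = 0 then lam * S x (j - 1) else if j = 1 then lam else 0)"
proof -
  define A where "A x = (if snd x = 0 then lam * S x (j - 1) else if j = 1 then lam else 0) - S x j" for x
  have Ab: "\<bar>A x\<bar> \<le> 2" for x
  proof -
    have "lam * S x (j - 1) \<le> 1 * 1" "0 \<le> lam * S x (j - 1)"
      using S_bounds(1,2)[of x "j - 1"] lam by (intro mult_mono mult_nonneg_nonneg; simp)+
    then show ?thesis using S_bounds(1,2)[of x j] lam by (auto simp: A_def abs_le_iff)
  qed
  have "\<bar>E A\<bar> \<le> E (\<lambda>x. S x K)" if K: "K \<ge> j" for K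
  proof -
    define R where "R x = no_token x * lam * S x K - S x (Suc K)" for x
    have Rb: "\<bar>R x\<bar> \<le> S x K" for x
    proof -
      have "lam * S x K \<le> 1 * S x K" using lam S_bounds(1)[of x K] by (intro mult_right_mono) auto
      moreover have "0 \<le> lam * S x K" using lam S_bounds(1)[of x K] by simp
      ultimately show ?thesis
        using S_bounds(1)[of x "Suc K"] S_bounds(3)[of x K] S_bounds(1)[of x K] by (auto simp: R_def)
    qed
    have Rb1: "\<bar>R x\<bar> \<le> 1" for x using Rb[of x] S_bounds(2)[of x K] by linarith
    have "A x - R x = (\<Sum>k=j..K. drift k x)" for x
      unfolding sum_drift[OF j K] by (simp add: A_def R_def algebra_simps)
    then have "E (\<lambda>x. A x - R x) = E (\<lambda>x. \<Sum>k=j..K. drift k x)" by simp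
    also have "\<dots> = (\<Sum>k=j..K. E (drift k))"
      using j by (intro Bochner_Integration.integral_sum integrable_pmf_bounded[where B=2] drift_abs) auto
    also have "\<dots> = 0" using j E_drift_zero by (intro sum.neutral) auto
    finally have "E A = E R"
      by (subst (asm) Bochner_Integration.integral_diff) (auto intro: integrable_pmf_bounded Ab Rb1)
    also have "\<bar>E R\<bar> \<le> E (\<lambda>x. \<bar>R x\<bar>)" by (rule integral_abs_bound)
    also have "\<dots> \<le> E (\<lambda>x. S x K)"
      by (rule expectation_pmf_mono[where A=1 and B=1]) (use Rb Rb1 S_bounds in auto)
    finally show ?thesis .
  qed
  then have "\<bar>E A\<bar> \<le> 0"
    by (intro LIMSEQ_le_const[OF E_S_tendsto_0]) auto
  then have "E A = 0" by simp
  moreover have "E A = E (\<lambda>x. if snd x = 0 then lam * S x (j - 1) else if j = 1 then lam else 0) - E (\<lambda>x. S x j)"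
    unfolding A_def
    by (intro Bochner_Integration.integral_diff integrable_pmf_bounded[where B=1])
       (use S_bounds lam in \<open>auto intro!: mult_le_one simp: abs_mult\<close>)
  ultimately show ?thesis by simp
qed

lemma E_S1: "E (\<lambda>x. S x 1) = lam"
proof -
  have "E (\<lambda>x. S x 1) = E (\<lambda>x. lam)"
    unfolding E_S_balance[OF order.refl] by (rule expectation_pmf_cong) (simp add: S_bounds)
  then show ?thesis by simp
qed

lemma E_S_le: "k \<ge> 1 \<Longrightarrow> E (\<lambda>x. S x k) \<le> lam ^ k"
proof (induction k rule: dec_induct)
  case base
  show ?case using E_S1 by simp
next
  case (step k)
  have "E (\<lambda>x. S x (Suc k)) \<le> E (\<lambda>x. lam * S x k)"
    unfolding E_S_balance[of "Suc k", simplified]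
    by (rule expectation_pmf_mono[where A=1 and B=1])
       (use step lam S_bounds in \<open>auto intro!: mult_le_one simp: abs_mult\<close>)
  also have "\<dots> = lam * E (\<lambda>x. S x k)" by simp
  also have "\<dots> \<le> lam * lam ^ k" using step lam by (intro mult_left_mono) auto
  finally show ?case by simp
qed

lemma lipschitz_arrival:
  assumes g: "sup_lipschitz L g" and x: "x \<in> set_pmf \<nu>" and i: "i < n"
  shows "\<bar>g (queue_fractions n ((fst x)[i := fst x ! i + 1])) - g (S x)\<bar> \<le> L / real n"
proof -
  have "\<bar>queue_fractions n ((fst x)[i := fst x ! i + 1]) k - S x k\<bar> \<le> 1 / real n" for k
    using queue_fractions_arrival[OF i] stateD[OF x] by (auto simp: fractions_def)
  then have "\<bar>g (queue_fractions n ((fst x)[i := fst x ! i + 1])) - g (S x)\<bar> \<le> L * (1 / real n)"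
    using g queue_fractions_fraction_space[OF n] S_fraction_space unfolding sup_lipschitz_def by blast
  then show ?thesis by simp
qed

lemma lipschitz_departure:
  assumes g: "sup_lipschitz L g" and x: "x \<in> set_pmf \<nu>" and i: "i < n" and p: "fst x ! i > 0"
  shows "\<bar>g (queue_fractions n ((fst x)[i := fst x ! i - 1])) - g (S x)\<bar> \<le> L / real n"
proof -
  have "\<bar>queue_fractions n ((fst x)[i := fst x ! i - 1]) k - S x k\<bar> \<le> 1 / real n" for k
    using queue_fractions_departure[OF i _ p] stateD[OF x] by (auto simp: fractions_def)
  then have "\<bar>g (queue_fractions n ((fst x)[i := fst x ! i - 1])) - g (S x)\<bar> \<le> L * (1 / real n)"
    using g queue_fractions_fraction_space[OF n] S_fraction_space unfolding sup_lipschitz_def by blast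
  then show ?thesis by simp
qed

lemma abs_sum_queue_jumps_le:
  assumes x: "x \<in> set_pmf \<nu>" and "0 \<le> D"
    and a: "\<And>i. i < n \<Longrightarrow> \<bar>a i\<bar> \<le> D" and b: "\<And>i. i < n \<Longrightarrow> fst x ! i > 0 \<Longrightarrow> \<bar>b i\<bar> \<le> D"
  shows "\<bar>(\<Sum>i<n. arrival_rate lam n (fst x) (snd x) i * a i) + (\<Sum>i<n. of_bool (fst x ! i > 0) * b i)\<bar>
      \<le> 2 * real n * D"
proof -
  have "\<bar>\<Sum>i<n. arrival_rate lam n (fst x) (snd x) i * a i\<bar>
      \<le> (\<Sum>i<n. arrival_rate lam n (fst x) (snd x) i * D)"
    using a arrival_rate_nonneg[of lam n] lam
    by (intro order.trans[OF sum_abs] sum_mono) (auto simp: abs_mult intro!: mult_left_mono)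
  also have "\<dots> = real n * lam * D"
    using sum_arrival_rate[of "fst x" "snd x" n c lam] x supp by (auto simp: sum_distrib_right[symmetric])
  also have "\<dots> \<le> real n * 1 * D" using lam assms(2) by (intro mult_right_mono mult_left_mono) auto
  finally have 1: "\<bar>\<Sum>i<n. arrival_rate lam n (fst x) (snd x) i * a i\<bar> \<le> real n * D" by simp
  have "\<bar>\<Sum>i<n. of_bool (fst x ! i > 0) * b i\<bar> \<le> (\<Sum>i<n. D)"
    using b assms(2) by (intro order.trans[OF sum_abs] sum_mono) auto
  then have 2: "\<bar>\<Sum>i<n. of_bool (fst x ! i > 0) * b i\<bar> \<le> real n * D" by simp
  show ?thesis using 1 2 by linarith
qed

text \<open>
  Separation of time scales. In the increments of \<open>g S * h M\<close> the part due to \<open>g\<close> is at most \<open>L * H / n\<close>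
  per jump, at rate at most \<open>2 * n\<close>; what remains is \<open>g S\<close> times the increment of \<open>h\<close>, at a rate
  proportional to \<open>n\<close>.
\<close>
lemma E_token_balance:
  assumes g: "sup_lipschitz L g" and h: "\<And>m. m \<le> c \<Longrightarrow> \<bar>h m\<bar> \<le> H"
  shows "\<bar>E (\<lambda>x. g (S x) * (lam * (h (snd x - 1) - h (snd x))
      + of_bool (snd x < c) * (mu * (1 - S x 1 - real (snd x) / real n)) * (h (snd x + 1) - h (snd x))))\<bar>
      \<le> 2 * L * H / real n" (is "\<bar>E ?X\<bar> \<le> _")
proof -
  let ?G = "rcpb_generator lam c mu n (\<lambda>x. g (S x) * h (snd x))"
  have L: "0 \<le> L" using sup_lipschitz_nonneg[OF g] .
  have H: "0 \<le> H" using h[of 0] by simp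
  have B: "\<bar>g s * h m\<bar> \<le> L * H" if "s \<in> fraction_space" "m \<le> c" for s m
    unfolding abs_mult using g h[OF that(2)] that(1) L
    by (intro mult_mono) (auto simp: sup_lipschitz_def)
  have G0: "E ?G = 0" by (rule E_generator[where g="\<lambda>s m. g s * h m", OF B])
  have Gb: "\<bar>?G x\<bar> \<le> real n * (lam + 1 + mu) * (2 * (L * H))" if "x \<in> set_pmf \<nu>" for x
    by (rule generator_bounded[where g="\<lambda>s m. g s * h m", OF B that])
  have pt: "\<bar>?G x - real n * ?X x\<bar> \<le> 2 * L * H" if x: "x \<in> set_pmf \<nu>" for x
  proof -
    obtain q m where xq: "x = (q, m)" by force
    let ?b = "\<lambda>i. queue_fractions n (q[i := q ! i - 1])"
    let ?a = "\<lambda>i. queue_fractions n (q[i := q ! i + 1])"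
    have m: "m \<le> c" and len: "length q = n" using stateD[OF x] by (auto simp: xq)
    have ar: "(\<Sum>i<n. arrival_rate lam n q m i) = real n * lam"
      using sum_arrival_rate[of q m n c lam] x supp by (auto simp: xq)
    define A where "A = (\<Sum>i<n. arrival_rate lam n (fst x) (snd x) i *
          ((g (?a i) - g (S x)) * h (m - 1)))"
    define D where "D = (\<Sum>i<n. of_bool (fst x ! i > 0) *
          ((g (?b i) - g (S x)) * h m))"
    have e1: "(\<Sum>i<n. arrival_rate lam n q m i * (g (?a i) * h (m - 1) - g (S x) * h m))
         = A + real n * lam * (g (S x) * (h (m - 1) - h m))"
      unfolding ar[symmetric] sum_distrib_right sum.distrib[symmetric] A_def
      by (intro sum.cong refl) (simp add: xq algebra_simps)
    have e2: "(\<Sum>i<n. of_bool (q ! i > 0) * (g (?b i) * h m - g (S x) * h m)) = D"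
      unfolding D_def by (simp only: left_diff_distrib xq fst_conv)
    have e3: "real (idle q) - real m = real n * (1 - S x 1 - real m / real n)"
      using idle_eq_queue_fractions[OF n len] n by (simp add: fractions_def xq right_diff_distrib)
    have "?G x = A + real n * lam * (g (S x) * (h (m - 1) - h m)) + D
        + of_bool (m < c) * (mu * (real (idle q) - real m)) * (g (S x) * h (m + 1) - g (S x) * h m)"
      unfolding e1[symmetric] e2[symmetric] by (simp add: xq fractions_def)
    also have "\<dots> = real n * ?X x + (A + D)"
      unfolding e3 by (simp only: xq snd_conv algebra_simps)
    finally have "?G x - real n * ?X x = A + D" by simp
    also have "\<bar>\<dots>\<bar> \<le> 2 * real n * (L / real n * H)"
      unfolding A_def D_def
    proof (rule abs_sum_queue_jumps_le[OF x])
      show "0 \<le> L / real n * H" using L H by simp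
      show "\<bar>(g (?a i) - g (S x)) * h (m - 1)\<bar> \<le> L / real n * H" if "i < n" for i
        unfolding abs_mult using lipschitz_arrival[OF g x that] h[of "m - 1"] m L
        by (intro mult_mono) (auto simp: xq)
      show "\<bar>(g (?b i) - g (S x)) * h m\<bar> \<le> L / real n * H"
        if "i < n" "fst x ! i > 0" for i
        unfolding abs_mult using lipschitz_departure[OF g x that] h[of m] m L
        by (intro mult_mono) (auto simp: xq)
    qed
    finally show ?thesis using n by simp
  qed
  have nX: "\<bar>real n * ?X x\<bar> \<le> real n * (lam + 1 + mu) * (2 * (L * H)) + 2 * L * H" if "x \<in> set_pmf \<nu>" for x
    using Gb[OF that] pt[OF that] by linarith
  have "\<bar>E (\<lambda>x. ?G x - real n * ?X x)\<bar> \<le> 2 * L * H" by (rule expectation_pmf_abs_le[OF pt])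
  also have "E (\<lambda>x. ?G x - real n * ?X x) = E ?G - E (\<lambda>x. real n * ?X x)"
    by (rule Bochner_Integration.integral_diff[OF integrable_pmf_bounded[OF Gb] integrable_pmf_bounded[OF nX]])
  also have "\<dots> = - (real n * E ?X)" unfolding G0 by (simp only: integral_mult_right_zero)
  finally have "real n * \<bar>E ?X\<bar> \<le> 2 * L * H" by (simp only: abs_minus_cancel abs_mult abs_of_nat)
  then show ?thesis using n by (simp add: field_simps)
qed

text \<open>
  The product rule for the observable \<open>(S k - a) * g S\<close>: the terms in which \<open>g\<close> varies are small wherever
  \<open>S k\<close> is close to \<open>a\<close>, and so is the product of two increments. This converts concentration of \<open>S k\<close>
  at \<open>a\<close> into near orthogonality of its drift to every Lipschitz function.
\<close>
lemma E_lipschitz_drift: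
  assumes g: "sup_lipschitz L g" and k: "k \<ge> 1"
  shows "\<bar>E (\<lambda>x. g (S x) * drift k x)\<bar> \<le> 2 * L * E (\<lambda>x. \<bar>S x k - a\<bar>) + 2 * L / real n"
proof -
  let ?X = "\<lambda>x. g (S x) * drift k x"
  let ?G = "rcpb_generator lam c mu n (\<lambda>x. (S x k - a) * g (S x))"
  have L: "0 \<le> L" using sup_lipschitz_nonneg[OF g] .
  have ga: "\<bar>g (S x)\<bar> \<le> L" for x using g by (auto simp: sup_lipschitz_def)
  have B: "\<bar>(s k - a) * g s\<bar> \<le> (1 + \<bar>a\<bar>) * L" if "s \<in> fraction_space" for s
  proof -
    have "0 \<le> s k" "s k \<le> 1" using that by (auto simp: fraction_space_def)
    then have "\<bar>s k - a\<bar> \<le> 1 + \<bar>a\<bar>" by linarith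
    then show ?thesis unfolding abs_mult using g that by (intro mult_mono) (auto simp: sup_lipschitz_def)
  qed
  have G0: "E ?G = 0" by (rule E_generator[where g="\<lambda>s m. (s k - a) * g s", OF B])
  have Gb: "\<bar>?G x\<bar> \<le> real n * (lam + 1 + mu) * (2 * ((1 + \<bar>a\<bar>) * L))" if "x \<in> set_pmf \<nu>" for x
    by (rule generator_bounded[where g="\<lambda>s m. (s k - a) * g s", OF B that])
  have pt: "\<bar>?G x - ?X x\<bar> \<le> 2 * L * \<bar>S x k - a\<bar> + 2 * L / real n" if x: "x \<in> set_pmf \<nu>" for x
  proof -
    obtain q m where xq: "x = (q, m)" by force
    have len: "length q = n" using stateD[OF x] by (auto simp: xq)
    define s where "s = S x"
    define s1 s2 where "s1 i = queue_fractions n (q[i := q ! i + 1])"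
      and "s2 i = queue_fractions n (q[i := q ! i - 1])" for i
    have "drift k x = rcpb_generator lam c mu n (\<lambda>x. S x k) x"
      using generator_coordinate[OF x k, of "\<lambda>z. z"] n by (simp add: net_flow_def)
    also have "\<dots> = (\<Sum>i<n. arrival_rate lam n q m i * (s1 i k - s k))
        + (\<Sum>i<n. of_bool (q ! i > 0) * (s2 i k - s k))"
      unfolding xq rcpb_generator.simps by (simp add: s_def s1_def s2_def fractions_def xq)
    finally have d: "?X x = (\<Sum>i<n. arrival_rate lam n q m i * ((s1 i k - s k) * g s))
        + (\<Sum>i<n. of_bool (q ! i > 0) * ((s2 i k - s k) * g s))"
      by (simp only: s_def sum_distrib_left distrib_left mult.assoc mult.commute[of "g (S x)"])
    have "?G x = (\<Sum>i<n. arrival_rate lam n q m i * ((s1 i k - a) * g (s1 i) - (s k - a) * g s))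
        + (\<Sum>i<n. of_bool (q ! i > 0) * ((s2 i k - a) * g (s2 i) - (s k - a) * g s))"
      unfolding xq rcpb_generator.simps by (simp add: s_def s1_def s2_def fractions_def xq)
    also have "\<dots> = ((\<Sum>i<n. arrival_rate lam n q m i * ((s1 i k - s k) * g s))
        + (\<Sum>i<n. arrival_rate lam n (fst x) (snd x) i * ((s1 i k - a) * (g (s1 i) - g s))))
      + ((\<Sum>i<n. of_bool (q ! i > 0) * ((s2 i k - s k) * g s))
        + (\<Sum>i<n. of_bool (fst x ! i > 0) * ((s2 i k - a) * (g (s2 i) - g s))))"
      unfolding sum.distrib[symmetric]
      by (intro arg_cong2[where f=plus] sum.cong refl) (simp_all add: xq algebra_simps)
    finally have "?G x - ?X x =
        (\<Sum>i<n. arrival_rate lam n (fst x) (snd x) i * ((s1 i k - a) * (g (s1 i) - g s)))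
        + (\<Sum>i<n. of_bool (fst x ! i > 0) * ((s2 i k - a) * (g (s2 i) - g s)))"
      unfolding d by linarith
    also have "\<bar>\<dots>\<bar> \<le> 2 * real n * ((\<bar>S x k - a\<bar> + 1 / real n) * (L / real n))"
    proof (rule abs_sum_queue_jumps_le[OF x])
      show "0 \<le> (\<bar>S x k - a\<bar> + 1 / real n) * (L / real n)" using L by simp
      fix i assume i: "i < n"
      have "\<bar>s1 i k - S x k\<bar> \<le> 1 / real n"
        using queue_fractions_arrival[OF i len] by (auto simp: s1_def fractions_def xq)
      then have "\<bar>s1 i k - a\<bar> \<le> \<bar>S x k - a\<bar> + 1 / real n" by linarith
      then show "\<bar>(s1 i k - a) * (g (s1 i) - g s)\<bar> \<le> (\<bar>S x k - a\<bar> + 1 / real n) * (L / real n)"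
        unfolding abs_mult using lipschitz_arrival[OF g x i]
        by (intro mult_mono) (auto simp: xq s1_def s_def)
      assume p: "fst x ! i > 0"
      have "\<bar>s2 i k - S x k\<bar> \<le> 1 / real n"
        using queue_fractions_departure[OF i len, of k] p by (auto simp: s2_def fractions_def xq)
      then have "\<bar>s2 i k - a\<bar> \<le> \<bar>S x k - a\<bar> + 1 / real n" by linarith
      then show "\<bar>(s2 i k - a) * (g (s2 i) - g s)\<bar> \<le> (\<bar>S x k - a\<bar> + 1 / real n) * (L / real n)"
        unfolding abs_mult using lipschitz_departure[OF g x i p]
        by (intro mult_mono) (auto simp: xq s2_def s_def)
    qed
    also have "\<dots> = 2 * L * \<bar>S x k - a\<bar> + 2 * L / real n"
      using n by (simp add: field_simps)
    finally show ?thesis .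
  qed
  have gd: "\<bar>?X x\<bar> \<le> L * 2" for x
    unfolding abs_mult using ga drift_abs[OF k] L by (intro mult_mono) auto
  have Sa: "\<bar>\<bar>S x k - a\<bar>\<bar> \<le> 1 + \<bar>a\<bar>" for x using S_bounds(1,2)[of x k] by linarith
  have "\<bar>E (\<lambda>x. ?X x)\<bar> = \<bar>E (\<lambda>x. ?G x - ?X x)\<bar>"
    by (subst Bochner_Integration.integral_diff[OF integrable_pmf_bounded[OF Gb] integrable_pmf_bounded[OF gd]])
       (simp_all add: G0)
  also have "\<dots> \<le> E (\<lambda>x. \<bar>?G x - ?X x\<bar>)" by (rule integral_abs_bound)
  also have "\<dots> \<le> E (\<lambda>x. 2 * L * \<bar>S x k - a\<bar> + 2 * L / real n)"
  proof (rule expectation_pmf_mono[OF _ _ pt])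
    show "\<bar>\<bar>?G x - ?X x\<bar>\<bar> \<le> real n * (lam + 1 + mu) * (2 * ((1 + \<bar>a\<bar>) * L)) + L * 2"
      if "x \<in> set_pmf \<nu>" for x using Gb[OF that] gd[of x] by linarith
    show "\<bar>2 * L * \<bar>S x k - a\<bar> + 2 * L / real n\<bar> \<le> 2 * L * (1 + \<bar>a\<bar>) + 2 * L / real n" for x
      using L mult_left_mono[OF Sa[of x], of "2 * L"] by (simp add: abs_of_nonneg)
  qed
  also have "\<dots> = 2 * L * E (\<lambda>x. \<bar>S x k - a\<bar>) + 2 * L / real n"
    by (subst Bochner_Integration.integral_add) (auto intro!: integrable_mult_right integrable_pmf_bounded[OF Sa])
  finally show ?thesis .
qed

end

section \<open>Sequences of equilibria\<close>

locale rcpb_sequence =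
  fixes c :: "nat \<Rightarrow> nat" and lam :: real and mu :: "nat \<Rightarrow> real"
    and \<nu> :: "nat \<Rightarrow> rcpb_state pmf" and N :: nat
  assumes equilibrium: "n \<ge> N \<Longrightarrow> rcpb_equilibrium n (c n) lam (mu n) (\<nu> n)"
begin

abbreviation E :: "nat \<Rightarrow> (rcpb_state \<Rightarrow> real) \<Rightarrow> real" where
  "E n f \<equiv> measure_pmf.expectation (\<nu> n) f"

lemma lam: "0 < lam" "lam < 1"
  using rcpb_equilibrium.lam[OF equilibrium[OF order.refl]] .

lemma n_ge_1: "n \<ge> N \<Longrightarrow> n \<ge> 1"
  using rcpb_equilibrium.n[OF equilibrium] .

lemma fractions_mem: "n \<ge> N \<Longrightarrow> fractions n x \<in> fraction_space"
  by (rule rcpb_equilibrium.S_fraction_space[OF equilibrium])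

lemma fractions_bounds:
  assumes "n \<ge> N"
  shows "0 \<le> fractions n x k" "fractions n x k \<le> 1" "fractions n x (Suc k) \<le> fractions n x k"
    "fractions n x 0 = 1"
  using fractions_mem[OF assms, of x] by (auto simp: fraction_space_def)

text \<open>
  The eventual uniform bound makes the functions integrable, so that sums and comparisons of vanishing
  sequences need no side conditions.
\<close>
definition vanishing :: "(nat \<Rightarrow> rcpb_state \<Rightarrow> real) \<Rightarrow> bool" where
  "vanishing F \<longleftrightarrow> (\<exists>B. \<forall>\<^sub>F n in sequentially. \<forall>x\<in>set_pmf (\<nu> n). \<bar>F n x\<bar> \<le> B) \<and>
     (\<lambda>n. E n (F n)) \<longlonglongrightarrow> 0"

lemma vanishingI:
  assumes "\<And>n x. n \<ge> N \<Longrightarrow> x \<in> set_pmf (\<nu> n) \<Longrightarrow> \<bar>F n x\<bar> \<le> B" "(\<lambda>n. E n (F n)) \<longlonglongrightarrow> 0"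
  shows "vanishing F"
  unfolding vanishing_def
proof (intro conjI exI[of _ B] assms(2))
  show "\<forall>\<^sub>F n in sequentially. \<forall>x\<in>set_pmf (\<nu> n). \<bar>F n x\<bar> \<le> B"
    using eventually_ge_at_top[of N] by eventually_elim (use assms(1) in blast)
qed

lemma vanishing_tendsto: "vanishing F \<Longrightarrow> (\<lambda>n. E n (F n)) \<longlonglongrightarrow> 0"
  by (simp add: vanishing_def)

lemma vanishing_integrable:
  assumes "vanishing F" shows "\<forall>\<^sub>F n in sequentially. integrable (\<nu> n) (F n)"
proof -
  obtain B where "\<forall>\<^sub>F n in sequentially. \<forall>x\<in>set_pmf (\<nu> n). \<bar>F n x\<bar> \<le> B"
    using assms by (auto simp: vanishing_def)
  then show ?thesis by eventually_elim (auto intro: integrable_pmf_bounded)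
qed

lemma vanishing_add:
  assumes F: "vanishing F" and H: "vanishing H"
  shows "vanishing (\<lambda>n x. F n x + H n x)"
proof -
  obtain A B where A: "\<forall>\<^sub>F n in sequentially. \<forall>x\<in>set_pmf (\<nu> n). \<bar>F n x\<bar> \<le> A"
    and B: "\<forall>\<^sub>F n in sequentially. \<forall>x\<in>set_pmf (\<nu> n). \<bar>H n x\<bar> \<le> B"
    using assms by (auto simp: vanishing_def)
  have "\<forall>\<^sub>F n in sequentially. \<forall>x\<in>set_pmf (\<nu> n). \<bar>F n x + H n x\<bar> \<le> A + B"
    using A B by eventually_elim (force intro: order.trans[OF abs_triangle_ineq] add_mono)
  moreover have "(\<lambda>n. E n (\<lambda>x. F n x + H n x)) \<longlonglongrightarrow> 0"
  proof (rule Lim_transform_eventually)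
    show "(\<lambda>n. E n (F n) + E n (H n)) \<longlonglongrightarrow> 0"
      using tendsto_add[OF vanishing_tendsto[OF F] vanishing_tendsto[OF H]] by simp
    show "\<forall>\<^sub>F n in sequentially. E n (F n) + E n (H n) = E n (\<lambda>x. F n x + H n x)"
      using vanishing_integrable[OF F] vanishing_integrable[OF H] by eventually_elim simp
  qed
  ultimately show ?thesis unfolding vanishing_def by blast
qed

lemma vanishing_cmult:
  assumes F: "vanishing F"
  shows "vanishing (\<lambda>n x. a * F n x)"
proof -
  obtain A where A: "\<forall>\<^sub>F n in sequentially. \<forall>x\<in>set_pmf (\<nu> n). \<bar>F n x\<bar> \<le> A"
    using assms by (auto simp: vanishing_def)
  have "\<forall>\<^sub>F n in sequentially. \<forall>x\<in>set_pmf (\<nu> n). \<bar>a * F n x\<bar> \<le> \<bar>a\<bar> * A"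
    using A by eventually_elim (simp add: abs_mult mult_left_mono)
  moreover have "(\<lambda>n. E n (\<lambda>x. a * F n x)) \<longlonglongrightarrow> 0"
    using tendsto_mult_left[OF vanishing_tendsto[OF F], of a] by simp
  ultimately show ?thesis unfolding vanishing_def by blast
qed

lemma vanishing_diff:
  "vanishing F \<Longrightarrow> vanishing H \<Longrightarrow> vanishing (\<lambda>n x. F n x - H n x)"
  using vanishing_add[OF _ vanishing_cmult[of H "-1"], of F] by simp

lemma vanishing_cong_eventually:
  assumes "vanishing F" and eq: "\<forall>\<^sub>F n in sequentially. \<forall>x\<in>set_pmf (\<nu> n). F n x = H n x"
  shows "vanishing H"
proof -
  obtain A where A: "\<forall>\<^sub>F n in sequentially. \<forall>x\<in>set_pmf (\<nu> n). \<bar>F n x\<bar> \<le> A"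
    using assms by (auto simp: vanishing_def)
  have "\<forall>\<^sub>F n in sequentially. \<forall>x\<in>set_pmf (\<nu> n). \<bar>H n x\<bar> \<le> A"
    using A eq by eventually_elim force
  moreover have "(\<lambda>n. E n (H n)) \<longlonglongrightarrow> 0"
  proof (rule Lim_transform_eventually[OF vanishing_tendsto[OF assms(1)]])
    show "\<forall>\<^sub>F n in sequentially. E n (F n) = E n (H n)"
      using eq by eventually_elim (rule expectation_pmf_cong, blast)
  qed
  ultimately show ?thesis unfolding vanishing_def by blast
qed

lemma vanishing_cong:
  assumes "vanishing F" "\<And>n x. n \<ge> N \<Longrightarrow> x \<in> set_pmf (\<nu> n) \<Longrightarrow> F n x = H n x"
  shows "vanishing H"
proof (rule vanishing_cong_eventually[OF assms(1)])
  show "\<forall>\<^sub>F n in sequentially. \<forall>x\<in>set_pmf (\<nu> n). F n x = H n x"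
    using eventually_ge_at_top[of N] by eventually_elim (use assms(2) in blast)
qed

lemma vanishing_dominated:
  assumes H: "vanishing H" and le: "\<And>n x. n \<ge> N \<Longrightarrow> x \<in> set_pmf (\<nu> n) \<Longrightarrow> \<bar>F n x\<bar> \<le> H n x"
  shows "vanishing F"
proof -
  obtain A where A: "\<forall>\<^sub>F n in sequentially. \<forall>x\<in>set_pmf (\<nu> n). \<bar>H n x\<bar> \<le> A"
    using assms by (auto simp: vanishing_def)
  have FA: "\<forall>\<^sub>F n in sequentially. \<forall>x\<in>set_pmf (\<nu> n). \<bar>F n x\<bar> \<le> A"
    using A eventually_ge_at_top[of N] by eventually_elim (use le in force)
  moreover have "(\<lambda>n. E n (F n)) \<longlonglongrightarrow> 0"
  proof (rule Lim_null_comparison[OF _ vanishing_tendsto[OF H]])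
    show "\<forall>\<^sub>F n in sequentially. norm (E n (F n)) \<le> E n (H n)"
      using A FA eventually_ge_at_top[of N]
    proof eventually_elim
      case (elim n)
      have "\<bar>E n (F n)\<bar> \<le> E n (\<lambda>x. \<bar>F n x\<bar>)" by (rule integral_abs_bound)
      also have "\<dots> \<le> E n (H n)"
        by (rule expectation_pmf_mono[where A=A and B=A]) (use elim le in auto)
      finally show ?case by simp
    qed
  qed
  ultimately show ?thesis unfolding vanishing_def by blast
qed

lemma vanishing_sum:
  "(\<And>i. i \<in> I \<Longrightarrow> vanishing (F i)) \<Longrightarrow> vanishing (\<lambda>n x. \<Sum>i\<in>I. F i n x)"
proof (induction I rule: infinite_finite_induct)
  case (insert i I)
  then show ?case using vanishing_add[of "F i" "\<lambda>n x. \<Sum>i\<in>I. F i n x"] by simp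
qed (auto simp: vanishing_def intro: exI[of _ 0])

lemma vanishing_deterministic:
  assumes "a \<longlonglongrightarrow> 0" shows "vanishing (\<lambda>n x. a n)"
proof -
  have "\<forall>\<^sub>F n in sequentially. \<bar>a n\<bar> < 1"
    using order_tendstoD(2)[OF tendsto_rabs_zero[OF assms], of 1] by simp
  then have "\<forall>\<^sub>F n in sequentially. \<forall>x\<in>set_pmf (\<nu> n). \<bar>a n\<bar> \<le> 1" by eventually_elim simp
  then show ?thesis using assms unfolding vanishing_def by auto
qed

end

section \<open>Concentration of the fractions\<close>

text \<open>
  The cooperative inequality for \<open>d = S - s*\<close>. Each weight is nearly \<open>1\<close> where \<open>d k\<close> is
  positive and \<open>0\<close> elsewhere, so after summation by parts every term \<open>d k * (w j - w k)\<close> with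
  \<open>j\<close> adjacent to \<open>k\<close> is at most \<open>e\<close>: it is positive only if \<open>0 < d k < e\<close>. What is left are the two boundary terms.
\<close>
lemma smoothed_contraction:
  fixes d :: "nat \<Rightarrow> real" and e theta :: real
  assumes e: "e > 0" and theta: "0 \<le> theta" "theta \<le> 1" and d0: "d 0 = 0" and K: "K \<ge> 1"
  shows "(\<Sum>k=1..K. ramp e (d k) * (theta * (d (k - 1) - d k) - (d k - d (k + 1))))
    \<le> - max (d 1) 0 + 2 * real K * e + max (d (K + 1)) 0"
proof -
  define w where "w k = ramp e (d k)" for k
  have w: "0 \<le> w k" "w k \<le> 1" for k using ramp_bounds[OF e] by (auto simp: w_def)
  have ex: "d k * (w j - w k) \<le> e" for j k
  proof -
    consider "d k \<le> 0" | "d k \<ge> e" | "0 < d k" "d k < e" by linarith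
    then show ?thesis
    proof cases
      case 1
      then have "w k = 0" by (simp add: w_def ramp_bounds[OF e])
      moreover have "d k * w j \<le> 0" using 1 w[of j] by (intro mult_nonpos_nonneg) auto
      ultimately show ?thesis using e by simp
    next
      case 2
      then have "w k = 1" by (simp add: w_def ramp_bounds[OF e])
      moreover have "d k * (w j - 1) \<le> 0" using 2 e w[of j] by (intro mult_nonneg_nonpos) auto
      ultimately show ?thesis using e by simp
    next
      case 3
      have "d k * (w j - w k) \<le> d k * 1" using 3 w[of j] w[of k] by (intro mult_left_mono) auto
      then show ?thesis using 3 by linarith
    qed
  qed
  \<comment> \<open>The boundary term at \<open>K\<close> must be kept exact for the induction to close.\<close>
  have "(\<Sum>k=1..K. w k * (theta * (d (k - 1) - d k) - (d k - d (k + 1))))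
    \<le> - (w 1 * d 1) + 2 * (real K - 1) * e + w K * (d (K + 1) - theta * d K)"
    using K
  proof (induction rule: dec_induct)
    case base
    then show ?case by (simp add: d0 algebra_simps)
  next
    case (step K)
    have 1: "theta * (d K * (w (Suc K) - w K)) \<le> 1 * e"
    proof (cases "d K * (w (Suc K) - w K) \<ge> 0")
      case True
      then show ?thesis using theta ex[of K "Suc K"] by (intro mult_mono) auto
    next
      case False
      then have "theta * (d K * (w (Suc K) - w K)) \<le> 0"
        using theta mult_nonneg_nonpos[of theta "d K * (w (Suc K) - w K)"] by linarith
      then show ?thesis using e by simp
    qed
    have 2: "d (Suc K) * (w K - w (Suc K)) \<le> e" by (rule ex)
    show ?case using step 1 2 by (simp add: algebra_simps)
  qed
  moreover have "w 1 * d 1 \<ge> max (d 1) 0 - e"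
  proof -
    have "d 1 * (1 - w 1) \<le> e" if "d 1 \<ge> 0"
    proof (cases "d 1 \<ge> e")
      case True
      then show ?thesis using e by (simp add: w_def ramp_bounds[OF e])
    next
      case False
      have "d 1 * (1 - w 1) \<le> d 1 * 1" using that w[of 1] by (intro mult_left_mono) auto
      then show ?thesis using False by simp
    qed
    moreover have "w 1 * d 1 = 0" if "d 1 \<le> 0" using that by (simp add: w_def ramp_bounds[OF e])
    ultimately show ?thesis using e by (cases "d 1 \<ge> 0") (auto simp: algebra_simps)
  qed
  moreover have "w K * (d (K + 1) - theta * d K) \<le> max (d (K + 1)) 0"
  proof -
    have "0 \<le> w K * d K" using w[of K] by (cases "d K \<ge> 0") (auto simp: w_def ramp_bounds[OF e])
    then have "0 \<le> theta * (w K * d K)" using theta by simp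
    moreover have "w K * d (K + 1) \<le> 1 * max (d (K + 1)) 0"
      using w[of K] by (intro order.trans[OF mult_left_mono mult_right_mono]) auto
    ultimately show ?thesis by (simp add: algebra_simps)
  qed
  moreover have "2 * (real K - 1) * e = 2 * real K * e - 2 * e" by (simp add: algebra_simps)
  ultimately show ?thesis using e unfolding w_def by linarith
qed

text \<open>
  Inside expectations, the indicator of an empty memory acts like \<open>p (S 1)\<close>. The lower bound holds against
  all nonnegative Lipschitz functions; the upper bound is asked only against those that vanish linearly
  as \<open>S 1\<close> tends to \<open>1\<close>. When no server is idle, tokens are not created however large the message rate
  is, so under the High Message regime an empty memory cannot be excluded there. Monotonicity of \<open>p\<close>
  is what makes the drift cooperative.
\<close>
locale averaged_rcpb_sequence = rcpb_sequence +
  fixes p :: "real \<Rightarrow> real" and M :: real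
  assumes p_mono: "\<lbrakk>0 \<le> y; y \<le> z; z \<le> 1\<rbrakk> \<Longrightarrow> p y \<le> p z"
    and p_lipschitz: "\<lbrakk>0 \<le> y; y \<le> z; z \<le> 1\<rbrakk> \<Longrightarrow> p z - p y \<le> M * (z - y)"
    and p_range: "\<lbrakk>0 \<le> y; y \<le> 1\<rbrakk> \<Longrightarrow> 0 \<le> p y \<and> p y \<le> 1"
    and averaged_lower: "\<lbrakk>bounded_lipschitz g; \<And>s. s \<in> fraction_space \<Longrightarrow> 0 \<le> g s; 0 < e\<rbrakk> \<Longrightarrow>
      \<forall>\<^sub>F n in sequentially. - e < measure_pmf.expectation (\<nu> n)
        (\<lambda>x. g (fractions n x) * (no_token x - p (fractions n x 1)))"
    and averaged_upper: "\<lbrakk>bounded_lipschitz g; \<And>s. s \<in> fraction_space \<Longrightarrow> 0 \<le> g s;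
        \<And>s. s \<in> fraction_space \<Longrightarrow> g s \<le> C * (1 - s 1); 0 < e\<rbrakk> \<Longrightarrow>
      \<forall>\<^sub>F n in sequentially. measure_pmf.expectation (\<nu> n)
        (\<lambda>x. g (fractions n x) * (no_token x - p (fractions n x 1))) < e"
begin

definition q :: real where "q = p lam"

definition s_lim :: "nat \<Rightarrow> real" where
  "s_lim k = (if k = 0 then 1 else lam * (lam * q) ^ (k - 1))"

lemma q_bounds: "0 \<le> q" "q \<le> 1"
  using p_range[of lam] lam by (auto simp: q_def)

lemma s_lim_0: "s_lim 0 = 1" and s_lim_1: "s_lim 1 = lam"
  by (simp_all add: s_lim_def)

lemma s_lim_bounds: "0 \<le> s_lim k" "s_lim k \<le> 1"
proof -
  have "lam * q \<le> 1 * 1" using lam q_bounds by (intro mult_mono) auto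
  then have "(lam * q) ^ (k - 1) \<le> 1" using lam q_bounds by (intro power_le_one) auto
  then have "lam * (lam * q) ^ (k - 1) \<le> 1 * 1" using lam q_bounds by (intro mult_mono) auto
  then show "0 \<le> s_lim k" "s_lim k \<le> 1" using lam q_bounds by (auto simp: s_lim_def)
qed

text \<open>
  The point \<open>s_lim\<close> is the equilibrium of the drift in which the indicator of an empty memory is frozen
  at its limiting mean \<open>q\<close>.
\<close>
lemma s_lim_balance:
  assumes "k \<ge> 1"
  shows "lam * q * (s_lim (k - 1) - s_lim k) + of_bool (k = 1) * lam * (1 - q) = s_lim k - s_lim (k + 1)"
proof (cases "k = 1")
  case True
  then show ?thesis by (simp add: s_lim_def algebra_simps)
next
  case False
  then obtain j where "k = Suc (Suc j)" using assms by (metis One_nat_def Suc_le_D not_less_eq_eq le_antisym not0_implies_Suc)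
  then show ?thesis by (simp add: s_lim_def algebra_simps)
qed

text \<open>
  Relative to \<open>s_lim\<close>, the drift is a linear map of the deviation plus the fluctuation of the indicator
  of an empty memory.
\<close>
lemma net_flow_decomposition:
  assumes n: "n \<ge> N" and k: "k \<ge> 1"
  defines "d \<equiv> \<lambda>j x. fractions n x j - s_lim j"
  shows "net_flow lam n k x = lam * q * (d (k - 1) x - d k x) - (d k x - d (k + 1) x)
     + lam * (no_token x - q) * (fractions n x (k - 1) - fractions n x k - of_bool (k = 1))"
proof -
  have "net_flow lam n k x = lam * no_token x * (fractions n x (k - 1) - fractions n x k)
     + of_bool (k = 1) * lam * (1 - no_token x) - (fractions n x k - fractions n x (k + 1))"
    by (simp add: net_flow_def birth_flow_def)
  then show ?thesis using s_lim_balance[OF k] by (simp add: d_def algebra_simps)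
qed

text \<open>
  Combine \<open>E_ramp_drift\<close> for the first \<open>K\<close> coordinates with the contraction inequality for the linear
  part of the drift. The fluctuation part is \<open>- lam * (G - q) * V\<close>, where \<open>V\<close> is nonnegative above
  \<open>lam + e\<close> and nonpositive below \<open>lam\<close>, as \<open>p (S 1) - q\<close> is because \<open>p\<close> is
  nondecreasing. So replacing \<open>G\<close> by \<open>p (S 1)\<close> gives this part the favourable sign, up to \<open>M * e\<close>.
\<close>
lemma E_S1_excess_le:
  assumes K: "K \<ge> 1" and e: "0 < e" "lam + e < 1"
  shows "\<forall>\<^sub>F n in sequentially. E n (\<lambda>x. max (fractions n x 1 - lam) 0)
    \<le> 2 * real K * e + lam ^ (K + 1) + (M + 3) * e"
proof -
  let ?D = "\<lambda>n x k. (lam * q * ((fractions n x (k - 1) - s_lim (k - 1)) - (fractions n x k - s_lim k))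
      - ((fractions n x k - s_lim k) - (fractions n x (k + 1) - s_lim (k + 1))))"
  let ?U = "\<lambda>n x. max (fractions n x 1 - lam) 0"
  let ?F = "\<lambda>n k x. ramp e (fractions n x k - s_lim k) * net_flow lam n k x"
  let ?W = "\<lambda>s. (\<Sum>k=2..K. ramp e (s k - s_lim k) * (s (k - 1) - s k))"
  define V where "V s = - (\<Sum>k=1..K. ramp e (s k - s_lim k) * (s (k - 1) - s k - of_bool (k = 1)))" for s
  let ?J = "\<lambda>n x. (no_token x - q) * V (fractions n x)"
  have blV: "bounded_lipschitz V"
    unfolding V_def
    by (intro bounded_lipschitz_minus bounded_lipschitz_sum bounded_lipschitz_mult
        bounded_lipschitz_ramp bounded_lipschitz_diff bounded_lipschitz_coordinate bounded_lipschitz_const)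
  have V_eq: "V s = ramp e (s 1 - lam) * s 1 - ?W s"
    and V_sum: "0 \<le> ?W s"
      "?W s \<le> s 1"
    if s: "s \<in> fraction_space" for s
  proof -
    have s0: "s 0 = 1" and mono: "\<And>k. s (Suc k) \<le> s k" and s01: "\<And>k. 0 \<le> s k" "\<And>k. s k \<le> 1"
      using s by (auto simp: fraction_space_def)
    have "V s = - (ramp e (s 1 - s_lim 1) * (s 0 - s 1 - 1)
        + (\<Sum>k=2..K. ramp e (s k - s_lim k) * (s (k - 1) - s k - of_bool (k = 1))))"
      unfolding V_def using K by (simp add: sum.atLeast_Suc_atMost numeral_2_eq_2)
    also have "(\<Sum>k=2..K. ramp e (s k - s_lim k) * (s (k - 1) - s k - of_bool (k = 1)))
        = ?W s"
      by (rule sum.cong) auto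
    finally show "V s = ramp e (s 1 - lam) * s 1 - ?W s"
      by (simp add: s_lim_def s0)
    have mono': "s k \<le> s (k - 1)" if "k \<ge> 2" for k using mono[of "k - 1"] that by simp
    show "0 \<le> ?W s"
      using ramp_bounds(1)[OF e(1)] mono' by (intro sum_nonneg mult_nonneg_nonneg) auto
    have "?W s \<le> (\<Sum>k=2..K. 1 * (s (k - 1) - s k))"
      using ramp_bounds(2)[OF e(1)] mono' by (intro sum_mono mult_right_mono) auto
    also have "\<dots> = s 1 - s K"
      using K by (induction K rule: dec_induct) (auto simp: numeral_2_eq_2)
    also have "\<dots> \<le> s 1" using s01 by simp
    finally show "?W s \<le> s 1" .
  qed
  have V1: "\<bar>V s\<bar> \<le> 1" and Vpos: "lam + e \<le> s 1 \<Longrightarrow> 0 \<le> V s" and Vneg: "s 1 \<le> lam \<Longrightarrow> V s \<le> 0"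
    if s: "s \<in> fraction_space" for s
  proof -
    have s1: "0 \<le> s 1" "s 1 \<le> 1" using s by (auto simp: fraction_space_def)
    have "ramp e (s 1 - lam) * s 1 \<le> 1 * 1" "0 \<le> ramp e (s 1 - lam) * s 1"
      using ramp_bounds(1,2)[OF e(1), of "s 1 - lam"] s1 by (intro mult_mono mult_nonneg_nonneg; simp)+
    then show "\<bar>V s\<bar> \<le> 1" using V_eq[OF s] V_sum[OF s] s1 by linarith
    show "0 \<le> V s" if "lam + e \<le> s 1"
      using V_eq[OF s] V_sum[OF s] ramp_bounds(4)[OF e(1), of "s 1 - lam"] that by simp
    show "V s \<le> 0" if "s 1 \<le> lam"
      using V_eq[OF s] V_sum[OF s] ramp_bounds(3)[OF e(1), of "s 1 - lam"] that by simp
  qed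
  have M0: "M \<ge> 0" using p_lipschitz[of 0 1] p_mono[of 0 1] by simp
  have pV: "- (M * e) \<le> (p (s 1) - q) * V s" if s: "s \<in> fraction_space" for s
  proof -
    have s1: "0 \<le> s 1" "s 1 \<le> 1" using s by (auto simp: fraction_space_def)
    have Me: "0 \<le> M * e" using M0 e by simp
    consider "s 1 \<le> lam" | "lam < s 1" "s 1 < lam + e" | "lam + e \<le> s 1" by linarith
    then show ?thesis
    proof cases
      case 1
      then have "p (s 1) \<le> q" using s1 lam p_mono[of "s 1" lam] by (simp add: q_def)
      then have "0 \<le> (p (s 1) - q) * V s" using Vneg[OF s 1] by (intro mult_nonpos_nonpos) auto
      then show ?thesis using Me by simp
    next
      case 2
      have "0 \<le> p (s 1) - q" "p (s 1) - q \<le> M * (s 1 - lam)"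
        using 2 s1 lam p_mono[of lam "s 1"] p_lipschitz[of lam "s 1"] by (auto simp: q_def)
      moreover have "M * (s 1 - lam) \<le> M * e" using 2 M0 by (intro mult_left_mono) auto
      ultimately have "\<bar>p (s 1) - q\<bar> \<le> M * e" by linarith
      then have "\<bar>p (s 1) - q\<bar> * \<bar>V s\<bar> \<le> M * e * 1" using V1[OF s] Me by (intro mult_mono) auto
      then show ?thesis unfolding abs_mult[symmetric] by linarith
    next
      case 3
      then have "q \<le> p (s 1)" using s1 lam e p_mono[of lam "s 1"] by (simp add: q_def)
      then have "0 \<le> (p (s 1) - q) * V s" using Vpos[OF s 3] by (intro mult_nonneg_nonneg) auto
      then show ?thesis using Me by simp
    qed
  qed
  let ?G = "\<lambda>n x. no_token x - p (fractions n x 1) :: real"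
  let ?B = "\<lambda>n x. max (- V (fractions n x)) 0 * ?G n x"
  let ?A = "\<lambda>n x. max (V (fractions n x)) 0 * ?G n x"
  \<comment> \<open>The positive part of \<open>V\<close> calls for a lower bound on \<open>G\<close>, its negative part for an upper bound.\<close>
  have up: "\<forall>\<^sub>F n in sequentially. - e < E n (\<lambda>x. ?A n x)"
    by (rule averaged_lower) (use blV e in auto)
  \<comment> \<open>The negative part of \<open>V\<close> lives on \<open>S 1 < lam + e < 1\<close>, away from full occupancy.\<close>
  have dn: "\<forall>\<^sub>F n in sequentially. E n (\<lambda>x. ?B n x) < e"
  proof (rule averaged_upper[where C="1 / (1 - lam - e)"])
    show "bounded_lipschitz (\<lambda>s. max (- V s) 0)" using blV by auto
    fix s assume s: "s \<in> fraction_space"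
    then have s1: "0 \<le> s 1" "s 1 \<le> 1" by (auto simp: fraction_space_def)
    show "max (- V s) 0 \<le> 1 / (1 - lam - e) * (1 - s 1)"
    proof (cases "lam + e \<le> s 1")
      case True
      then show ?thesis using Vpos[OF s] s1 e by simp
    next
      case False
      then have "1 \<le> (1 - s 1) / (1 - lam - e)" using e by simp
      then show ?thesis using V1[OF s] by simp
    qed
  qed (use e in auto)
  have lim: "(\<lambda>n. (real K / e) * (1 / real n)) \<longlonglongrightarrow> (real K / e) * 0"
    by (intro tendsto_intros lim_1_over_n)
  then have "\<forall>\<^sub>F n in sequentially. (real K / e) * (1 / real n) < e"
    using e by (intro order_tendstoD(2)[OF lim]) auto
  then show ?thesis
    using up dn eventually_ge_at_top[of N]
  proof eventually_elim
    case (elim n)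
    then have nN: "n \<ge> N" by simp
    note eq = equilibrium[OF nN]
    have p01: "\<bar>?G n x\<bar> \<le> 1" for x :: rcpb_state
      using p_range[of "fractions n x 1"] fractions_bounds(1,2)[OF nN, of x 1] by auto
    have q01: "\<bar>no_token x - q\<bar> \<le> 1" for x :: rcpb_state
      using q_bounds by auto
    have Vb: "\<bar>V (fractions n x)\<bar> \<le> 1" for x by (rule V1[OF fractions_mem[OF nN]])
    have GVb: "\<bar>?J n x\<bar> \<le> 1" for x
      unfolding abs_mult using mult_mono[OF q01 Vb] by simp
    have b1: "\<bar>?A n x\<bar> \<le> 1" "\<bar>?B n x\<bar> \<le> 1" for x
      unfolding abs_mult using Vb[of x] p01 by (intro mult_le_one; simp)+
    have j1: "integrable (\<nu> n) (\<lambda>x. ?A n x)"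
      and j2: "integrable (\<nu> n) (\<lambda>x. ?B n x)"
      by (rule integrable_pmf_bounded, rule b1)+
    have "- 2 * e - M * e \<le> E n (\<lambda>x. ?A n x)
        - E n (\<lambda>x. ?B n x) - E n (\<lambda>x. M * e)"
      using elim(2,3) by simp
    also have "\<dots> = E n (\<lambda>x. ?A n x - ?B n x - M * e)"
      by (subst Bochner_Integration.integral_diff[OF Bochner_Integration.integrable_diff[OF j1 j2]],
          simp, subst Bochner_Integration.integral_diff[OF j1 j2], rule refl)
    also have "\<dots> \<le> E n (\<lambda>x. ?J n x)"
    proof (rule expectation_pmf_mono[where A="2 + M * e" and B=1])
      fix x
      show "\<bar>?A n x - ?B n x - M * e\<bar> \<le> 2 + M * e"
        using b1[of x] mult_nonneg_nonneg[OF M0 order.strict_implies_order[OF e(1)]] by linarith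
      have "?A n x - ?B n x = V (fractions n x) * ?G n x"
        by (cases "V (fractions n x) \<ge> 0") (auto simp: max_def)
      moreover have "?J n x = V (fractions n x) * ?G n x + (p (fractions n x 1) - q) * V (fractions n x)"
        by (simp add: algebra_simps)
      ultimately show "?A n x - ?B n x - M * e
          \<le> ?J n x"
        using pV[OF fractions_mem[OF nN, of x]] by linarith
    qed (rule GVb)
    finally have GV: "- (2 + M) * e \<le> E n (\<lambda>x. ?J n x)"
      by (simp add: algebra_simps)
    have w2: "\<bar>?F n k x\<bar> \<le> 1 * 2" if "k \<ge> 1" for k x
      unfolding abs_mult using ramp_bounds[OF e(1)] rcpb_equilibrium.drift_abs[OF eq that] by (intro mult_mono) auto
    have "- (real K / e) * (1 / real n) = (\<Sum>k=1..K. - 1 / (real n * e))" by simp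
    also have "\<dots> \<le> (\<Sum>k=1..K. E n (\<lambda>x. ?F n k x))"
      by (intro sum_mono rcpb_equilibrium.E_ramp_drift[OF eq] e) auto
    also have "\<dots> = E n (\<lambda>x. \<Sum>k=1..K. ?F n k x)"
      using w2 by (intro Bochner_Integration.integral_sum[symmetric] integrable_pmf_bounded) auto
    also have "\<dots> \<le> E n (\<lambda>x. - ?U n x + 2 * real K * e + fractions n x (K + 1)
        - lam * (?J n x))"
    proof (rule expectation_pmf_mono[where A="real K * 2" and B="3 + 2 * real K * e"])
      fix x
      have "\<bar>\<Sum>k=1..K. ?F n k x\<bar> \<le> (\<Sum>k=1..K. 1 * 2)"
        using w2 by (intro order.trans[OF sum_abs] sum_mono) auto
      then show "\<bar>\<Sum>k=1..K. ?F n k x\<bar> \<le> real K * 2" by simp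
      have "\<bar>lam * (?J n x)\<bar> \<le> 1 * 1"
        unfolding abs_mult[of lam] using GVb[of x] lam by (intro mult_mono) auto
      then show "\<bar>- ?U n x + 2 * real K * e + fractions n x (K + 1)
        - lam * (?J n x)\<bar> \<le> 3 + 2 * real K * e"
        using fractions_bounds(1,2)[OF nN, of x 1] fractions_bounds(1,2)[OF nN, of x "K + 1"] lam e
          mult_nonneg_nonneg[of "real K" e]
        by linarith
      have "(\<Sum>k=1..K. ?F n k x)
        = (\<Sum>k=1..K. ramp e (fractions n x k - s_lim k) *
            ?D n x k)
          - lam * (?J n x)"
        unfolding V_def mult_minus_right diff_minus_eq_add sum_distrib_left sum.distrib[symmetric]
        by (intro sum.cong refl, subst net_flow_decomposition[OF nN]) (auto simp: algebra_simps)
      moreover have "(\<Sum>k=1..K. ramp e (fractions n x k - s_lim k) *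
            ?D n x k)
         \<le> - max (fractions n x 1 - s_lim 1) 0 + 2 * real K * e + max (fractions n x (K + 1) - s_lim (K + 1)) 0"
        using lam q_bounds fractions_bounds(4)[OF nN, of x]
        by (intro smoothed_contraction e K) (auto simp: s_lim_0 mult_le_one)
      moreover have "max (fractions n x (K + 1) - s_lim (K + 1)) 0 \<le> fractions n x (K + 1)"
        using s_lim_bounds(1)[of "K + 1"] fractions_bounds(1)[OF nN, of x "K + 1"] by simp
      ultimately show "(\<Sum>k=1..K. ?F n k x)
        \<le> - ?U n x + 2 * real K * e + fractions n x (K + 1)
          - lam * (?J n x)"
        unfolding s_lim_1 by linarith
    qed
    also have "\<dots> = - E n (\<lambda>x. ?U n x) + 2 * real K * e + E n (\<lambda>x. fractions n x (K + 1))
        - lam * E n (\<lambda>x. ?J n x)"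
    proof -
      have i1: "integrable (\<nu> n) (\<lambda>x. ?U n x)"
      proof (rule integrable_pmf_bounded[where B=1])
        fix x show "\<bar>?U n x\<bar> \<le> 1"
          using fractions_bounds(1,2)[OF nN, of x 1] lam by linarith
      qed
      have i2: "integrable (\<nu> n) (\<lambda>x. fractions n x (K + 1))"
        using fractions_bounds(1,2)[OF nN] by (intro integrable_pmf_bounded[where B=1]) auto
      have i3: "integrable (\<nu> n) (\<lambda>x. ?J n x)"
        by (rule integrable_pmf_bounded[OF GVb])
      have "E n (\<lambda>x. - A x + a + B x - b * D x) = - E n A + a + E n B - b * E n D"
        if "integrable (\<nu> n) A" "integrable (\<nu> n) B" "integrable (\<nu> n) D"
        for A B D :: "rcpb_state \<Rightarrow> real" and a b :: real
        using that by simp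
      from this[OF i1 i2 i3] show ?thesis .
    qed
    finally have "E n (\<lambda>x. ?U n x)
       \<le> (real K / e) * (1 / real n) + 2 * real K * e + E n (\<lambda>x. fractions n x (K + 1))
        + lam * - E n (\<lambda>x. ?J n x)" by simp
    also have "\<dots> \<le> e + 2 * real K * e + lam ^ (K + 1) + 1 * ((2 + M) * e)"
    proof -
      have "lam * - E n (\<lambda>x. ?J n x) \<le> lam * ((2 + M) * e)"
        using GV lam by (intro mult_left_mono) (auto simp: algebra_simps)
      also have "\<dots> \<le> 1 * ((2 + M) * e)" using lam M0 e by (intro mult_right_mono) auto
      finally show ?thesis using elim(1) rcpb_equilibrium.E_S_le[OF eq, of "K + 1"] by simp
    qed
    finally show ?case by (simp add: algebra_simps)
  qed
qed

text \<open>
  The mean of \<open>S 1\<close> is exactly \<open>lam\<close>, so the absolute deviation has twice the mean of its positive part.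
\<close>
lemma vanishing_S1: "vanishing (\<lambda>n x. \<bar>fractions n x 1 - s_lim 1\<bar>)"
proof (rule vanishingI[where B=1])
  let ?U = "\<lambda>n x. max (fractions n x 1 - lam) 0"
  show "\<bar>\<bar>fractions n x 1 - s_lim 1\<bar>\<bar> \<le> 1" if "n \<ge> N" for n x
    using fractions_bounds(1,2)[OF that, of x 1] s_lim_bounds[of 1] by linarith
  have M0: "M \<ge> 0" using p_lipschitz[of 0 1] p_mono[of 0 1] by simp
  have pos: "0 \<le> E n (\<lambda>x. ?U n x)" for n by (intro Bochner_Integration.integral_nonneg) auto
  have "(\<lambda>n. E n (\<lambda>x. ?U n x)) \<longlonglongrightarrow> 0"
  proof (rule tendstoI)
    fix r :: real assume r: "r > 0"
    have "(\<lambda>K. lam ^ K) \<longlonglongrightarrow> 0" using lam by (intro LIMSEQ_power_zero) auto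
    then have "\<forall>\<^sub>F K in sequentially. lam ^ K < r / 2"
      using r by (intro order_tendstoD(2)) auto
    then obtain K0 where K0: "\<And>K. K \<ge> K0 \<Longrightarrow> lam ^ K < r / 2" by (auto simp: eventually_sequentially)
    \<comment> \<open>\<open>K\<close> is fixed first, to make \<open>lam ^ (K + 1)\<close> small; then \<open>e\<close>, depending on \<open>K\<close>; \<open>n\<close> tends to infinity last.\<close>
    define K where "K = max K0 1"
    have K: "K \<ge> 1" "lam ^ (K + 1) < r / 2" using K0[of "K + 1"] by (auto simp: K_def)
    define A where "A = 2 * real K + (M + 3)"
    have A: "A > 0" using M0 by (simp add: A_def add_nonneg_pos)
    define e where "e = min ((1 - lam) / 2) (r / (4 * A))"
    have e: "0 < e" "lam + e < 1" using lam r A by (auto simp: e_def min_def field_simps)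
    have "A * e \<le> A * (r / (4 * A))" using A by (intro mult_left_mono) (auto simp: e_def)
    then have Ae: "A * e \<le> r / 4" using A by simp
    show "\<forall>\<^sub>F n in sequentially. dist (E n (\<lambda>x. ?U n x)) 0 < r"
      using E_S1_excess_le[OF K(1) e]
    proof eventually_elim
      case (elim n)
      have "2 * real K * e + lam ^ (K + 1) + (M + 3) * e = A * e + lam ^ (K + 1)"
        by (simp add: A_def algebra_simps)
      then show ?case using elim pos[of n] Ae K(2) r by (simp add: dist_real_def)
    qed
  qed
  then have "(\<lambda>n. 2 * E n (\<lambda>x. ?U n x)) \<longlonglongrightarrow> 2 * 0"
    by (intro tendsto_intros)
  then have l: "(\<lambda>n. 2 * E n (\<lambda>x. ?U n x)) \<longlonglongrightarrow> 0" by simp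
  show "(\<lambda>n. E n (\<lambda>x. \<bar>fractions n x 1 - s_lim 1\<bar>)) \<longlonglongrightarrow> 0"
  proof (rule Lim_transform_eventually[OF l])
    show "\<forall>\<^sub>F n in sequentially. 2 * E n (\<lambda>x. ?U n x)
        = E n (\<lambda>x. \<bar>fractions n x 1 - s_lim 1\<bar>)"
      using eventually_ge_at_top[of N]
    proof eventually_elim
      case (elim n)
      have b: "\<bar>?U n x\<bar> \<le> 1" "\<bar>fractions n x 1\<bar> \<le> 1" for x
        using fractions_bounds(1,2)[OF elim, of x 1] lam by linarith+
      have i1: "integrable (\<nu> n) (\<lambda>x. ?U n x)"
        and i2: "integrable (\<nu> n) (\<lambda>x. fractions n x 1)"
        by (rule integrable_pmf_bounded, rule b)+
      have "E n (\<lambda>x. \<bar>fractions n x 1 - s_lim 1\<bar>)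
          = E n (\<lambda>x. 2 * ?U n x - (fractions n x 1 - lam))"
        unfolding s_lim_1 by (rule expectation_pmf_cong) (simp add: max_def abs_if)
      also have "\<dots> = 2 * E n (\<lambda>x. ?U n x) - (E n (\<lambda>x. fractions n x 1) - lam)"
        using i1 i2 by simp
      also have "E n (\<lambda>x. fractions n x 1) = lam"
        using rcpb_equilibrium.E_S1[OF equilibrium[OF elim]] .
      finally show ?case by simp
    qed
  qed
qed

text \<open>
  Since \<open>S 1\<close> is now close to \<open>lam\<close>, where \<open>1 - S 1\<close> is bounded away from zero, the restriction on test
  functions in the upper averaging bound is removed: the factor \<open>1 - S 1\<close> is inserted and
  replaced by the constant \<open>1 - lam\<close>. Functions of either sign are shifted by a constant.
\<close>
lemma vanishing_token_average:
  assumes g: "bounded_lipschitz g"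
  shows "vanishing (\<lambda>n x. g (fractions n x) * (no_token x - q))"
proof -
  have M0: "M \<ge> 0" using p_lipschitz[of 0 1] p_mono[of 0 1] by simp
  have nonneg: "vanishing (\<lambda>n x. g (fractions n x) * (no_token x - q))"
    if g: "bounded_lipschitz g" and pos: "\<And>s. s \<in> fraction_space \<Longrightarrow> 0 \<le> g s" for g
  proof -
    obtain L where L: "sup_lipschitz L g" using g by (auto simp: bounded_lipschitz_def)
    define h where "h s = g s * (1 - s 1)" for s
    let ?J = "\<lambda>n x. g (fractions n x) * (1 - lam) * (no_token x - q)"
    let ?H = "\<lambda>n x. h (fractions n x) * (no_token x - p (fractions n x 1))"
    have h: "bounded_lipschitz h" unfolding h_def using g by (intro bounded_lipschitz_mult) auto
    have s1: "0 \<le> s 1 \<and> s 1 \<le> 1" if "s \<in> fraction_space" for s :: "nat \<Rightarrow> real"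
      using that by (auto simp: fraction_space_def)
    have h0: "0 \<le> h s" and hL: "h s \<le> L * (1 - s 1)" if "s \<in> fraction_space" for s
      using pos[OF that] s1[OF that] sup_lipschitzD(1)[OF L that] by (auto simp: h_def intro!: mult_right_mono)
    have p01: "\<bar>no_token x - p (fractions n x 1)\<bar> \<le> 1" if "n \<ge> N" for n and x :: rcpb_state
      using p_range[of "fractions n x 1"] fractions_bounds(1,2)[OF that, of x 1] by auto
    have gb: "\<bar>g (fractions n x)\<bar> \<le> L" if "n \<ge> N" for n x
      by (rule sup_lipschitzD(1)[OF L fractions_mem[OF that]])
    have 1: "vanishing (\<lambda>n x. ?H n x)"
    proof (rule vanishingI[where B="L * 1 * 1"])
      show "\<bar>?H n x\<bar> \<le> L * 1 * 1" if "n \<ge> N" for n x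
        unfolding h_def abs_mult using gb[OF that] p01[OF that] s1[OF fractions_mem[OF that, of x]] sup_lipschitz_nonneg[OF L]
        by (intro mult_mono) auto
      show "(\<lambda>n. E n (\<lambda>x. ?H n x)) \<longlonglongrightarrow> 0"
      proof (rule tendstoI)
        fix e :: real assume e: "e > 0"
        have lo: "\<forall>\<^sub>F n in sequentially. - e < E n (\<lambda>x. ?H n x)"
          by (rule averaged_lower[OF h _ e]) (rule h0)
        have "\<forall>\<^sub>F n in sequentially. E n (\<lambda>x. ?H n x) < e"
          by (rule averaged_upper[OF h _ _ e]) (rule h0, assumption, rule hL)
        with lo show "\<forall>\<^sub>F n in sequentially. dist (E n (\<lambda>x. ?H n x)) 0 < e"
          by eventually_elim (simp add: dist_real_def)
      qed
    qed
    have 2: "vanishing (\<lambda>n x. ?H n x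
        - ?J n x)"
    proof (rule vanishing_dominated[OF vanishing_cmult[OF vanishing_S1]])
      fix n and x :: rcpb_state assume n: "n \<ge> N"
      define G where "G = (no_token x :: real)"
      define y where "y = fractions n x 1"
      have y: "0 \<le> y" "y \<le> 1" using fractions_bounds(1,2)[OF n] by (auto simp: y_def)
      have py: "\<bar>p y - q\<bar> \<le> M * \<bar>y - lam\<bar>"
        using p_mono[of y lam] p_mono[of lam y] p_lipschitz[of y lam] p_lipschitz[of lam y] y lam
        by (cases "y \<le> lam") (auto simp: q_def)
      have "h (fractions n x) * (G - p y) - g (fractions n x) * (1 - lam) * (G - q)
          = g (fractions n x) * ((lam - y) * (G - p y) + (1 - lam) * (q - p y))"
        by (simp add: h_def y_def algebra_simps)
      also have "\<bar>\<dots>\<bar> \<le> L * (\<bar>y - lam\<bar> * 1 + 1 * (M * \<bar>y - lam\<bar>))"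
      proof -
        have "\<bar>(lam - y) * (G - p y)\<bar> \<le> \<bar>y - lam\<bar> * 1" "\<bar>(1 - lam) * (q - p y)\<bar> \<le> 1 * (M * \<bar>y - lam\<bar>)"
          unfolding abs_mult using p01[OF n, of x] py lam by (intro mult_mono; simp add: G_def y_def)+
        then have "\<bar>(lam - y) * (G - p y) + (1 - lam) * (q - p y)\<bar> \<le> \<bar>y - lam\<bar> * 1 + 1 * (M * \<bar>y - lam\<bar>)"
          by linarith
        then show ?thesis unfolding abs_mult[of "g _"]
          using gb[OF n, of x] sup_lipschitz_nonneg[OF L] by (intro mult_mono) auto
      qed
      also have "\<dots> = L * (1 + M) * \<bar>fractions n x 1 - s_lim 1\<bar>"
        unfolding s_lim_1 by (simp add: y_def algebra_simps)
      finally show "\<bar>?H n x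
        - ?J n x\<bar> \<le> L * (1 + M) * \<bar>fractions n x 1 - s_lim 1\<bar>"
        by (simp add: G_def y_def)
    qed
    show ?thesis
    proof (rule vanishing_cong[OF vanishing_cmult[OF vanishing_diff[OF 1 2], of "1 / (1 - lam)"]])
      fix n x
      have "1 - lam \<noteq> 0" using lam by simp
      then show "1 / (1 - lam) * (?H n x
         - (?H n x
           - ?J n x))
        = g (fractions n x) * (no_token x - q)" by simp
    qed
  qed
  obtain L where L: "sup_lipschitz L g" using g by (auto simp: bounded_lipschitz_def)
  have "vanishing (\<lambda>n x. (g (fractions n x) + L) * (no_token x - q) - L * (no_token x - q))"
  proof (rule vanishing_diff)
    show "vanishing (\<lambda>n x. (g (fractions n x) + L) * (no_token x - q))"
    proof (rule nonneg)
      show "bounded_lipschitz (\<lambda>s. g s + L)" using g by auto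
      show "0 \<le> g s + L" if "s \<in> fraction_space" for s using sup_lipschitzD(1)[OF L that] by linarith
    qed
    show "vanishing (\<lambda>n x. L * (no_token x - q))"
      by (rule nonneg) (use sup_lipschitz_nonneg[OF L] in auto)
  qed
  then show ?thesis by (rule vanishing_cong) (simp add: algebra_simps)
qed

text \<open>
  Near orthogonality of \<open>g S\<close> to the drift of \<open>S k\<close>, for the choice \<open>g S = S (k + 1) - s_lim (k + 1)\<close>: by
  \<open>net_flow_decomposition\<close> the drift is \<open>g S\<close> itself plus deviations of \<open>S (k - 1)\<close> and \<open>S k\<close> and the averaged
  fluctuation of the empty memory.
\<close>
lemma vanishing_fraction_step:
  assumes k: "k \<ge> 1"
    and v: "vanishing (\<lambda>n x. \<bar>fractions n x (k - 1) - s_lim (k - 1)\<bar>)"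
      "vanishing (\<lambda>n x. \<bar>fractions n x k - s_lim k\<bar>)"
  shows "vanishing (\<lambda>n x. \<bar>fractions n x (k + 1) - s_lim (k + 1)\<bar>)"
proof -
  let ?Z = "\<lambda>n x. fractions n x (k + 1) - s_lim (k + 1)"
  let ?D = "\<lambda>n x. ((fractions n x k - s_lim k)
      - lam * no_token x * ((fractions n x (k - 1) - s_lim (k - 1)) - (fractions n x k - s_lim k)))"
  define g where "g s = s (k + 1) - s_lim (k + 1)" for s :: "nat \<Rightarrow> real"
  have g: "bounded_lipschitz g" unfolding g_def by (intro bounded_lipschitz_diff) auto
  then obtain L where L: "sup_lipschitz L g" by (auto simp: bounded_lipschitz_def)
  have gb: "\<bar>g (fractions n x)\<bar> \<le> L" if "n \<ge> N" for n x
    by (rule sup_lipschitzD(1)[OF L fractions_mem[OF that]])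
  have L0: "0 \<le> L" using sup_lipschitz_nonneg[OF L] .
  have flow: "vanishing (\<lambda>n x. g (fractions n x) * net_flow lam n k x)"
  proof (rule vanishingI[where B="L * 2"])
    show "\<bar>g (fractions n x) * net_flow lam n k x\<bar> \<le> L * 2" if "n \<ge> N" for n x
      unfolding abs_mult using gb[OF that] rcpb_equilibrium.drift_abs[OF equilibrium[OF that] k] L0
      by (intro mult_mono) auto
    have "(\<lambda>n. 2 * L * E n (\<lambda>x. \<bar>fractions n x k - s_lim k\<bar>) + 2 * L * (1 / real n)) \<longlonglongrightarrow> 2 * L * 0 + 2 * L * 0"
      by (intro tendsto_intros vanishing_tendsto[OF v(2)] lim_1_over_n)
    then have "(\<lambda>n. 2 * L * E n (\<lambda>x. \<bar>fractions n x k - s_lim k\<bar>) + 2 * L / real n) \<longlonglongrightarrow> 0" by simp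
    then show "(\<lambda>n. E n (\<lambda>x. g (fractions n x) * net_flow lam n k x)) \<longlonglongrightarrow> 0"
    proof (rule Lim_null_comparison[rotated])
      show "\<forall>\<^sub>F n in sequentially. norm (E n (\<lambda>x. g (fractions n x) * net_flow lam n k x))
          \<le> 2 * L * E n (\<lambda>x. \<bar>fractions n x k - s_lim k\<bar>) + 2 * L / real n"
        using eventually_ge_at_top[of N]
        by eventually_elim (use rcpb_equilibrium.E_lipschitz_drift[OF equilibrium L k] in simp)
    qed
  qed
  define kap where "kap = lam * (s_lim (k - 1) - s_lim k - of_bool (k = 1))"
  have tok: "vanishing (\<lambda>n x. kap * (g (fractions n x) * (no_token x - q)))"
    by (rule vanishing_cmult[OF vanishing_token_average[OF g]])
  have rest: "vanishing (\<lambda>n x. g (fractions n x) * ?D n x)"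
  proof (rule vanishing_dominated[OF vanishing_add[OF vanishing_cmult[OF v(1), of L] vanishing_cmult[OF v(2), of "2 * L"]]])
    fix n and x :: rcpb_state assume n: "n \<ge> N"
    define a b where "a = fractions n x (k - 1) - s_lim (k - 1)" and "b = fractions n x k - s_lim k"
    have "\<bar>lam * no_token x * (a - b)\<bar> \<le> 1 * \<bar>a - b\<bar>"
      unfolding abs_mult using lam by (intro mult_right_mono) auto
    moreover have "\<bar>b - t\<bar> \<le> \<bar>a\<bar> + 2 * \<bar>b\<bar>" if "\<bar>t\<bar> \<le> 1 * \<bar>a - b\<bar>" for t
      using that abs_triangle_ineq4[of b t] abs_triangle_ineq4[of a b] by linarith
    ultimately have "\<bar>b - lam * no_token x * (a - b)\<bar> \<le> \<bar>a\<bar> + 2 * \<bar>b\<bar>" by blast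
    then have "\<bar>g (fractions n x) * (b - lam * no_token x * (a - b))\<bar> \<le> L * (\<bar>a\<bar> + 2 * \<bar>b\<bar>)"
      unfolding abs_mult[of "g _"] using gb[OF n] L0 by (intro mult_mono) auto
    then show "\<bar>g (fractions n x) * ?D n x\<bar>
      \<le> L * \<bar>fractions n x (k - 1) - s_lim (k - 1)\<bar> + 2 * L * \<bar>fractions n x k - s_lim k\<bar>"
      by (simp add: a_def b_def algebra_simps)
  qed
  have sq: "vanishing (\<lambda>n x. (?Z n x)\<^sup>2)"
  proof (rule vanishing_cong[OF vanishing_diff[OF vanishing_add[OF flow rest] tok]])
    fix n and x :: rcpb_state assume n: "n \<ge> N"
    have "?Z n x = net_flow lam n k x
       + ?D n x
       - kap * (no_token x - q)"
      unfolding net_flow_decomposition[OF n k] kap_def by (simp add: algebra_simps)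
    then have "(?Z n x)\<^sup>2 = g (fractions n x) * (net_flow lam n k x
       + ?D n x
       - kap * (no_token x - q))"
      unfolding power2_eq_square g_def by simp
    then show "g (fractions n x) * net_flow lam n k x + g (fractions n x) * ?D n x
      - kap * (g (fractions n x) * (no_token x - q)) = (?Z n x)\<^sup>2"
      by (simp only: ring_distribs mult.left_commute)
  qed
  show ?thesis
  proof (rule vanishingI[where B=1])
    show b: "\<bar>\<bar>?Z n x\<bar>\<bar> \<le> 1" if "n \<ge> N" for n x
      using fractions_bounds(1,2)[OF that, of x "k + 1"] s_lim_bounds[of "k + 1"] by linarith
    have "(\<lambda>n. sqrt (E n (\<lambda>x. (?Z n x)\<^sup>2))) \<longlonglongrightarrow> sqrt 0"
      by (intro tendsto_intros vanishing_tendsto[OF sq])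
    then have "(\<lambda>n. sqrt (E n (\<lambda>x. (?Z n x)\<^sup>2))) \<longlonglongrightarrow> 0" by simp
    then show "(\<lambda>n. E n (\<lambda>x. \<bar>?Z n x\<bar>)) \<longlonglongrightarrow> 0"
    proof (rule Lim_null_comparison[rotated])
      show "\<forall>\<^sub>F n in sequentially. norm (E n (\<lambda>x. \<bar>?Z n x\<bar>))
          \<le> sqrt (E n (\<lambda>x. (?Z n x)\<^sup>2))"
        using eventually_ge_at_top[of N]
      proof eventually_elim
        case (elim n)
        let ?Y = "\<lambda>x. \<bar>?Z n x\<bar>"
        have i: "integrable (\<nu> n) ?Y" by (rule integrable_pmf_bounded[OF b[OF elim]])
        have i2: "integrable (\<nu> n) (\<lambda>x. (?Y x)\<^sup>2)"
          by (rule integrable_pmf_bounded[where B=1]) (use b[OF elim] in \<open>auto simp: abs_square_le_1\<close>)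
        have "measure_pmf.variance (\<nu> n) ?Y = E n (\<lambda>x. (?Y x)\<^sup>2) - (E n ?Y)\<^sup>2"
          by (rule measure_pmf.variance_eq[OF i i2])
        then have "(E n ?Y)\<^sup>2 \<le> E n (\<lambda>x. (?Y x)\<^sup>2)"
          using measure_pmf.variance_positive[of "\<nu> n" ?Y] by simp
        then have "\<bar>E n ?Y\<bar> \<le> sqrt (E n (\<lambda>x. (?Y x)\<^sup>2))" by (simp add: real_le_rsqrt)
        then show ?case by simp
      qed
    qed
  qed
qed

lemma vanishing_fractions: "vanishing (\<lambda>n x. \<bar>fractions n x k - s_lim k\<bar>)"
proof (induction k rule: less_induct)
  case (less k)
  consider "k = 0" | "k = 1" | j where "k = j + 1" "j \<ge> 1"
    by (metis One_nat_def Suc_eq_plus1 Suc_leI not0_implies_Suc neq0_conv)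
  then show ?case
  proof cases
    case 1
    show ?thesis
    proof (rule vanishing_dominated[OF vanishing_cmult[OF vanishing_S1, of 0]])
      show "\<bar>\<bar>fractions n x k - s_lim k\<bar>\<bar> \<le> 0 * \<bar>fractions n x 1 - s_lim 1\<bar>" if "n \<ge> N" for n x
        using fractions_bounds(4)[OF that] by (simp add: 1 s_lim_0)
    qed
  next
    case 2
    then show ?thesis using vanishing_S1 by simp
  next
    case 3
    then show ?thesis using vanishing_fraction_step[of j] less by simp
  qed
qed

lemma s_lim_fraction_space: "s_lim \<in> fraction_space"
proof -
  have "s_lim (Suc k) \<le> s_lim k" for k
  proof (cases k)
    case 0
    then show ?thesis using s_lim_bounds(2)[of 1] by (simp add: s_lim_0)
  next
    case (Suc j)
    have "lam * q \<le> 1 * 1" using lam q_bounds by (intro mult_mono) auto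
    then have "lam * (lam * q) ^ j * (lam * q) \<le> lam * (lam * q) ^ j * 1"
      using lam q_bounds by (intro mult_left_mono) auto
    then show ?thesis by (simp add: Suc s_lim_def mult_ac)
  qed
  then show ?thesis using s_lim_bounds by (simp add: fraction_space_def s_lim_0)
qed

end

section \<open>From coordinates to weak convergence\<close>

lemma dist_w_square_le:
  assumes s: "s \<in> fraction_space" and t: "t \<in> fraction_space"
  shows "(dist_w s t)\<^sup>2 \<le> (\<Sum>i<K. \<bar>s i - t i\<bar>) + 2 / 2 ^ K"
proof -
  let ?f = "\<lambda>i. \<bar>s i - t i\<bar>\<^sup>2 / 2 ^ i"
  have b: "\<bar>s i - t i\<bar> \<le> 1" for i
  proof -
    have "0 \<le> s i" "s i \<le> 1" "0 \<le> t i" "t i \<le> 1" using s t by (auto simp: fraction_space_def)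
    then show ?thesis by linarith
  qed
  have sq: "\<bar>s i - t i\<bar>\<^sup>2 \<le> \<bar>s i - t i\<bar>" for i
    using mult_left_mono[OF b[of i], of "\<bar>s i - t i\<bar>"] by (simp add: power2_eq_square)
  have sm: "summable ?f" by (rule summable_dist_w[OF s t])
  have nn: "0 \<le> suminf ?f" by (rule suminf_nonneg[OF sm]) simp
  have "(dist_w s t)\<^sup>2 = suminf ?f" using nn by (simp add: dist_w_eq_suminf[OF s t])
  also have "\<dots> = (\<Sum>i. ?f (i + K)) + (\<Sum>i<K. ?f i)" by (rule suminf_split_initial_segment[OF sm])
  also have "\<dots> \<le> (\<Sum>i. (1 / 2) ^ i * (1 / 2 ^ K)) + (\<Sum>i<K. \<bar>s i - t i\<bar>)"
  proof (intro add_mono suminf_le sum_mono)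
    show "?f (i + K) \<le> (1 / 2) ^ i * (1 / 2 ^ K)" for i
    proof -
      have "\<bar>s (i + K) - t (i + K)\<bar>\<^sup>2 \<le> 1" using sq[of "i + K"] b[of "i + K"] by linarith
      then have "?f (i + K) \<le> 1 / 2 ^ (i + K)" by (intro divide_right_mono) auto
      also have "\<dots> = (1 / 2) ^ i * (1 / 2 ^ K)" by (simp add: power_add power_one_over)
      finally show ?thesis .
    qed
    show "summable (\<lambda>i. ?f (i + K))" by (rule summable_ignore_initial_segment[OF sm])
    show "summable (\<lambda>i. (1 / 2) ^ i * (1 / 2 ^ K) :: real)"
      by (intro summable_mult2 summable_geometric) simp
    show "?f i \<le> \<bar>s i - t i\<bar>" for i
    proof -
      have "?f i \<le> \<bar>s i - t i\<bar>\<^sup>2 / 1" by (intro divide_left_mono) auto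
      then show ?thesis using sq[of i] by simp
    qed
  qed
  also have "(\<Sum>i. (1 / 2) ^ i * (1 / 2 ^ K) :: real) = 2 / 2 ^ K"
    by (subst suminf_mult2[symmetric]) (simp_all add: suminf_geometric summable_geometric)
  finally show ?thesis by simp
qed

lemma continuous_at_dist_w:
  assumes f: "continuous_map fraction_topology euclideanreal f" and s: "s \<in> fraction_space" and e: "e > 0"
  shows "\<exists>d>0. \<forall>t\<in>fraction_space. dist_w s t < d \<longrightarrow> \<bar>f t - f s\<bar> < e"
proof -
  interpret Metric_space fraction_space dist_w by (rule Metric_space_fraction_space)
  have "openin fraction_topology {t \<in> topspace fraction_topology. f t \<in> ball (f s) e}"
    by (rule openin_continuous_map_preimage[OF f]) simp
  then have "openin fraction_topology {t \<in> fraction_space. f t \<in> ball (f s) e}" by simp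
  moreover have "s \<in> {t \<in> fraction_space. f t \<in> ball (f s) e}" using s e by simp
  ultimately obtain d where d: "d > 0" "mball s d \<subseteq> {t \<in> fraction_space. f t \<in> ball (f s) e}"
    unfolding openin_mtopology by blast
  have "\<bar>f t - f s\<bar> < e" if "t \<in> fraction_space" "dist_w s t < d" for t
  proof -
    have "t \<in> mball s d" using that s by (simp add: in_mball)
    then have "f t \<in> ball (f s) e" using d(2) by blast
    then show ?thesis by (simp add: dist_real_def abs_minus_commute)
  qed
  then show ?thesis using d(1) by blast
qed

context averaged_rcpb_sequence
begin

text \<open>
  Near \<open>s_lim\<close> the function is close to its limit value by continuity; at distance at least \<open>d\<close> its bounded
  deviation is charged to the squared distance divided by \<open>d\<^sup>2\<close>, whose mean is controlled by finitely many
  coordinates and a tail.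
\<close>
lemma expectation_tendsto:
  assumes f: "continuous_map fraction_topology euclideanreal f" and b: "bounded (f ` fraction_space)"
  shows "(\<lambda>n. E n (\<lambda>x. f (fractions n x))) \<longlonglongrightarrow> f s_lim"
proof -
  let ?F = "\<lambda>n x. f (fractions n x) - f s_lim"
  obtain B where B: "\<And>s. s \<in> fraction_space \<Longrightarrow> \<bar>f s\<bar> \<le> B" using b by (auto simp: bounded_iff)
  have B0: "B \<ge> 0" using B[OF s_lim_fraction_space] by linarith
  have lim: "(\<lambda>n. E n (\<lambda>x. ?F n x)) \<longlonglongrightarrow> 0"
  proof (rule tendstoI)
    fix e :: real assume e: "e > 0"
    obtain d where d: "d > 0" and fd: "\<And>t. t \<in> fraction_space \<Longrightarrow> dist_w s_lim t < d \<Longrightarrow> \<bar>f t - f s_lim\<bar> < e / 3"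
      using continuous_at_dist_w[OF f s_lim_fraction_space, of "e / 3"] e by auto
    define C where "C = 2 * B / d\<^sup>2"
    have C: "C \<ge> 0" using B0 by (simp add: C_def)
    have "(\<lambda>K. C * 2 * (1 / 2) ^ K) \<longlonglongrightarrow> C * 2 * 0" by (intro tendsto_intros LIMSEQ_power_zero) simp
    then have "\<forall>\<^sub>F K in sequentially. C * 2 * (1 / 2) ^ K < e / 3" using e by (intro order_tendstoD(2)) auto
    then obtain K where "C * 2 * (1 / 2) ^ K < e / 3" by (auto simp: eventually_sequentially)
    then have K: "C * (2 / 2 ^ K) < e / 3" by (simp add: power_one_over)
    let ?D = "\<lambda>n x. (\<Sum>i<K. \<bar>fractions n x i - s_lim i\<bar>)"
    have "vanishing (\<lambda>n x. C * ?D n x)"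
      by (intro vanishing_cmult vanishing_sum vanishing_fractions)
    from order_tendstoD(2)[OF vanishing_tendsto[OF this], of "e / 3"]
    have "\<forall>\<^sub>F n in sequentially. E n (\<lambda>x. C * ?D n x) < e / 3" using e by simp
    then show "\<forall>\<^sub>F n in sequentially. dist (E n (\<lambda>x. ?F n x)) 0 < e"
      using eventually_ge_at_top[of N]
    proof eventually_elim
      case (elim n)
      have fb: "\<bar>?F n x\<bar> \<le> 2 * B" for x
        using B[OF fractions_mem[OF elim(2), of x]] B[OF s_lim_fraction_space] by linarith
      have sb: "\<bar>C * ?D n x\<bar> \<le> C * real K" for x
      proof -
        have "?D n x \<le> (\<Sum>i<K. 1)"
        proof (rule sum_mono)
          fix i show "\<bar>fractions n x i - s_lim i\<bar> \<le> 1"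
            using fractions_bounds(1,2)[OF elim(2), of x i] s_lim_bounds[of i] by linarith
        qed
        then show ?thesis using C by (simp add: abs_mult mult_left_mono sum_nonneg)
      qed
      have "\<bar>E n (\<lambda>x. ?F n x)\<bar> \<le> E n (\<lambda>x. \<bar>?F n x\<bar>)"
        by (rule integral_abs_bound)
      also have "\<dots> \<le> E n (\<lambda>x. 2 * e / 3 + C * ?D n x)"
      proof (rule expectation_pmf_mono[where A="2 * B" and B="2 * e / 3 + C * real K"])
        fix x
        show "\<bar>\<bar>?F n x\<bar>\<bar> \<le> 2 * B" using fb by simp
        show "\<bar>2 * e / 3 + C * ?D n x\<bar> \<le> 2 * e / 3 + C * real K"
          using sb[of x] e by linarith
        have t: "fractions n x \<in> fraction_space" by (rule fractions_mem[OF elim(2)])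
        have sn: "0 \<le> C * ?D n x" using C by (intro mult_nonneg_nonneg sum_nonneg) auto
        show "\<bar>?F n x\<bar> \<le> 2 * e / 3 + C * ?D n x"
        proof (cases "dist_w s_lim (fractions n x) < d")
          case True
          then show ?thesis using fd[OF t True] sn e by linarith
        next
          case False
          then have "1 \<le> (dist_w s_lim (fractions n x) / d)\<^sup>2" using d by simp
          then have "2 * B * 1 \<le> 2 * B * ((dist_w s_lim (fractions n x))\<^sup>2 / d\<^sup>2)"
            using B0 by (intro mult_left_mono) (auto simp: power_divide)
          also have "\<dots> = C * (dist_w s_lim (fractions n x))\<^sup>2" by (simp add: C_def)
          also have "\<dots> \<le> C * ((\<Sum>i<K. \<bar>s_lim i - fractions n x i\<bar>) + 2 / 2 ^ K)"
            by (intro mult_left_mono dist_w_square_le s_lim_fraction_space t C)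
          also have "\<dots> = C * ?D n x + C * (2 / 2 ^ K)"
            by (simp add: distrib_left abs_minus_commute)
          finally show ?thesis using fb[of x] K e by linarith
        qed
      qed
      also have "\<dots> = 2 * e / 3 + E n (\<lambda>x. C * ?D n x)"
        by (subst Bochner_Integration.integral_add[OF _ integrable_pmf_bounded[OF sb]]) simp_all
      finally show ?case using elim(1) by (simp add: dist_real_def)
    qed
  qed
  have "(\<lambda>n. E n (\<lambda>x. ?F n x) + f s_lim) \<longlonglongrightarrow> 0 + f s_lim"
    by (intro tendsto_intros lim)
  then have "(\<lambda>n. E n (\<lambda>x. ?F n x) + f s_lim) \<longlonglongrightarrow> f s_lim" by simp
  then show ?thesis
  proof (rule Lim_transform_eventually)
    show "\<forall>\<^sub>F n in sequentially. E n (\<lambda>x. ?F n x) + f s_lim = E n (\<lambda>x. f (fractions n x))"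
      using eventually_ge_at_top[of N]
    proof eventually_elim
      case (elim n)
      have "integrable (\<nu> n) (\<lambda>x. f (fractions n x))"
        by (rule integrable_pmf_bounded[OF B[OF fractions_mem[OF elim]]])
      then show ?case by simp
    qed
  qed
qed

lemma s_lim_eq_s_star:
  assumes "p lam = P0_star reg lam"
  shows "s_lim = s_star reg lam"
  using assms by (simp add: s_lim_def s_star_def q_def fun_eq_iff)

end

section \<open>The number of tokens in the three regimes\<close>

context rcpb_sequence
begin

text \<open>
  Balance of the token count across the cut between \<open>j\<close> and \<open>j + 1\<close>, conditionally on the fractions: take for
  \<open>h\<close> the indicator of at least \<open>j + 1\<close> tokens.
\<close>
lemma vanishing_token_ratio:
  assumes mu: "\<And>n. mu n = mu0" and mu0: "mu0 > 0" and g: "bounded_lipschitz g"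
    and j: "\<forall>\<^sub>F n in sequentially. j < c n"
  shows "vanishing (\<lambda>n x. g (fractions n x) * of_bool (snd x = Suc j)
      - g (fractions n x) * (mu0 * (1 - fractions n x 1) / lam) * of_bool (snd x = j))"
proof -
  let ?A = "\<lambda>n x. g (fractions n x) * (mu0 * (1 - fractions n x 1) / lam) * of_bool (snd x = j)"
  obtain L where L: "sup_lipschitz L g" using g by (auto simp: bounded_lipschitz_def)
  have L0: "L \<ge> 0" by (rule sup_lipschitz_nonneg[OF L])
  have gb: "\<bar>g (fractions n x)\<bar> \<le> L" if "n \<ge> N" for n x
    by (rule sup_lipschitzD(1)[OF L fractions_mem[OF that]])
  define h where "h m = (of_bool (Suc j \<le> m) :: real)" for m
  define T where "T n x = g (fractions n x) * (lam * (h (snd x - 1) - h (snd x))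
      + of_bool (snd x < c n) * (mu n * (1 - fractions n x 1 - real (snd x) / real n)) * (h (snd x + 1) - h (snd x)))"
    for n and x :: rcpb_state
  have T: "vanishing T"
  proof (rule vanishingI[where B="L * (1 + mu0)"])
    fix n x assume n: "n \<ge> N" and x: "x \<in> set_pmf (\<nu> n)"
    interpret eq: rcpb_equilibrium n "c n" lam "mu n" "\<nu> n" by (rule equilibrium[OF n])
    have "real (snd x) \<le> real n * (1 - fractions n x 1)"
      using eq.stateD[OF x] idle_eq_queue_fractions[OF n_ge_1[OF n], of "fst x"] by (simp add: fractions_def)
    then have r: "0 \<le> 1 - fractions n x 1 - real (snd x) / real n"
      using n_ge_1[OF n] by (simp add: field_simps)
    have r1: "1 - fractions n x 1 - real (snd x) / real n \<le> 1"
      using fractions_bounds(1)[OF n, of x 1] divide_nonneg_nonneg[of "real (snd x)" "real n"] by linarith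
    have "\<bar>lam * (h (snd x - 1) - h (snd x))\<bar> \<le> 1 * 1"
      unfolding abs_mult using lam by (intro mult_mono) (auto simp: h_def)
    moreover have "\<bar>of_bool (snd x < c n) * (mu n * (1 - fractions n x 1 - real (snd x) / real n)) * (h (snd x + 1) - h (snd x))\<bar>
        \<le> 1 * (mu0 * 1) * 1"
      unfolding abs_mult using r r1 mu0 mu by (intro mult_mono) (auto simp: h_def)
    ultimately show "\<bar>T n x\<bar> \<le> L * (1 + mu0)"
      unfolding T_def abs_mult[of "g _"] using gb[OF n, of x] L0 by (intro mult_mono) auto
  next
    have "(\<lambda>n. 2 * L * (1 / real n)) \<longlonglongrightarrow> 2 * L * 0" by (intro tendsto_intros lim_1_over_n)
    then have "(\<lambda>n. 2 * L * 1 / real n) \<longlonglongrightarrow> 0" by simp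
    then show "(\<lambda>n. E n (T n)) \<longlonglongrightarrow> 0"
    proof (rule Lim_null_comparison[rotated])
      show "\<forall>\<^sub>F n in sequentially. norm (E n (T n)) \<le> 2 * L * 1 / real n"
        using eventually_ge_at_top[of N]
      proof eventually_elim
        case (elim n)
        show ?case
          unfolding T_def real_norm_def
          by (rule rcpb_equilibrium.E_token_balance[OF equilibrium[OF elim] L]) (simp add: h_def)
      qed
    qed
  qed
  \<comment> \<open>The token rate involves idle servers whose identity is not stored, \<open>n * (1 - S 1) - j\<close> in number; \<open>U\<close> accounts for the \<open>j\<close>.\<close>
  define U where "U n x = g (fractions n x) * (mu0 * real j / real n) * of_bool (snd x = j)"
    for n and x :: rcpb_state
  have U: "vanishing U"
  proof (rule vanishing_dominated[OF vanishing_deterministic])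
    have "(\<lambda>n. L * mu0 * real j * (1 / real n)) \<longlonglongrightarrow> L * mu0 * real j * 0"
      by (intro tendsto_intros lim_1_over_n)
    then show "(\<lambda>n. L * (mu0 * real j / real n)) \<longlonglongrightarrow> 0" by (simp add: mult.assoc)
    show "\<bar>U n x\<bar> \<le> L * (mu0 * real j / real n)" if "n \<ge> N" for n x
    proof -
      have "\<bar>g (fractions n x)\<bar> * \<bar>mu0 * real j / real n\<bar> * \<bar>of_bool (snd x = j)\<bar> \<le> L * (mu0 * real j / real n) * 1"
        using gb[OF that, of x] mu0 L0 by (intro mult_mono) auto
      then show ?thesis by (simp add: U_def abs_mult)
    qed
  qed
  show ?thesis
  proof (rule vanishing_cong_eventually[OF vanishing_cmult[OF vanishing_add[OF T U], of "- 1 / lam"]])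
    show "\<forall>\<^sub>F n in sequentially. \<forall>x\<in>set_pmf (\<nu> n). - 1 / lam * (T n x + U n x) =
        g (fractions n x) * of_bool (snd x = Suc j)
        - ?A n x"
      using j
    proof eventually_elim
      case (elim n)
      show ?case
      proof
        fix x :: rcpb_state
        have h1: "h (snd x - 1) - h (snd x) = - of_bool (snd x = Suc j)" by (auto simp: h_def)
        have h2: "h (snd x + 1) - h (snd x) = of_bool (snd x = j)" by (auto simp: h_def)
        show "- 1 / lam * (T n x + U n x) = g (fractions n x) * of_bool (snd x = Suc j)
          - ?A n x"
          unfolding T_def U_def h1 h2 mu using elim lam by (cases "snd x = j") (auto simp: field_simps)
      qed
    qed
  qed
qed

text \<open>
  Iterating the ratio is possible because it is itself a Lipschitz function of the fractions and can be
  absorbed into the test function.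
\<close>
lemma vanishing_token_law:
  assumes mu: "\<And>n. mu n = mu0" and mu0: "mu0 > 0" and g: "bounded_lipschitz g"
    and j: "\<forall>\<^sub>F n in sequentially. j \<le> c n"
  shows "vanishing (\<lambda>n x. g (fractions n x) * of_bool (snd x = j)
      - g (fractions n x) * (mu0 * (1 - fractions n x 1) / lam) ^ j * no_token x)"
  using j g
proof (induction j arbitrary: g)
  case 0
  show ?case by (rule vanishing_cong[OF vanishing_deterministic[OF tendsto_const]]) simp
next
  case (Suc j)
  have g': "bounded_lipschitz (\<lambda>s. g s * (mu0 * (1 - s 1) / lam))"
    using Suc.prems by (intro bounded_lipschitz_mult bounded_lipschitz_divide_const bounded_lipschitz_diff) auto
  have j: "\<forall>\<^sub>F n in sequentially. j < c n" using Suc.prems(1) by eventually_elim simp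
  then have "\<forall>\<^sub>F n in sequentially. j \<le> c n" by eventually_elim simp
  from vanishing_add[OF vanishing_token_ratio[OF mu mu0 Suc.prems(2) j] Suc.IH[OF this g']]
  show ?case by (rule vanishing_cong) (simp add: algebra_simps)
qed

lemma geometric_weight_bounded_lipschitz:
  assumes "mu0 > 0"
  shows "bounded_lipschitz (\<lambda>s. inverse (\<Sum>j=0..J. (mu0 * (1 - s 1) / lam) ^ j))"
proof (rule bounded_lipschitz_inverse)
  show "bounded_lipschitz (\<lambda>s. \<Sum>j=0..J. (mu0 * (1 - s 1) / lam) ^ j)"
    by (intro bounded_lipschitz_sum bounded_lipschitz_power bounded_lipschitz_divide_const
        bounded_lipschitz_mult bounded_lipschitz_diff bounded_lipschitz_const bounded_lipschitz_coordinate)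
  fix s :: "nat \<Rightarrow> real" assume "s \<in> fraction_space"
  then have "0 \<le> mu0 * (1 - s 1) / lam" using assms lam by (simp add: fraction_space_def)
  then have "(mu0 * (1 - s 1) / lam) ^ 0 \<le> (\<Sum>j=0..J. (mu0 * (1 - s 1) / lam) ^ j)"
    by (intro member_le_sum) auto
  then show "1 \<le> (\<Sum>j=0..J. (mu0 * (1 - s 1) / lam) ^ j)" by simp
qed

text \<open>
  The probabilities of \<open>0, ..., J\<close> tokens are proportional to the powers of the ratio; dividing the test
  function by their sum isolates the empty memory.
\<close>
lemma vanishing_no_token:
  assumes mu: "\<And>n. mu n = mu0" and mu0: "mu0 > 0" and g: "bounded_lipschitz g"
    and J: "\<forall>\<^sub>F n in sequentially. J \<le> c n"
  shows "vanishing (\<lambda>n x. g (fractions n x) * (inverse (\<Sum>j=0..J. (mu0 * (1 - fractions n x 1) / lam) ^ j)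
      * of_bool (snd x \<le> J) - no_token x))"
proof -
  define rho where "rho s = mu0 * (1 - s 1) / lam" for s :: "nat \<Rightarrow> real"
  define sig where "sig s = (\<Sum>j=0..J. rho s ^ j)" for s
  define g' where "g' s = g s * inverse (sig s)" for s
  let ?w = "\<lambda>j n x. g' (fractions n x) * of_bool (snd x = j) - g' (fractions n x) * (mu0 * (1 - fractions n x 1) / lam) ^ j * no_token x"
  have g': "bounded_lipschitz g'"
    unfolding g'_def sig_def rho_def by (intro bounded_lipschitz_mult g geometric_weight_bounded_lipschitz mu0)
  have "vanishing (\<lambda>n x. \<Sum>j=0..J. ?w j n x)"
  proof (rule vanishing_sum)
    fix j assume "j \<in> {0..J}"
    then have "\<forall>\<^sub>F n in sequentially. j \<le> c n" using J by (auto elim: eventually_mono)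
    then show "vanishing (\<lambda>n x. ?w j n x)"
      by (rule vanishing_token_law[OF mu mu0 g'])
  qed
  then show ?thesis
  proof (rule vanishing_cong)
    fix n and x :: rcpb_state assume n: "n \<ge> N"
    let ?s = "fractions n x"
    have "0 \<le> rho ?s" using fractions_bounds(2)[OF n, of x 1] mu0 lam by (simp add: rho_def)
    then have "rho ?s ^ 0 \<le> sig ?s" unfolding sig_def by (intro member_le_sum) auto
    then have sig: "sig ?s \<noteq> 0" by simp
    have "(\<Sum>j=0..J. g' ?s * of_bool (snd x = j) - g' ?s * rho ?s ^ j * no_token x)
       = g' ?s * (\<Sum>j=0..J. of_bool (snd x = j)) - g' ?s * sig ?s * no_token x"
      unfolding sum_subtractf sig_def by (simp add: sum_distrib_left sum_distrib_right mult.assoc)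
    also have "(\<Sum>j=0..J. of_bool (snd x = j) :: real) = of_bool (snd x \<le> J)"
      by (simp add: of_bool_def)
    also have "g' ?s * sig ?s = g ?s" using sig by (simp add: g'_def)
    finally show "(\<Sum>j=0..J. g' ?s * of_bool (snd x = j) - g' ?s * (mu0 * (1 - ?s 1) / lam) ^ j * no_token x)
       = g ?s * (inverse (\<Sum>j=0..J. (mu0 * (1 - ?s 1) / lam) ^ j) * of_bool (snd x \<le> J) - no_token x)"
      by (simp add: g'_def sig_def rho_def algebra_simps)
  qed
qed

lemma averaged_constrained:
  assumes c: "\<And>n. c n = c0" and mu: "\<And>n. mu n = mu0" and mu0: "mu0 > 0"
  shows "\<exists>M. averaged_rcpb_sequence c lam mu \<nu> N (\<lambda>y. inverse (\<Sum>j=0..c0. (mu0 * (1 - y) / lam) ^ j)) M"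
proof -
  let ?p = "\<lambda>y. inverse (\<Sum>j=0..c0. (mu0 * (1 - y) / lam) ^ j)"
  let ?A = "\<lambda>g n x. g (fractions n x) * (no_token x - ?p (fractions n x 1))"
  obtain M where M: "\<And>y z. 0 \<le> y \<Longrightarrow> y \<le> z \<Longrightarrow> z \<le> 1 \<Longrightarrow> ?p z - ?p y \<le> M * (z - y)"
    using bounded_lipschitz_first_coordinate[OF geometric_weight_bounded_lipschitz[OF mu0]] by meson
  have ge1: "1 \<le> (\<Sum>j=0..c0. (mu0 * (1 - y) / lam) ^ j)" if "y \<le> 1" for y
  proof -
    have "0 \<le> mu0 * (1 - y) / lam" using that mu0 lam by simp
    then have "(mu0 * (1 - y) / lam) ^ 0 \<le> (\<Sum>j=0..c0. (mu0 * (1 - y) / lam) ^ j)"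
      by (intro member_le_sum) auto
    then show ?thesis by simp
  qed
  have avg: "(\<lambda>n. E n (\<lambda>x. ?A g n x)) \<longlonglongrightarrow> 0"
    if g: "bounded_lipschitz g" for g
  proof -
    have "vanishing (\<lambda>n x. - 1 * (g (fractions n x) * (?p (fractions n x 1) * of_bool (snd x \<le> c0) - no_token x)))"
      by (rule vanishing_cmult[OF vanishing_no_token[OF mu mu0 g]]) (simp add: c)
    then have "vanishing (\<lambda>n x. ?A g n x)"
    proof (rule vanishing_cong)
      fix n x assume "n \<ge> N" "x \<in> set_pmf (\<nu> n)"
      then have "snd x \<le> c0" using rcpb_equilibrium.stateD[OF equilibrium] c by metis
      then show "- 1 * (g (fractions n x) * (?p (fractions n x 1) * of_bool (snd x \<le> c0) - no_token x))
          = ?A g n x"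
        by (simp add: algebra_simps)
    qed
    then show ?thesis by (rule vanishing_tendsto)
  qed
  have "averaged_rcpb_sequence c lam mu \<nu> N ?p M"
  proof
    fix y z :: real
    show "?p y \<le> ?p z" if "0 \<le> y" "y \<le> z" "z \<le> 1"
      using that ge1[of z] mu0 lam
      by (intro le_imp_inverse_le sum_mono power_mono divide_right_mono mult_left_mono) auto
    show "?p z - ?p y \<le> M * (z - y)" if "0 \<le> y" "y \<le> z" "z \<le> 1" by (rule M[OF that])
    show "0 \<le> ?p y \<and> ?p y \<le> 1" if "0 \<le> y" "y \<le> 1"
      using ge1[OF that(2)] by (simp add: inverse_le_1_iff)
  next
    fix g and e :: real assume g: "bounded_lipschitz g" and e: "0 < e"
    show "\<forall>\<^sub>F n in sequentially. - e < E n (\<lambda>x. ?A g n x)"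
      using e by (intro order_tendstoD(1)[OF avg[OF g]]) simp
    show "\<forall>\<^sub>F n in sequentially. E n (\<lambda>x. ?A g n x) < e"
      by (intro order_tendstoD(2)[OF avg[OF g]] e)
  qed
  then show ?thesis by blast
qed

text \<open>
  Against a function bounded by \<open>C * (1 - S 1)\<close>, the empty memory is charged to the rate \<open>mu * (1 - S 1)\<close> at
  which it is left, which cannot exceed the rate at which tokens are consumed.
\<close>
lemma averaged_high_message:
  assumes c: "\<And>n. n \<ge> N \<Longrightarrow> c n \<ge> 1" and mu: "filterlim mu at_top sequentially"
  shows "averaged_rcpb_sequence c lam mu \<nu> N (\<lambda>y. 0) 0"
proof
  fix g :: "(nat \<Rightarrow> real) \<Rightarrow> real" and e :: real
  assume g: "bounded_lipschitz g" and pos: "\<And>s. s \<in> fraction_space \<Longrightarrow> 0 \<le> g s" and e: "0 < e"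
  show "\<forall>\<^sub>F n in sequentially. - e < E n (\<lambda>x. g (fractions n x) * (no_token x - 0))"
    using eventually_ge_at_top[of N]
  proof eventually_elim
    case (elim n)
    have "0 \<le> E n (\<lambda>x. g (fractions n x) * (no_token x - 0))"
      using pos[OF fractions_mem[OF elim]] by (intro Bochner_Integration.integral_nonneg) auto
    then show ?case using e by linarith
  qed
  fix C :: real assume C: "\<And>s. s \<in> fraction_space \<Longrightarrow> g s \<le> C * (1 - s 1)"
  let ?A = "\<lambda>n x. (1 - fractions n x 1) * no_token x"
  have bl: "sup_lipschitz 1 (\<lambda>_. 1)" by (simp add: sup_lipschitz_def) (metis abs_ge_zero order.trans)
  \<comment> \<open>The balance across the cut between \<open>0\<close> and \<open>1\<close> token, with a constant test function.\<close>
  have bound: "mu n * E n (\<lambda>x. ?A n x) \<le> 3" if n: "n \<ge> N" for n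
  proof -
    interpret eq: rcpb_equilibrium n "c n" lam "mu n" "\<nu> n" by (rule equilibrium[OF n])
    define h where "h m = (of_bool (1 \<le> m) :: real)" for m :: nat
    have b: "\<bar>?A n x\<bar> \<le> 1" "\<bar>of_bool (snd x = 1) :: real\<bar> \<le> 1" for x
      using fractions_bounds(1,2)[OF n, of x 1] by auto
    have i: "integrable (\<nu> n) (\<lambda>x. ?A n x)"
       "integrable (\<nu> n) (\<lambda>x. of_bool (snd x = 1) :: real)"
      by (rule integrable_pmf_bounded, rule b)+
    have "\<bar>E n (\<lambda>x. 1 * (lam * (h (snd x - 1) - h (snd x))
      + of_bool (snd x < c n) * (mu n * (1 - fractions n x 1 - real (snd x) / real n)) * (h (snd x + 1) - h (snd x))))\<bar>
      \<le> 2 * 1 * 1 / real n"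
      by (rule eq.E_token_balance[OF bl]) (simp add: h_def)
    also have "E n (\<lambda>x. 1 * (lam * (h (snd x - 1) - h (snd x))
      + of_bool (snd x < c n) * (mu n * (1 - fractions n x 1 - real (snd x) / real n)) * (h (snd x + 1) - h (snd x))))
      = E n (\<lambda>x. mu n * (?A n x) - lam * of_bool (snd x = 1))"
    proof (rule expectation_pmf_cong)
      fix x :: rcpb_state
      have h1: "h (snd x - 1) - h (snd x) = - of_bool (snd x = 1)" by (auto simp: h_def)
      have h2: "h (snd x + 1) - h (snd x) = no_token x" by (auto simp: h_def)
      show "1 * (lam * (h (snd x - 1) - h (snd x))
        + of_bool (snd x < c n) * (mu n * (1 - fractions n x 1 - real (snd x) / real n)) * (h (snd x + 1) - h (snd x)))
        = mu n * (?A n x) - lam * of_bool (snd x = 1)"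
        unfolding h1 h2 using c[OF n] by (cases "snd x = 0") auto
    qed
    also have "\<dots> = mu n * E n (\<lambda>x. ?A n x) - lam * E n (\<lambda>x. of_bool (snd x = 1))"
      by (subst Bochner_Integration.integral_diff) (use i in auto)
    finally have "mu n * E n (\<lambda>x. ?A n x)
        \<le> 2 / real n + lam * E n (\<lambda>x. of_bool (snd x = 1))" by linarith
    moreover have "\<bar>E n (\<lambda>x. of_bool (snd x = 1))\<bar> \<le> 1" by (rule expectation_pmf_abs_le) simp
    then have "lam * E n (\<lambda>x. of_bool (snd x = 1)) \<le> 1 * 1" using lam by (intro mult_mono) auto
    moreover have "2 / real n \<le> 2" using n_ge_1[OF n] by (simp add: field_simps)
    ultimately show ?thesis by linarith
  qed
  have "filterlim (\<lambda>n. mu n) at_infinity sequentially" using mu by (rule filterlim_at_top_imp_at_infinity)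
  then have "(\<lambda>n. 3 * \<bar>C\<bar> / mu n) \<longlonglongrightarrow> 0" by (intro tendsto_divide_0[OF tendsto_const])
  then have "\<forall>\<^sub>F n in sequentially. 3 * \<bar>C\<bar> / mu n < e" by (rule order_tendstoD(2)[OF _ e])
  then show "\<forall>\<^sub>F n in sequentially. E n (\<lambda>x. g (fractions n x) * (no_token x - 0)) < e"
    using eventually_ge_at_top[of N] filterlim_at_top_dense[THEN iffD1, OF mu, rule_format, of 0]
  proof eventually_elim
    case (elim n)
    obtain L where L: "sup_lipschitz L g" using g by (auto simp: bounded_lipschitz_def)
    have b: "0 \<le> ?A n x" "?A n x \<le> 1" for x
      using fractions_bounds(1,2)[OF elim(2), of x 1] by auto
    have "E n (\<lambda>x. g (fractions n x) * (no_token x - 0))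
        \<le> E n (\<lambda>x. \<bar>C\<bar> * (?A n x))"
    proof (rule expectation_pmf_mono[where A=L and B="\<bar>C\<bar> * 1"])
      fix x
      show "\<bar>g (fractions n x) * (no_token x - 0)\<bar> \<le> L"
        using sup_lipschitzD(1)[OF L] sup_lipschitz_nonneg[OF L] fractions_mem[OF elim(2)] by auto
      show "\<bar>\<bar>C\<bar> * (?A n x)\<bar> \<le> \<bar>C\<bar> * 1"
        unfolding abs_mult abs_abs using b[of x] by (intro mult_left_mono) (simp_all only: abs_of_nonneg abs_ge_zero)
      have "g (fractions n x) \<le> C * (1 - fractions n x 1)" by (rule C[OF fractions_mem[OF elim(2)]])
      also have "\<dots> \<le> \<bar>C\<bar> * (1 - fractions n x 1)"
        using fractions_bounds(2)[OF elim(2), of x 1] by (intro mult_right_mono) auto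
      finally show "g (fractions n x) * (no_token x - 0) \<le> \<bar>C\<bar> * (?A n x)"
        by simp
    qed
    also have "\<dots> = \<bar>C\<bar> * E n (\<lambda>x. ?A n x)" by simp
    also have "\<dots> \<le> \<bar>C\<bar> * (3 / mu n)"
      using bound[OF elim(2)] elim(3) by (intro mult_left_mono) (auto simp: field_simps)
    finally show ?case using elim(1) by (simp add: mult.commute)
  qed
qed auto

text \<open>
  The balance of the mean number of tokens, with \<open>h M = M\<close>. Tokens are consumed at rate \<open>lam * (1 - G)\<close> and
  created at rate at most \<open>mu0 * (1 - S 1)\<close>; a full memory only lowers creation. Since \<open>h\<close> is bounded by \<open>c n\<close>,
  the error is of order \<open>c n / n\<close>, and this is where the memory has to be small compared with \<open>n\<close>.
\<close>
lemma high_memory_token_lower: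
  assumes mu: "\<And>n. mu n = mu0" and mu0: "mu0 > 0" and c: "(\<lambda>n. real (c n) / real n) \<longlonglongrightarrow> 0"
    and g: "bounded_lipschitz g" and pos: "\<And>s. s \<in> fraction_space \<Longrightarrow> 0 \<le> g s" and e: "0 < e"
  shows "\<forall>\<^sub>F n in sequentially. - e < E n (\<lambda>x. g (fractions n x) *
     (no_token x - (1 - mu0 * (1 - fractions n x 1) / lam)))"
proof -
  obtain L where L: "sup_lipschitz L g" using g by (auto simp: bounded_lipschitz_def)
  have "(\<lambda>n. (2 * L / lam) * (real (c n) / real n)) \<longlonglongrightarrow> (2 * L / lam) * 0" by (intro tendsto_intros c)
  then have "(\<lambda>n. (2 * L / lam) * (real (c n) / real n)) \<longlonglongrightarrow> 0" by simp
  from order_tendstoD(2)[OF this e] eventually_ge_at_top[of N] show ?thesis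
  proof eventually_elim
    case (elim n)
    interpret eq: rcpb_equilibrium n "c n" lam "mu n" "\<nu> n" by (rule equilibrium[OF elim(2)])
    define R where "R x = g (fractions n x) * (no_token x - (1 - mu0 * (1 - fractions n x 1) / lam))"
      for x :: rcpb_state
    define T where "T x = g (fractions n x) * (lam * (real (snd x - 1) - real (snd x))
      + of_bool (snd x < c n) * (mu n * (1 - fractions n x 1 - real (snd x) / real n)) * (real (snd x + 1) - real (snd x)))"
      for x :: rcpb_state
    have ET: "\<bar>E n T\<bar> \<le> 2 * L * real (c n) / real n"
      unfolding T_def by (rule eq.E_token_balance[OF L]) simp
      let ?B = "\<lambda>x. of_bool (snd x < c n) * (mu0 * (1 - fractions n x 1 - real (snd x) / real n))"
    have gb: "\<bar>g (fractions n x)\<bar> \<le> L" for x by (rule sup_lipschitzD(1)[OF L fractions_mem[OF elim(2)]])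
    have y: "0 \<le> 1 - fractions n x 1" "1 - fractions n x 1 \<le> 1" for x
      using fractions_bounds(1,2)[OF elim(2), of x 1] by auto
    have "E n T \<le> E n (\<lambda>x. lam * R x)"
    proof (rule expectation_pmf_mono[where A="L * (1 + mu0 * (1 + real (c n)))" and B="L * (1 + mu0)"])
      fix x assume x: "x \<in> set_pmf (\<nu> n)"
      have m: "snd x \<le> c n" using eq.stateD[OF x] by simp
      have d: "real (snd x - 1) - real (snd x) = no_token x - 1" by (cases "snd x") auto
      have Teq: "T x = g (fractions n x) * (lam * (no_token x - 1)
          + ?B x)"
        unfolding T_def d mu by simp
      have Req: "lam * R x = g (fractions n x) * (lam * (no_token x - 1) + mu0 * (1 - fractions n x 1))"
        using lam by (simp add: R_def field_simps)
      have mn: "0 \<le> real (snd x) / real n" "real (snd x) / real n \<le> real (c n)"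
      proof -
        have "real (snd x) / real n \<le> real (snd x) / 1" using n_ge_1[OF elim(2)] by (intro divide_left_mono) auto
        then show "real (snd x) / real n \<le> real (c n)" using m by simp
      qed simp
      have "?B x \<le> mu0 * (1 - fractions n x 1)"
        using mn y[of x] mu0 by (cases "snd x < c n") auto
      then show "T x \<le> lam * R x" unfolding Teq Req
        using pos[OF fractions_mem[OF elim(2), of x]] by (intro mult_left_mono) auto
      have l1: "\<bar>lam * (no_token x - 1)\<bar> \<le> 1" using lam by auto
      have "\<bar>mu0 * (1 - fractions n x 1)\<bar> \<le> mu0 * 1"
        unfolding abs_mult using mu0 y[of x] by (intro mult_mono) auto
      with l1 have "\<bar>lam * (no_token x - 1) + mu0 * (1 - fractions n x 1)\<bar> \<le> 1 + mu0" by linarith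
      then show "\<bar>lam * R x\<bar> \<le> L * (1 + mu0)"
        unfolding Req abs_mult[of "g _"] using gb[of x] by (intro mult_mono) auto
      have "\<bar>?B x\<bar> \<le> 1 * (mu0 * (1 + real (c n)))"
      proof -
        have "\<bar>1 - fractions n x 1 - real (snd x) / real n\<bar> \<le> 1 + real (c n)" using mn y[of x] by linarith
        then show ?thesis unfolding abs_mult using mu0 by (intro mult_mono) auto
      qed
      with l1 have "\<bar>lam * (no_token x - 1)
          + ?B x\<bar> \<le> 1 + mu0 * (1 + real (c n))"
        by linarith
      then show "\<bar>T x\<bar> \<le> L * (1 + mu0 * (1 + real (c n)))"
        unfolding Teq abs_mult[of "g _"] using gb[of x] by (intro mult_mono) auto
    qed
    then have "- (2 * L * real (c n) / real n) \<le> lam * E n R" using ET by simp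
    moreover have "(2 * L / lam) * (real (c n) / real n) = (2 * L * real (c n) / real n) / lam" by simp
    moreover have "- (z / lam) \<le> r" if "- z \<le> lam * r" for z r :: real
      using that lam by (simp add: field_simps)
    ultimately have "- ((2 * L / lam) * (real (c n) / real n)) \<le> E n R" by metis
    then show ?case using elim(1) unfolding R_def by linarith
  qed
qed

end

text \<open>
  The truncated geometric law gives \<open>0\<close> a probability that exceeds its limit by at most \<open>1 / (J + 1)\<close>,
  uniformly in the ratio, also at the critical ratio \<open>1\<close>.
\<close>
lemma inverse_geometric_sum_le:
  fixes r :: real
  assumes r: "0 \<le> r"
  shows "inverse (\<Sum>j=0..J. r ^ j) \<le> max (1 - r) 0 + 1 / real (Suc J)"
proof -
  define s where "s = (\<Sum>j=0..J. r ^ j)"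
  have "r ^ 0 \<le> s" unfolding s_def using r by (intro member_le_sum) auto
  then have s1: "s \<ge> 1" by simp
  show ?thesis
  proof (cases "r \<ge> 1")
    case True
    have "(\<Sum>j=0..J. 1) \<le> s" unfolding s_def using True by (intro sum_mono) auto
    then have "real (Suc J) \<le> s" by simp
    then have "inverse s \<le> inverse (real (Suc J))" by (intro le_imp_inverse_le) auto
    then show ?thesis using True by (simp add: s_def inverse_eq_divide)
  next
    case False
    have geo: "(1 - r) * s = 1 - r ^ Suc J"
      unfolding s_def using one_diff_power_eq[of r "Suc J"] by (simp add: atLeast0AtMost lessThan_Suc_atMost)
    have "(\<Sum>j=0..J. r ^ Suc J) \<le> s"
      unfolding s_def using r False by (intro sum_mono power_decreasing) auto
    then have "real (Suc J) * r ^ Suc J \<le> s" by simp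
    then have "r ^ Suc J / s \<le> 1 / real (Suc J)" using s1 by (simp add: field_simps)
    moreover have "inverse s = (1 - r) + r ^ Suc J / s" using geo s1 by (simp add: field_simps)
    ultimately show ?thesis using False by (simp add: s_def)
  qed
qed

text \<open>
  For the upper bound the memory is truncated at a fixed level \<open>J\<close>, and \<open>J\<close> tends to infinity after \<open>n\<close>.
  The lower bound \<open>1 - rho\<close> is negative where \<open>rho > 1\<close>; there it is replaced by the trivial bound \<open>0\<close>, by
  multiplying the test function with a Lipschitz cutoff.
\<close>
lemma (in rcpb_sequence) averaged_high_memory:
  assumes mu: "\<And>n. mu n = mu0" and mu0: "mu0 > 0" and c: "(\<lambda>n. real (c n) / real n) \<longlonglongrightarrow> 0"
    and c_top: "filterlim c at_top sequentially"
  shows "\<exists>M. averaged_rcpb_sequence c lam mu \<nu> N (\<lambda>y. max (1 - mu0 * (1 - y) / lam) 0) M"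
proof -
  let ?p = "\<lambda>y. max (1 - mu0 * (1 - y) / lam) 0"
  let ?A = "\<lambda>g n x. g (fractions n x) * (no_token x - ?p (fractions n x 1))"
  have blr: "bounded_lipschitz (\<lambda>s. 1 - mu0 * (1 - s 1) / lam)"
    by (intro bounded_lipschitz_diff bounded_lipschitz_divide_const bounded_lipschitz_mult
        bounded_lipschitz_const bounded_lipschitz_coordinate)
  have "bounded_lipschitz (\<lambda>s. ?p (s 1))" by (intro bounded_lipschitz_max blr bounded_lipschitz_const)
  then obtain M where M: "\<And>y z. 0 \<le> y \<Longrightarrow> y \<le> z \<Longrightarrow> z \<le> 1 \<Longrightarrow> ?p z - ?p y \<le> M * (z - y)"
    using bounded_lipschitz_first_coordinate[of ?p] by meson
  have prange: "0 \<le> ?p y \<and> ?p y \<le> 1" if "y \<le> 1" for y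
    using that mu0 lam by auto
  have "averaged_rcpb_sequence c lam mu \<nu> N ?p M"
  proof
    fix y z :: real
    show "?p y \<le> ?p z" if "0 \<le> y" "y \<le> z" "z \<le> 1"
    proof -
      have "mu0 * (1 - z) / lam \<le> mu0 * (1 - y) / lam"
        using that mu0 lam by (intro divide_right_mono mult_left_mono) auto
      then show ?thesis by simp
    qed
    show "?p z - ?p y \<le> M * (z - y)" if "0 \<le> y" "y \<le> z" "z \<le> 1" by (rule M[OF that])
    show "0 \<le> ?p y \<and> ?p y \<le> 1" if "0 \<le> y" "y \<le> 1" by (rule prange[OF that(2)])
  next
    fix g :: "(nat \<Rightarrow> real) \<Rightarrow> real" and e :: real
    assume g: "bounded_lipschitz g" and pos: "\<And>s. s \<in> fraction_space \<Longrightarrow> 0 \<le> g s" and e: "0 < e"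
    obtain L where L: "sup_lipschitz L g" using g by (auto simp: bounded_lipschitz_def)
    have L0: "L \<ge> 0" by (rule sup_lipschitz_nonneg[OF L])
    have gb: "0 \<le> g (fractions n x)" "g (fractions n x) \<le> L" if "n \<ge> N" for n x
      using sup_lipschitzD(1)[OF L fractions_mem[OF that, of x]] pos[OF fractions_mem[OF that, of x]] by auto
    have pp: "\<bar>?A g n x\<bar> \<le> L * 1" if "n \<ge> N" for n x
      unfolding abs_mult using gb[OF that, of x] prange[of "fractions n x 1"] fractions_bounds(2)[OF that, of x 1] L0
      by (intro mult_mono) (auto split: if_splits)
    show "\<forall>\<^sub>F n in sequentially. - e < E n (\<lambda>x. ?A g n x)"
    proof -
      \<comment> \<open>\<open>a\<close> is the width of the cutoff, small enough for the error \<open>L * a\<close> to be at most \<open>e / 2\<close>; \<open>L + 1\<close> avoids division by zero.\<close>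
      define a where "a = e / (2 * (L + 1))"
      have a: "a > 0" using e L0 by (simp add: a_def)
      have La: "L * a \<le> e / 2"
      proof -
        have "L * a \<le> (L + 1) * a" using a by (intro mult_right_mono) auto
        also have "(L + 1) * a = e / 2"
        proof -
          have "L + 1 \<noteq> 0" using L0 by linarith
          then show ?thesis by (simp add: a_def field_simps)
        qed
        finally show ?thesis .
      qed
      define k where "k s = g s * ramp a (1 - mu0 * (1 - s 1) / lam)" for s
      have k: "bounded_lipschitz k" unfolding k_def by (intro bounded_lipschitz_mult g bounded_lipschitz_ramp blr)
      then obtain L' where L': "sup_lipschitz L' k" by (auto simp: bounded_lipschitz_def)
      have k0: "0 \<le> k s" if "s \<in> fraction_space" for s
        using pos[OF that] ramp_bounds(1)[OF a] by (simp add: k_def)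
      have "\<forall>\<^sub>F n in sequentially. - (e / 2) < E n (\<lambda>x. k (fractions n x) *
           (no_token x - (1 - mu0 * (1 - fractions n x 1) / lam)))"
        by (rule high_memory_token_lower[OF mu mu0 c k k0]) (use e in auto)
      then show ?thesis using eventually_ge_at_top[of N]
      proof eventually_elim
        case (elim n)
        define X where "X x = k (fractions n x) * (no_token x - (1 - mu0 * (1 - fractions n x 1) / lam))"
          for x :: rcpb_state
        define Y where "Y x = ?A g n x"
          for x :: rcpb_state
        have Yb: "\<bar>Y x\<bar> \<le> L * 1" for x unfolding Y_def by (rule pp[OF elim(2)])
        have "E n X \<le> E n (\<lambda>x. Y x + L * a)"
        proof (rule expectation_pmf_mono[where A="L' * (2 + mu0 / lam)" and B="L * 1 + L * a"])
          fix x
          define r where "r = 1 - mu0 * (1 - fractions n x 1) / lam"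
          have y: "0 \<le> fractions n x 1" "fractions n x 1 \<le> 1" using fractions_bounds(1,2)[OF elim(2)] by auto
          have "mu0 * (1 - fractions n x 1) / lam \<le> mu0 * 1 / lam" "0 \<le> mu0 * (1 - fractions n x 1) / lam"
            using y mu0 lam by (intro divide_right_mono mult_left_mono divide_nonneg_nonneg mult_nonneg_nonneg; simp)+
          then have rb: "\<bar>no_token x - r\<bar> \<le> 2 + mu0 / lam" by (auto simp: r_def)
          show "\<bar>X x\<bar> \<le> L' * (2 + mu0 / lam)"
            unfolding X_def abs_mult r_def[symmetric]
            using rb sup_lipschitzD(1)[OF L' fractions_mem[OF elim(2), of x]] by (intro mult_mono) auto
          show "\<bar>Y x + L * a\<bar> \<le> L * 1 + L * a"
            using Yb[of x] mult_nonneg_nonneg[OF L0 order.strict_implies_order[OF a]] by linarith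
          have rr: "ramp a r * (no_token x - r) \<le> no_token x - max r 0 + a"
          proof -
            have "ramp a r * no_token x \<le> no_token x"
              using ramp_bounds(2)[OF a, of r] by simp
            moreover have "max r 0 - ramp a r * r \<le> a"
            proof -
              consider "r \<le> 0" | "r \<ge> a" | "0 < r" "r < a" by linarith
              then show ?thesis
              proof cases
                case 3
                then have "0 \<le> ramp a r * r" using ramp_bounds(1)[OF a, of r] by simp
                then show ?thesis using 3 by simp
              qed (use a ramp_bounds(3,4)[OF a, of r] in auto)
            qed
            ultimately show ?thesis by (simp add: right_diff_distrib)
          qed
          have "X x = g (fractions n x) * (ramp a r * (no_token x - r))"
            by (simp add: X_def k_def r_def mult.assoc)
          also have "\<dots> \<le> g (fractions n x) * (no_token x - max r 0 + a)"
            using gb(1)[OF elim(2)] rr by (intro mult_left_mono)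
          also have "\<dots> = Y x + g (fractions n x) * a"
            by (simp add: Y_def r_def distrib_left)
          also have "\<dots> \<le> Y x + L * a" using gb(2)[OF elim(2), of x] a by (intro add_left_mono mult_right_mono) auto
          finally show "X x \<le> Y x + L * a" .
        qed
        also have "\<dots> = E n Y + L * a"
          by (subst Bochner_Integration.integral_add[OF integrable_pmf_bounded[OF Yb]]) simp_all
        finally show ?case using elim(1) La unfolding X_def Y_def by linarith
      qed
    qed
    show "\<forall>\<^sub>F n in sequentially. E n (\<lambda>x. ?A g n x) < e"
    proof -
      have "(\<lambda>J. L * (1 / real (Suc J))) \<longlonglongrightarrow> L * 0"
        by (intro tendsto_intros) (use LIMSEQ_inverse_real_of_nat in \<open>simp add: inverse_eq_divide\<close>)
      then have "\<forall>\<^sub>F J in sequentially. L * (1 / real (Suc J)) < e / 2"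
        using e by (intro order_tendstoD(2)) auto
      then obtain J where J: "L * (1 / real (Suc J)) < e / 2" by (auto simp: eventually_sequentially)
      have "\<forall>\<^sub>F n in sequentially. J \<le> c n" using c_top by (simp add: filterlim_at_top)
      note v = vanishing_no_token[OF mu mu0 g this]
      from order_tendstoD(1)[OF vanishing_tendsto[OF v], of "- (e / 2)"]
      have "\<forall>\<^sub>F n in sequentially. - (e / 2) < E n (\<lambda>x. g (fractions n x) *
          (inverse (\<Sum>j=0..J. (mu0 * (1 - fractions n x 1) / lam) ^ j) * of_bool (snd x \<le> J) - no_token x))"
        using e by simp
      then show ?thesis using eventually_ge_at_top[of N]
      proof eventually_elim
        case (elim n)
        define X where "X x = g (fractions n x) *
          (inverse (\<Sum>j=0..J. (mu0 * (1 - fractions n x 1) / lam) ^ j) * of_bool (snd x \<le> J) - no_token x)"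
          for x :: rcpb_state
        define Y where "Y x = ?A g n x"
          for x :: rcpb_state
        have Yb: "\<bar>Y x\<bar> \<le> L * 1" for x unfolding Y_def by (rule pp[OF elim(2)])
        have "E n X \<le> E n (\<lambda>x. L * (1 / real (Suc J)) - Y x)"
        proof (rule expectation_pmf_mono[where A="L * 1" and B="L * (1 / real (Suc J)) + L * 1"])
          fix x
          define r where "r = mu0 * (1 - fractions n x 1) / lam"
          have r: "0 \<le> r" using fractions_bounds(2)[OF elim(2), of x 1] mu0 lam by (simp add: r_def)
          define w where "w = inverse (\<Sum>j=0..J. r ^ j)"
          have "r ^ 0 \<le> (\<Sum>j=0..J. r ^ j)" using r by (intro member_le_sum) auto
          then have w: "0 \<le> w" "w \<le> 1" by (auto simp: w_def inverse_le_1_iff)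
          have w2: "w \<le> max (1 - r) 0 + 1 / real (Suc J)" unfolding w_def by (rule inverse_geometric_sum_le[OF r])
          have Xeq: "X x = g (fractions n x) * (w * of_bool (snd x \<le> J) - no_token x)"
            by (simp add: X_def w_def r_def)
          show "\<bar>X x\<bar> \<le> L * 1" unfolding Xeq abs_mult
            using gb[OF elim(2), of x] w L0 by (intro mult_mono) auto
          show "\<bar>L * (1 / real (Suc J)) - Y x\<bar> \<le> L * (1 / real (Suc J)) + L * 1"
          proof -
            have "0 \<le> L * (1 / real (Suc J))" using L0 by simp
            then show ?thesis using Yb[of x] by linarith
          qed
          have "w * of_bool (snd x \<le> J) \<le> w" using w by simp
          then have "w * of_bool (snd x \<le> J) - no_token x
              \<le> 1 / real (Suc J) - (no_token x - max (1 - r) 0)" using w2 by linarith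
          then have "X x \<le> g (fractions n x) * (1 / real (Suc J) - (no_token x - max (1 - r) 0))"
            unfolding Xeq using gb(1)[OF elim(2), of x] by (intro mult_left_mono)
          also have "\<dots> = g (fractions n x) * (1 / real (Suc J)) - Y x"
            by (simp add: Y_def r_def right_diff_distrib)
          also have "\<dots> \<le> L * (1 / real (Suc J)) - Y x"
            using gb(2)[OF elim(2), of x] by (intro diff_right_mono mult_right_mono) auto
          finally show "X x \<le> L * (1 / real (Suc J)) - Y x" .
        qed
        also have "\<dots> = L * (1 / real (Suc J)) - E n Y"
          by (subst Bochner_Integration.integral_diff[OF _ integrable_pmf_bounded[OF Yb]]) simp_all
        finally have "E n Y \<le> L * (1 / real (Suc J)) - E n X" by linarith
        then show ?case using elim(1) J unfolding X_def Y_def by linarith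
      qed
    qed
  qed
  then show ?thesis by blast
qed

section \<open>The limit theorem\<close>

lemma rcpb_equilibrium_lift:
  assumes "n \<ge> 1" "0 < lam" "lam < 1" "0 \<le> mu"
    and tf: "transition_function (rcpb_states n c) (rcpb_rate lam c mu n) P"
    and im: "image_transition_function (rcpb_states n c) (rcpb_observe n) P R"
    and inv: "invariant_distribution (rcpb_observe n ` rcpb_states n c) R \<pi>"
  shows "rcpb_equilibrium n c lam mu (map_pmf (inv_into (rcpb_states n c) (rcpb_observe n)) \<pi>)"
proof
  let ?\<nu> = "map_pmf (inv_into (rcpb_states n c) (rcpb_observe n)) \<pi>"
  show "set_pmf ?\<nu> \<subseteq> rcpb_states n c"
    using inv unfolding invariant_distribution_def set_map_pmf image_subset_iff
    by (meson inv_into_into subsetD)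
  fix g :: "(nat \<Rightarrow> real) \<Rightarrow> nat \<Rightarrow> real" and B :: real
  assume B: "\<And>s m. s \<in> fraction_space \<Longrightarrow> m \<le> c \<Longrightarrow> \<bar>g s m\<bar> \<le> B"
  have "measure_pmf.expectation ?\<nu> (rcpb_generator lam c mu n (\<lambda>x. (\<lambda>(s, m). g s m) (rcpb_observe n x))) = 0"
  proof (rule rcpb_generator_expectation_zero[OF _ _ tf im inv])
    fix x assume "x \<in> rcpb_states n c"
    then show "\<bar>(\<lambda>(s, m). g s m) (rcpb_observe n x)\<bar> \<le> B"
      using B queue_fractions_fraction_space[OF assms(1)]
      by (auto simp: rcpb_states_def rcpb_observe_def)
  qed (use assms in auto)
  then show "measure_pmf.expectation ?\<nu> (rcpb_generator lam c mu n (\<lambda>x. g (queue_fractions n (fst x)) (snd x))) = 0"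
    by (simp add: rcpb_observe_def case_prod_beta)
qed (use assms in auto)

theorem theorem3p4:
  fixes lam :: real and reg :: regime
    and c :: "nat \<Rightarrow> nat" and mu :: "nat \<Rightarrow> real"
    and P :: "nat \<Rightarrow> real \<Rightarrow> rcpb_state \<Rightarrow> rcpb_state pmf"
    and R :: "nat \<Rightarrow> real \<Rightarrow> (nat \<Rightarrow> real) \<times> nat \<Rightarrow> ((nat \<Rightarrow> real) \<times> nat) pmf"
    and \<pi> :: "nat \<Rightarrow> ((nat \<Rightarrow> real) \<times> nat) pmf"
  assumes "0 < lam" and "lam < 1"
    and "in_regime reg c mu"
    and "\<And>n. 1 \<le> n \<Longrightarrow> c n \<le> n \<Longrightarrow>
           transition_function (rcpb_states n (c n)) (rcpb_rate lam (c n) (mu n) n) (P n)"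
    and "\<And>n. 1 \<le> n \<Longrightarrow> c n \<le> n \<Longrightarrow>
           image_transition_function (rcpb_states n (c n)) (rcpb_observe n) (P n) (R n)"
    and "\<And>n. 1 \<le> n \<Longrightarrow> c n \<le> n \<Longrightarrow>
           invariant_distribution (rcpb_observe n ` rcpb_states n (c n)) (R n) (\<pi> n)"
  shows "weakly_converges fraction_topology (\<lambda>n. map_pmf fst (\<pi> n))
           (return_pmf (s_star reg lam))"
proof -
  let ?u = "\<lambda>n. inv_into (rcpb_states n (c n)) (rcpb_observe n)"
  define \<nu> where "\<nu> n = map_pmf (?u n) (\<pi> n)" for n
  have seq: "rcpb_sequence c lam mu \<nu> N"
    if N: "\<And>n. n \<ge> N \<Longrightarrow> n \<ge> 1 \<and> c n \<le> n \<and> mu n \<ge> 0" for N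
  proof (rule rcpb_sequence.intro)
    fix n assume "n \<ge> N"
    then have n: "n \<ge> 1" "c n \<le> n" "mu n \<ge> 0" using N by auto
    show "rcpb_equilibrium n (c n) lam (mu n) (\<nu> n)"
      unfolding \<nu>_def
      by (rule rcpb_equilibrium_lift[OF n(1) assms(1,2) n(3) assms(4)[OF n(1,2)] assms(5)[OF n(1,2)] assms(6)[OF n(1,2)]])
  qed
  have "\<exists>N p M. averaged_rcpb_sequence c lam mu \<nu> N p M \<and> p lam = P0_star reg lam \<and> (\<forall>n\<ge>N. n \<ge> 1 \<and> c n \<le> n)"
  proof (cases reg)
    case (High_Memory mu0)
    with assms(3) have h: "\<And>n. 1 \<le> n \<Longrightarrow> 1 \<le> c n \<and> c n \<le> n" "filterlim c at_top sequentially"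
        "(\<lambda>n. real (c n) / real n) \<longlonglongrightarrow> 0" "mu0 > 0" "\<And>n. mu n = mu0"
      by auto
    have s: "rcpb_sequence c lam mu \<nu> 1" by (rule seq) (use h in \<open>auto intro: less_imp_le\<close>)
    show ?thesis
      using rcpb_sequence.averaged_high_memory[OF s h(5,4,3,2)] h(1) unfolding High_Memory P0_star.simps by blast
  next
    case (High_Message c0)
    with assms(3) have h: "c0 \<ge> 1" "\<And>n. c n = c0" "\<And>n. n \<ge> c0 \<Longrightarrow> mu n > 0" "filterlim mu at_top sequentially"
      by auto
    have s: "rcpb_sequence c lam mu \<nu> c0" by (rule seq) (use h in \<open>auto intro: less_imp_le\<close>)
    have "averaged_rcpb_sequence c lam mu \<nu> c0 (\<lambda>y. 0) 0"
      by (rule rcpb_sequence.averaged_high_message[OF s _ h(4)]) (simp only: h(1,2))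
    moreover have "\<forall>n\<ge>c0. n \<ge> 1 \<and> c n \<le> n" using h by auto
    ultimately show ?thesis unfolding High_Message P0_star.simps by blast
  next
    case (Constrained c0 mu0)
    with assms(3) have h: "c0 \<ge> 1" "\<And>n. c n = c0" "mu0 > 0" "\<And>n. mu n = mu0" by auto
    have s: "rcpb_sequence c lam mu \<nu> c0" by (rule seq) (use h in \<open>auto intro: less_imp_le\<close>)
    have "\<forall>n\<ge>c0. n \<ge> 1 \<and> c n \<le> n" using h by auto
    then show ?thesis
      using rcpb_sequence.averaged_constrained[OF s h(2,4,3)] unfolding Constrained P0_star.simps by blast
  qed
  then obtain N p M where av: "averaged_rcpb_sequence c lam mu \<nu> N p M" and p: "p lam = P0_star reg lam"
    and N: "\<And>n. n \<ge> N \<Longrightarrow> n \<ge> 1 \<and> c n \<le> n" by blast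
  interpret averaged_rcpb_sequence c lam mu \<nu> N p M by (rule av)
  show ?thesis
    unfolding weakly_converges_def
  proof (intro allI impI, elim conjE)
    fix f assume f: "continuous_map fraction_topology euclideanreal f" and b: "bounded (f ` topspace fraction_topology)"
    have ts: "topspace fraction_topology = fraction_space"
      using Metric_space.topspace_mtopology[OF Metric_space_fraction_space] .
    have "(\<lambda>n. measure_pmf.expectation (\<nu> n) (\<lambda>x. f (fractions n x))) \<longlonglongrightarrow> f s_lim"
      by (rule expectation_tendsto[OF f]) (use b ts in simp)
    moreover have "\<forall>\<^sub>F n in sequentially. measure_pmf.expectation (\<nu> n) (\<lambda>x. f (fractions n x))
        = measure_pmf.expectation (map_pmf fst (\<pi> n)) f"
      using eventually_ge_at_top[of N]
    proof eventually_elim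
      case (elim n)
      have sup: "set_pmf (\<pi> n) \<subseteq> rcpb_observe n ` rcpb_states n (c n)"
        using assms(6) N[OF elim] by (simp add: invariant_distribution_def)
      have "measure_pmf.expectation (\<pi> n) (\<lambda>z. f (fractions n (?u n z)))
          = measure_pmf.expectation (\<pi> n) (\<lambda>z. f (fst z))"
      proof (rule expectation_pmf_cong)
        fix z assume "z \<in> set_pmf (\<pi> n)"
        then have "rcpb_observe n (?u n z) = z"
          using sup by (blast intro: f_inv_into_f)
        then have "fractions n (?u n z) = fst z"
          by (metis fractions_def fst_conv rcpb_observe_def case_prod_beta)
        then show "f (fractions n (?u n z)) = f (fst z)" by simp
      qed
      then show ?case by (simp add: \<nu>_def)
    qed
    ultimately have "(\<lambda>n. measure_pmf.expectation (map_pmf fst (\<pi> n)) f) \<longlonglongrightarrow> f s_lim"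
      by (rule Lim_transform_eventually)
    then show "(\<lambda>n. measure_pmf.expectation (map_pmf fst (\<pi> n)) f)
        \<longlonglongrightarrow> measure_pmf.expectation (return_pmf (s_star reg lam)) f"
      by (simp add: s_lim_eq_s_star[OF p])
  qed
qed

end
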